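(* There exist universal constants $c_1, c_2 > 0$ (independent of $n$ and of $T$) such that the following holds. Let $n \geq 1$ and let $T \subseteq \mathbb{R}^n$ be a finite set. Let $s_b = s_b(T)$ be the minimum $s > 0$ such that for every symmetric convex body $K \subseteq \mathbb{R}^n$ with $\gamma_n(K) \geq 1/2$ we have $T \cap sK \neq \emptyset$, and let $s_g = s_g(T)$ be the minimum $s > 0$ such that there exists an $s$-subgaussian random vector $Y$ supported on $T$. Then $s_b \leq c_1 s_g$ and $s_g \leq c_2 s_b$.
   Context: $\gamma_n$ denotes the standard Gaussian measure on $\mathbb{R}^n$, i.e. $\gamma_n(A) = (2\pi)^{-n/2}\int_A e^{-\|x\|_2^2/2}\,dx$. A convex body is a closed convex set with non-empty interior; it is symmetric if $K = -K$. A random vector $Y \in \mathbb{R}^n$ is $s$-subgaussian ($s>0$) if for every unit vector $\theta \in S^{n-1}$ and every $t \geq 0$, $\Pr[|\langle Y, \theta\rangle| \geq t] \leq 2 e^{-(t/s)^2/2}$. *)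

theory Defs
  imports "HOL-Probability.Probability"
begin

text \<open>
  The constants in the theorem do not depend on the dimension \<open>n\<close>, so \<open>n\<close> is quantified inside the
  statement and cannot be a type. A vector in \<open>n\<close>-space is a function \<open>nat \<Rightarrow> real\<close> that is
  extensional on \<open>{..<n}\<close>: this set is both \<open>topspace (powertop_real {..<n})\<close> (product topology) and
  \<open>space (PiM {..<n} (\<lambda>_. lborel))\<close> (Lebesgue measure on the Borel sets).
\<close>

definition euclid :: "nat \<Rightarrow> (nat \<Rightarrow> real) set" where
  "euclid n = ({..<n} \<rightarrow>\<^sub>E UNIV)"

definition dotp :: "nat \<Rightarrow> (nat \<Rightarrow> real) \<Rightarrow> (nat \<Rightarrow> real) \<Rightarrow> real" where
  "dotp n x y = (\<Sum>i<n. x i * y i)"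

definition norm2 :: "nat \<Rightarrow> (nat \<Rightarrow> real) \<Rightarrow> real" where
  "norm2 n x = sqrt (dotp n x x)"

definition dilate :: "nat \<Rightarrow> real \<Rightarrow> (nat \<Rightarrow> real) set \<Rightarrow> (nat \<Rightarrow> real) set" where
  "dilate n s K = (\<lambda>x. \<lambda>i\<in>{..<n}. s * x i) ` K"

definition gauss :: "nat \<Rightarrow> (nat \<Rightarrow> real) measure" where
  "gauss n = density (PiM {..<n} (\<lambda>_. lborel))
     (\<lambda>x. ennreal ((2 * pi) powr (- real n / 2) * exp (- (norm2 n x)\<^sup>2 / 2)))"

definition convex_set :: "nat \<Rightarrow> (nat \<Rightarrow> real) set \<Rightarrow> bool" where
  "convex_set n K \<longleftrightarrow>
     (\<forall>x\<in>K. \<forall>y\<in>K. \<forall>u\<ge>0. \<forall>v\<ge>0. u + v = 1 \<longrightarrow> (\<lambda>i\<in>{..<n}. u * x i + v * y i) \<in> K)"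

definition convex_body :: "nat \<Rightarrow> (nat \<Rightarrow> real) set \<Rightarrow> bool" where
  "convex_body n K \<longleftrightarrow>
     closedin (powertop_real {..<n}) K \<and> convex_set n K \<and>
     powertop_real {..<n} interior_of K \<noteq> {}"

definition symmetric_body :: "nat \<Rightarrow> (nat \<Rightarrow> real) set \<Rightarrow> bool" where
  "symmetric_body n K \<longleftrightarrow> convex_body n K \<and> K = dilate n (-1) K"

definition random_vector :: "nat \<Rightarrow> 'a measure \<Rightarrow> ('a \<Rightarrow> nat \<Rightarrow> real) \<Rightarrow> bool" where
  "random_vector n M Y \<longleftrightarrow> prob_space M \<and> Y \<in> M \<rightarrow>\<^sub>M PiM {..<n} (\<lambda>_. borel)"

definition subgaussian :: "nat \<Rightarrow> real \<Rightarrow> 'a measure \<Rightarrow> ('a \<Rightarrow> nat \<Rightarrow> real) \<Rightarrow> bool" where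
  "subgaussian n s M Y \<longleftrightarrow> random_vector n M Y \<and>
     (\<forall>\<theta>\<in>euclid n. norm2 n \<theta> = 1 \<longrightarrow>
        (\<forall>t\<ge>0. measure M {\<omega> \<in> space M. \<bar>dotp n (Y \<omega>) \<theta>\<bar> \<ge> t} \<le> 2 * exp (- (t / s)\<^sup>2 / 2)))"

text \<open>
  Both minima are taken as infima in \<open>ereal\<close>. This is the minimum whenever the minimum exists; if
  the zero vector is in \<open>T\<close>, every \<open>s > 0\<close> is admissible and the value is \<open>0\<close>; if \<open>T\<close> is empty, no
  \<open>s\<close> is admissible and the value is \<open>\<infinity>\<close>.
\<close>

definition s_b :: "nat \<Rightarrow> (nat \<Rightarrow> real) set \<Rightarrow> ereal" where
  "s_b n T = Inf (ereal ` {s. s > 0 \<and>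
     (\<forall>K. symmetric_body n K \<and> measure (gauss n) K \<ge> 1/2 \<longrightarrow> T \<inter> dilate n s K \<noteq> {})})"

text \<open>
  Only the law of \<open>Y\<close> matters, so it is no restriction to let the probability space \<open>M\<close> live on the
  type of vectors.
\<close>

definition s_g :: "nat \<Rightarrow> (nat \<Rightarrow> real) set \<Rightarrow> ereal" where
  "s_g n T = Inf (ereal ` {s. s > 0 \<and>
     (\<exists>(M :: (nat \<Rightarrow> real) measure) Y. subgaussian n s M Y \<and> (AE \<omega> in M. Y \<omega> \<in> T))})"

end

theory Submission
  imports Defs
begin

text \<open>
  \<^emph>\<open>From bodies to vectors.\<close> If every large body meets \<open>T\<close> after dilation by \<open>s\<close>, this applies in
  particular to the sublevel sets of averages of \<open>x \<mapsto> exp (\<langle>x, \<theta>\<rangle>\<^sup>2 / 4)\<close> over unit vectors \<open>\<theta>\<close>, which are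
  large by Markov's inequality. A minimax argument turns this into one distribution on \<open>T\<close> with bounded
  exponential square moments in all directions.

  \<^emph>\<open>From vectors to bodies.\<close> If \<open>T\<close> misses a dilate of \<open>K\<close>, separating each point of \<open>T\<close> from it gives a
  finite set \<open>A\<close> of functionals, bounded by 1 on \<open>K\<close>, at least one of which is large at \<open>Y\<close>. Since \<open>K\<close> has
  measure at least \<open>1/2\<close>, the expectation \<open>g(A)\<close> of the Gaussian supremum over \<open>A\<close> is bounded by a
  constant, so it remains to bound the supremum of the subgaussian process over \<open>A\<close> by \<open>g(A)\<close>; this is
  Talagrand's comparison theorem. Partition \<open>A\<close> greedily into cells of radius \<open>a\<close>, always removing the
  ball around the point whose small ball has the largest \<open>g\<close>, and number the cells by \<open>1, 2, \<dots>\<close>.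
  By the Sudakov--Fernique inequality, the small balls in the cell number \<open>i\<close> have a value of \<open>g\<close>
  smaller by order \<open>a * sqrt (ln i)\<close>. Iterating at geometrically decreasing radii, these decrements
  telescope along each branch, and they are also what a union bound over the numbered branches
  costs for a subgaussian process.
\<close>

section \<open>Gaussian measure and linear functionals\<close>

text \<open>Concentration of measure, the usual tool for such bounds, is avoided. Super-Sudakov
  follows from Sudakov--Fernique by comparing with a process whose clusters are independent. The
  mean of the supremum is bounded by playing off rotated copies of the Gaussian vector: disjoint
  events give a tail of order 1/N, which is not integrable, and Fernique's rotation by 45 degrees
  squares it. Finiteness of \<open>T\<close> does two more things: the partition tree ends in
  singletons, and the union bound only has to leave an event of positive probability, since a single
  outcome with \<open>Y\<close> in \<open>T\<close> gives the contradiction. In the other direction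
  the set of unit vectors is infinite. Multiplicative weights only ask about averages over finitely
  many of them, repetitions allowed, and each such average defines one body. The constant 2 arises
  as follows: E exp(X^2/4) = sqrt 2 for a standard normal X, Markov doubles this, the minimax slack
  raises it to 3, and min(1, 3 q^2) <= 2 q trades the factor 3 for a doubled scale.\<close>

definition stdn :: "real measure" where
  "stdn = density lborel std_normal_density"

text \<open>The index type is arbitrary because the comparison process in
  \<open>super_sudakov\<close> lives on a sum type, one block for shifts and one for independent
  copies.\<close>

definition Gam :: "'a set \<Rightarrow> ('a \<Rightarrow> real) measure" where
  "Gam J = PiM J (\<lambda>_. stdn)"

definition lin :: "'a set \<Rightarrow> ('a \<Rightarrow> real) \<Rightarrow> ('a \<Rightarrow> real) \<Rightarrow> real" where
  "lin J v x = (\<Sum>j\<in>J. v j * x j)"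

lemma sets_stdn [simp, measurable_cong]: "sets stdn = sets borel"
  by (simp add: stdn_def)

lemma space_stdn [simp]: "space stdn = UNIV"
  by (simp add: stdn_def)

lemma prob_space_stdn: "prob_space stdn"
  unfolding stdn_def by (rule prob_space_normal_density) simp

interpretation stdn: prob_space stdn
  by (rule prob_space_stdn)

interpretation PG: product_prob_space "\<lambda>_. stdn" J for J
  by unfold_locales

lemma sets_Gam [simp, measurable_cong]: "sets (Gam J) = sets (PiM J (\<lambda>_. borel))"
  unfolding Gam_def by (intro sets_PiM_cong) auto

lemma space_Gam: "space (Gam J) = PiE J (\<lambda>_. UNIV)"
  unfolding Gam_def by (simp add: space_PiM)

lemma prob_space_Gam: "prob_space (Gam J)"
  unfolding Gam_def by (rule PG.P.prob_space_axioms)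

lemma lin_measurable [measurable]: "lin J v \<in> borel_measurable (PiM J (\<lambda>_. borel))"
  unfolding lin_def by measurable

text \<open>The density is a product of one-dimensional normal densities, so both measures agree on
  boxes. All later arguments use independent coordinates only.\<close>

lemma gauss_eq_Gam: "gauss n = Gam {..<n}"
  unfolding Gam_def
proof (rule PG.PiM_eqI)
  interpret L: product_sigma_finite "\<lambda>_::nat. lborel :: real measure" ..
  show "sets (gauss n) = sets (PiM {..<n} (\<lambda>_. stdn))"
    unfolding gauss_def sets_density by (intro sets_PiM_cong) auto
  fix A :: "nat \<Rightarrow> real set" assume "\<And>i. i \<in> {..<n} \<Longrightarrow> A i \<in> sets stdn"
  then have A: "\<And>i. i < n \<Longrightarrow> A i \<in> sets borel" by simp
  have AP [measurable]: "Pi\<^sub>E {..<n} A \<in> sets (PiM {..<n} (\<lambda>_. lborel))"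
    using A by (intro sets_PiM_I_finite) auto
  have dens: "(2 * pi) powr (- real n / 2) * exp (- (norm2 n x)\<^sup>2 / 2) = (\<Prod>i<n. std_normal_density (x i))"
    for x
  proof -
    have "(2 * pi) powr (- real n / 2) = (1 / sqrt (2*pi)) ^ n"
    proof -
      have "(2 * pi) powr (- real n / 2) = ((2*pi) powr (-1/2)) powr (real n)"
        by (simp add: powr_powr)
      also have "(2*pi) powr (-1/2) = 1 / sqrt (2*pi)"
        using powr_minus_divide[of "2*pi" "1/2"] by (simp add: powr_half_sqrt)
      finally show ?thesis by (simp add: powr_realpow)
    qed
    moreover have "(norm2 n x)\<^sup>2 = (\<Sum>i<n. (x i)\<^sup>2)"
      unfolding norm2_def dotp_def by (subst real_sqrt_pow2) (auto intro!: sum_nonneg simp: power2_eq_square)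
    moreover have "exp (- (\<Sum>i<n. (x i)\<^sup>2) / 2) = (\<Prod>i<n. exp (- (x i)\<^sup>2 / 2))"
      by (simp add: exp_sum[symmetric] sum_negf[symmetric] sum_divide_distrib)
    ultimately show ?thesis
      unfolding std_normal_density_def prod.distrib by simp
  qed
  have m [measurable]: "(\<lambda>x. ennreal (\<Prod>i<n. std_normal_density (x i))) \<in> borel_measurable (PiM {..<n} (\<lambda>_. lborel))"
    by measurable
  have "emeasure (gauss n) (Pi\<^sub>E {..<n} A) =
      (\<integral>\<^sup>+x. ennreal (\<Prod>i<n. std_normal_density (x i)) * indicator (Pi\<^sub>E {..<n} A) x \<partial>PiM {..<n} (\<lambda>_. lborel))"
    unfolding gauss_def dens by (rule emeasure_density) (use m AP in auto)
  also have "\<dots> = (\<integral>\<^sup>+x. (\<Prod>i<n. ennreal (std_normal_density (x i)) * indicator (A i) (x i)) \<partial>PiM {..<n} (\<lambda>_. lborel))"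
  proof (intro nn_integral_cong)
    fix x assume "x \<in> space (PiM {..<n} (\<lambda>_. lborel :: real measure))"
    then have "x \<in> extensional {..<n}" by (simp add: space_PiM PiE_def)
    then have "indicator (Pi\<^sub>E {..<n} A) x = (\<Prod>i<n. indicator (A i) (x i) :: ennreal)"
      by (auto simp: indicator_def PiE_def Pi_iff)
    then show "ennreal (\<Prod>i<n. std_normal_density (x i)) * indicator (Pi\<^sub>E {..<n} A) x =
      (\<Prod>i<n. ennreal (std_normal_density (x i)) * indicator (A i) (x i))"
      by (simp add: prod.distrib prod_ennreal)
  qed
  also have "\<dots> = (\<Prod>i<n. \<integral>\<^sup>+y. ennreal (std_normal_density y) * indicator (A i) y \<partial>lborel)"
    using A by (intro L.product_nn_integral_prod) auto
  also have "\<dots> = (\<Prod>i<n. emeasure stdn (A i))"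
    unfolding stdn_def using A by (intro prod.cong refl, subst emeasure_density) auto
  finally show "emeasure (gauss n) (Pi\<^sub>E {..<n} A) = (\<Prod>i<n. emeasure stdn (A i))" .
qed simp

lemma distributed_lin:
  assumes J: "finite J" and pos: "0 < (\<Sum>j\<in>J. (v j)\<^sup>2)"
  shows "distributed (Gam J) lborel (lin J v) (normal_density 0 (sqrt (\<Sum>j\<in>J. (v j)\<^sup>2)))"
proof -
  interpret prob_space "Gam J" by (rule prob_space_Gam)
  \<comment> \<open>The rule for sums of independent normals asks for positive deviations and a
    nonempty index set: zero coefficients are dropped, and \<open>pos\<close> leaves at least one
    coordinate.\<close>
  define J' where "J' = {j\<in>J. v j \<noteq> 0}"
  have J': "finite J'" "J' \<subseteq> J" using J by (auto simp: J'_def)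
  have ne: "J' \<noteq> {}"
  proof
    assume "J' = {}"
    then have "(\<Sum>j\<in>J. (v j)\<^sup>2) = 0" by (intro sum.neutral) (auto simp: J'_def)
    with pos show False by simp
  qed
  then have Jne: "J \<noteq> {}" using J' by auto
  have "indep_vars (\<lambda>_. borel) (\<lambda>j x. x j) J"
  proof (subst indep_vars_iff_distr_eq_PiM')
    show "J \<noteq> {}" by fact
    show "(\<lambda>x. x i) \<in> borel_measurable (Gam J)" if "i \<in> J" for i
      using that by measurable
    have "distr (Gam J) (PiM J (\<lambda>_. borel)) (\<lambda>x. \<lambda>i\<in>J. x i) = distr (Gam J) (Gam J) (\<lambda>x. x)"
      by (intro distr_cong) (auto simp: space_Gam PiE_def restrict_extensional extensional_restrict)
    also have "\<dots> = Gam J" by simp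
    also have "\<dots> = PiM J (\<lambda>i. distr (Gam J) borel (\<lambda>x. x i))"
      unfolding Gam_def
    proof (intro PiM_cong refl)
      fix i assume "i \<in> J"
      then have "distr (PiM J (\<lambda>_. stdn)) stdn (\<lambda>x. x i) = stdn"
        by (rule distr_PiM_component[OF prob_space_stdn])
      moreover have "distr (PiM J (\<lambda>_. stdn)) stdn (\<lambda>x. x i) = distr (PiM J (\<lambda>_. stdn)) borel (\<lambda>x. x i)"
        by (intro distr_cong) auto
      ultimately show "stdn = distr (PiM J (\<lambda>_. stdn)) borel (\<lambda>x. x i)" by simp
    qed
    finally show "distr (Gam J) (PiM J (\<lambda>_. borel)) (\<lambda>x. \<lambda>i\<in>J. x i) = PiM J (\<lambda>i. distr (Gam J) borel (\<lambda>x. x i))" .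
  qed
  then have "indep_vars (\<lambda>_. borel) (\<lambda>j x. x j) J'"
    using J' by (rule_tac indep_vars_subset)
  then have ind: "indep_vars (\<lambda>_. borel) (\<lambda>j x. v j * x j) J'"
    by (rule indep_vars_compose2[where X="\<lambda>j x. x j" and Y="\<lambda>j y. v j * y"]) auto
  have coord: "distributed (Gam J) lborel (\<lambda>x. x j) std_normal_density" if "j \<in> J" for j
  proof -
    have "distr (PiM J (\<lambda>_. stdn)) stdn (\<lambda>x. x j) = stdn"
      using that by (rule distr_PiM_component[OF prob_space_stdn])
    moreover have "distr (PiM J (\<lambda>_. stdn)) stdn (\<lambda>x. x j) = distr (PiM J (\<lambda>_. stdn)) lborel (\<lambda>x. x j)"
      by (intro distr_cong) auto
    moreover have "(\<lambda>x. x j) \<in> borel_measurable (Gam J)" using that by measurable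
    ultimately show ?thesis
      unfolding distributed_def Gam_def[symmetric] by (simp add: stdn_def)
  qed
  have "distributed (Gam J) lborel (\<lambda>x. v j * x j) (normal_density 0 \<bar>v j\<bar>)" if "j \<in> J'" for j
  proof -
    have "distributed (Gam J) lborel (\<lambda>x. 0 + v j * x j) (normal_density (0 + v j * 0) (\<bar>v j\<bar> * 1))"
      using that coord[of j] by (intro normal_density_affine) (auto simp: J'_def)
    then show ?thesis by simp
  qed
  from sum_indep_normal[OF J'(1) ne ind _ this]
  have "distributed (Gam J) lborel (\<lambda>x. \<Sum>i\<in>J'. v i * x i) (normal_density (\<Sum>i\<in>J'. 0) (sqrt (\<Sum>i\<in>J'. \<bar>v i\<bar>\<^sup>2)))"
    by (auto simp: J'_def)
  moreover have "(\<lambda>x. \<Sum>i\<in>J'. v i * x i) = lin J v"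
    unfolding lin_def J'_def fun_eq_iff by (intro allI sum.mono_neutral_left) (auto simp: J)
  moreover have "(\<Sum>i\<in>J'. \<bar>v i\<bar>\<^sup>2) = (\<Sum>i\<in>J. (v i)\<^sup>2)"
    unfolding J'_def power2_abs by (intro sum.mono_neutral_left) (auto simp: J)
  ultimately show ?thesis by simp
qed

lemma lin_eq_0_if:
  assumes J: "finite J" and "\<not> 0 < (\<Sum>j\<in>J. (v j)\<^sup>2)"
  shows "lin J v x = 0"
proof -
  have "(\<Sum>j\<in>J. (v j)\<^sup>2) = 0" using assms(2) sum_nonneg[of J "\<lambda>j. (v j)\<^sup>2"] by force
  then have "\<forall>j\<in>J. v j = 0" using J by (subst (asm) sum_nonneg_eq_0_iff) auto
  then show ?thesis by (simp add: lin_def)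
qed

lemma integrable_lin_abs_power:
  assumes J: "finite J"
  shows "integrable (Gam J) (\<lambda>x. \<bar>lin J v x\<bar> ^ k)"
proof (cases "0 < (\<Sum>j\<in>J. (v j)\<^sup>2)")
  case True
  have "integrable lborel (\<lambda>x. normal_density 0 (sqrt (\<Sum>j\<in>J. (v j)\<^sup>2)) x * \<bar>x\<bar> ^ k)"
    using integrable_normal_moment_abs[of "sqrt (\<Sum>j\<in>J. (v j)\<^sup>2)" 0 k] True by simp
  then show ?thesis
    using distributed_integrable[OF distributed_lin[OF J True], of "\<lambda>x. \<bar>x\<bar>^k"] by simp
next
  case False
  interpret prob_space "Gam J" by (rule prob_space_Gam)
  show ?thesis using lin_eq_0_if[OF J False] by simp
qed

lemma integrable_lin:
  assumes J: "finite J"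
  shows "integrable (Gam J) (lin J v)"
proof (rule integrable_abs_cancel)
  show "integrable (Gam J) (\<lambda>x. \<bar>lin J v x\<bar>)"
    using integrable_lin_abs_power[OF J, of v 1] by simp
qed measurable

lemma integrable_lin_sq:
  assumes J: "finite J"
  shows "integrable (Gam J) (\<lambda>x. (lin J v x)\<^sup>2)"
  using integrable_lin_abs_power[OF J, of v 2] by simp

lemma integral_lin:
  assumes J: "finite J"
  shows "(\<integral>x. lin J v x \<partial>Gam J) = 0"
proof (cases "0 < (\<Sum>j\<in>J. (v j)\<^sup>2)")
  case True
  interpret prob_space "Gam J" by (rule prob_space_Gam)
  show ?thesis
    using normal_distributed_expectation[OF _ distributed_lin[OF J True]] True by simp
qed (simp add: lin_eq_0_if[OF J])

lemma integral_lin_sq: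
  assumes J: "finite J"
  shows "(\<integral>x. (lin J v x)\<^sup>2 \<partial>Gam J) = (\<Sum>j\<in>J. (v j)\<^sup>2)"
proof (cases "0 < (\<Sum>j\<in>J. (v j)\<^sup>2)")
  case True
  interpret prob_space "Gam J" by (rule prob_space_Gam)
  show ?thesis
    using normal_distributed_variance[OF _ distributed_lin[OF J True]] True integral_lin[OF J, of v] by simp
next
  case False
  then have "(\<Sum>j\<in>J. (v j)\<^sup>2) = 0" using sum_nonneg[of J "\<lambda>j. (v j)\<^sup>2"] by force
  then show ?thesis using lin_eq_0_if[OF J False] by simp
qed

section \<open>Rotation invariance\<close>

lemma std_normal_rotation:
  assumes ab: "a\<^sup>2 + b\<^sup>2 = (1::real)"
  shows "std_normal_density (a * u - b * v) * std_normal_density (b * u + a * v) =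
         std_normal_density u * std_normal_density v"
proof -
  have "(a * u - b * v)\<^sup>2 + (b * u + a * v)\<^sup>2 = (a\<^sup>2 + b\<^sup>2) * (u\<^sup>2 + v\<^sup>2)"
    by algebra
  with ab have "(a * u - b * v)\<^sup>2 + (b * u + a * v)\<^sup>2 = u\<^sup>2 + v\<^sup>2" by simp
  then show ?thesis
    unfolding std_normal_density_def
    by (simp add: exp_add[symmetric] add_divide_distrib[symmetric] flip: minus_add_distrib)
qed

lemma nn_integral_stdn:
  assumes [measurable]: "f \<in> borel_measurable borel"
  shows "(\<integral>\<^sup>+x. f x \<partial>stdn) = (\<integral>\<^sup>+x. ennreal (std_normal_density x) * f x \<partial>lborel)"
  unfolding stdn_def by (subst nn_integral_density) auto

text \<open>Two one-dimensional affine substitutions do the rotation: u = a x + b y at fixed y,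
  then, after Fubini, y = b u + a v at fixed u. Their Jacobians 1/a and a cancel, and the product
  density is invariant by \<open>std_normal_rotation\<close>.\<close>

lemma nn_integral_rotation:
  assumes a: "0 < a" and ab: "a\<^sup>2 + b\<^sup>2 = (1::real)"
  and f [measurable]: "case_prod f \<in> borel_measurable (borel \<Otimes>\<^sub>M borel)"
  shows "(\<integral>\<^sup>+x. (\<integral>\<^sup>+y. f (a * x + b * y) (- b * x + a * y) \<partial>stdn) \<partial>stdn) =
         (\<integral>\<^sup>+x. (\<integral>\<^sup>+y. f x y \<partial>stdn) \<partial>stdn)"
proof -
  let ?p = "\<lambda>x. ennreal (std_normal_density x)"
  let ?H = "\<lambda>x y. ?p x * (?p y * f (a * x + b * y) (- b * x + a * y))"
  let ?G = "\<lambda>u y. ennreal (1/a) * (?p ((u - b * y) / a) * (?p y * f u ((y - b * u) / a)))"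
  have f2 [measurable (raw)]: "(\<lambda>w. f (g w) (h w)) \<in> borel_measurable N"
    if "g \<in> borel_measurable N" "h \<in> borel_measurable N" for g h :: "'z \<Rightarrow> real" and N
  proof -
    have "(\<lambda>w. (g w, h w)) \<in> N \<rightarrow>\<^sub>M borel \<Otimes>\<^sub>M borel" using that by measurable
    from measurable_compose[OF this f] show ?thesis by simp
  qed
  have "(\<integral>\<^sup>+x. (\<integral>\<^sup>+y. f (a * x + b * y) (- b * x + a * y) \<partial>stdn) \<partial>stdn) =
    (\<integral>\<^sup>+x. ?p x * (\<integral>\<^sup>+y. ?p y * f (a * x + b * y) (- b * x + a * y) \<partial>lborel) \<partial>lborel)"
    by (simp add: nn_integral_stdn)
  also have "\<dots> = (\<integral>\<^sup>+x. (\<integral>\<^sup>+y. ?H x y \<partial>lborel) \<partial>lborel)"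
    by (simp add: nn_integral_cmult)
  also have "\<dots> = (\<integral>\<^sup>+y. (\<integral>\<^sup>+x. ?H x y \<partial>lborel) \<partial>lborel)"
    by (rule lborel_pair.Fubini'[symmetric]) measurable
  also have "\<dots> = (\<integral>\<^sup>+y. (\<integral>\<^sup>+u. ?G u y \<partial>lborel) \<partial>lborel)"
  proof (rule nn_integral_cong)
    fix y
    have "(\<integral>\<^sup>+x. ?H x y \<partial>lborel) =
      ennreal \<bar>1/a\<bar> * (\<integral>\<^sup>+u. ?p (- b * y / a + 1/a * u) * (?p y * f (a * (- b * y / a + 1/a * u) + b * y)
         (- b * (- b * y / a + 1/a * u) + a * y)) \<partial>lborel)"
      by (rule nn_integral_real_affine) (use a in auto)
    also have "\<dots> = (\<integral>\<^sup>+u. ennreal (1/a) * (?p (- b * y / a + 1/a * u) * (?p y * f (a * (- b * y / a + 1/a * u) + b * y)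
         (- b * (- b * y / a + 1/a * u) + a * y))) \<partial>lborel)"
      using a by (subst nn_integral_cmult) auto
    also have "\<dots> = (\<integral>\<^sup>+u. ?G u y \<partial>lborel)"
    proof (rule nn_integral_cong)
      fix u
      have 1: "- b * y / a + 1/a * u = (u - b * y) / a" using a by (simp add: field_simps)
      have 2: "a * ((u - b * y) / a) + b * y = u" using a by (simp add: field_simps)
      have "- b * ((u - b * y) / a) + a * y = ((a\<^sup>2 + b\<^sup>2) * y - b * u) / a"
        using a by (simp add: field_simps power2_eq_square)
      then have 3: "- b * ((u - b * y) / a) + a * y = (y - b * u) / a" by (simp add: ab)
      show "ennreal (1/a) * (?p (- b * y / a + 1/a * u) * (?p y * f (a * (- b * y / a + 1/a * u) + b * y)
         (- b * (- b * y / a + 1/a * u) + a * y))) = ?G u y"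
        unfolding 1 2 3 ..
    qed
    finally show "(\<integral>\<^sup>+x. ?H x y \<partial>lborel) =
      (\<integral>\<^sup>+u. ?G u y \<partial>lborel)" .
  qed
  also have "\<dots> = (\<integral>\<^sup>+u. (\<integral>\<^sup>+y. ?G u y \<partial>lborel) \<partial>lborel)"
    by (rule lborel_pair.Fubini') measurable
  also have "\<dots> = (\<integral>\<^sup>+u. (\<integral>\<^sup>+v. ?p u * (?p v * f u v) \<partial>lborel) \<partial>lborel)"
  proof (rule nn_integral_cong)
    fix u
    have "(\<integral>\<^sup>+y. ?G u y \<partial>lborel) =
       ennreal \<bar>a\<bar> * (\<integral>\<^sup>+v. ?G u (b * u + a * v) \<partial>lborel)"
      by (rule nn_integral_real_affine) (use a in auto)
    also have "\<dots> = (\<integral>\<^sup>+v. ennreal a * (?G u (b * u + a * v)) \<partial>lborel)"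
      using a by (subst nn_integral_cmult) auto
    also have "\<dots> = (\<integral>\<^sup>+v. ?p u * (?p v * f u v) \<partial>lborel)"
    proof (rule nn_integral_cong)
      fix v
      have "(u - b * (b * u + a * v)) / a = ((1 - b\<^sup>2) * u - a * b * v) / a"
        by (simp add: algebra_simps power2_eq_square)
      also have "1 - b\<^sup>2 = a\<^sup>2" using ab by simp
      finally have 1: "(u - b * (b * u + a * v)) / a = a * u - b * v"
        using a by (simp add: field_simps power2_eq_square)
      have 2: "(b * u + a * v - b * u) / a = v" using a by simp
      have 3: "ennreal a * ennreal (1/a) = 1" using a by (simp add: ennreal_mult[symmetric])
      have 4: "?p (a * u - b * v) * ?p (b * u + a * v) = ?p u * ?p v"
        by (simp add: ennreal_mult[symmetric] std_normal_rotation[OF ab])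
      have "ennreal a * (ennreal (1/a) * (?p (a * u - b * v) * (?p (b * u + a * v) * f u v))) =
         (ennreal a * ennreal (1/a)) * (?p (a * u - b * v) * ?p (b * u + a * v)) * f u v"
        by (simp only: mult.assoc)
      then show "ennreal a * (?G u (b * u + a * v)) =
        ?p u * (?p v * f u v)"
        unfolding 1 2 3 4 by (simp add: mult.assoc)
    qed
    finally show "(\<integral>\<^sup>+y. ?G u y \<partial>lborel) =
       (\<integral>\<^sup>+v. ?p u * (?p v * f u v) \<partial>lborel)" .
  qed
  also have "\<dots> = (\<integral>\<^sup>+x. (\<integral>\<^sup>+y. f x y \<partial>stdn) \<partial>stdn)"
    by (simp add: nn_integral_stdn nn_integral_cmult)
  finally show ?thesis .
qed

lemma sigma_finite_Gam: "sigma_finite_measure (Gam J)"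
  using prob_space_Gam by (rule prob_space_imp_sigma_finite)

lemma pair_sigma_finite_Gam: "pair_sigma_finite (Gam J) (Gam K)"
  by (intro pair_sigma_finite.intro sigma_finite_Gam)

lemma nn_integral_Gam_insert:
  assumes J: "finite J" "i \<notin> J" and f: "f \<in> borel_measurable (PiM (insert i J) (\<lambda>_. borel))"
  shows "(\<integral>\<^sup>+x. f x \<partial>Gam (insert i J)) = (\<integral>\<^sup>+x. (\<integral>\<^sup>+u. f (x(i := u)) \<partial>stdn) \<partial>Gam J)"
proof -
  have "f \<in> borel_measurable (PiM (insert i J) (\<lambda>_. stdn))"
    using f by (simp cong: measurable_cong_sets add: sets_Gam[unfolded Gam_def])
  from PG.product_nn_integral_insert[OF J this] show ?thesis unfolding Gam_def .
qed

text \<open>The rotation mixes \<open>x j\<close> only with \<open>y j\<close>, so coordinates can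
  be split off one at a time: the pair at \<open>i\<close> is handled by the planar case, and the
  integral over that pair is the function to which the induction hypothesis is applied.\<close>

lemma nn_integral_Gam_rotation:
  fixes f :: "('a \<Rightarrow> real) \<Rightarrow> ('a \<Rightarrow> real) \<Rightarrow> ennreal"
  assumes a: "0 < a" and ab: "a\<^sup>2 + b\<^sup>2 = (1::real)"
  and J: "finite J"
  and f: "case_prod f \<in> borel_measurable (PiM J (\<lambda>_. borel) \<Otimes>\<^sub>M PiM J (\<lambda>_. borel))"
  shows "(\<integral>\<^sup>+x. (\<integral>\<^sup>+y. f (\<lambda>j\<in>J. a * x j + b * y j) (\<lambda>j\<in>J. - b * x j + a * y j) \<partial>Gam J) \<partial>Gam J) =
         (\<integral>\<^sup>+x. (\<integral>\<^sup>+y. f x y \<partial>Gam J) \<partial>Gam J)"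
  using J f
proof (induction J arbitrary: f rule: finite_induct)
  case empty
  have s: "x = (\<lambda>_. undefined)" if "x \<in> space (Gam {})" for x :: "'a \<Rightarrow> real"
    using that by (auto simp: space_Gam)
  show ?case
  proof (intro nn_integral_cong)
    fix x y :: "'a \<Rightarrow> real" assume "x \<in> space (Gam {})" "y \<in> space (Gam {})"
    then have "x = (\<lambda>_. undefined)" "y = (\<lambda>_. undefined)" by (auto intro: s)
    then show "f (\<lambda>j\<in>{}. a * x j + b * y j) (\<lambda>j\<in>{}. - b * x j + a * y j) = f x y"
      by (simp add: restrict_def)
  qed
next
  case (insert i J)
  let ?I = "insert i J"
  let ?B = "\<lambda>J. PiM J (\<lambda>_. borel :: real measure) :: ('a \<Rightarrow> real) measure"
  note f = insert.prems
  have f2 [measurable (raw)]: "(\<lambda>w. f (g w) (h w)) \<in> borel_measurable N"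
    if "g \<in> N \<rightarrow>\<^sub>M ?B ?I" "h \<in> N \<rightarrow>\<^sub>M ?B ?I" for g h and N :: "'z measure"
  proof -
    have "(\<lambda>w. (g w, h w)) \<in> N \<rightarrow>\<^sub>M ?B ?I \<Otimes>\<^sub>M ?B ?I" using that by measurable
    from measurable_compose[OF this f] show ?thesis by simp
  qed
  have upd [measurable (raw)]: "(\<lambda>w. (g w)(i := h w)) \<in> N \<rightarrow>\<^sub>M ?B ?I"
    if "g \<in> N \<rightarrow>\<^sub>M ?B J" "h \<in> borel_measurable N" for g h and N :: "'z measure"
    using that by (intro measurable_fun_upd[where J=J]) auto
  interpret sfG: sigma_finite_measure "Gam J" by (rule sigma_finite_Gam)
  interpret sfG': sigma_finite_measure "Gam ?I" by (rule sigma_finite_Gam)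
  interpret sfp: pair_sigma_finite "Gam J" stdn
    by (intro pair_sigma_finite.intro sigma_finite_Gam) unfold_locales
  let ?R = "\<lambda>J x y. \<lambda>j\<in>J. a * x j + b * y j" and ?S = "\<lambda>J x y. \<lambda>j\<in>J. - b * x j + a * y j"
  have R: "?R ?I (x(i := u)) (y(i := v)) = (?R J x y)(i := a * u + b * v)"
       "?S ?I (x(i := u)) (y(i := v)) = (?S J x y)(i := - b * u + a * v)" for x y u v
    using insert.hyps by (auto simp: fun_eq_iff restrict_def)
  have "(\<integral>\<^sup>+x. (\<integral>\<^sup>+y. f (?R ?I x y) (?S ?I x y) \<partial>Gam ?I) \<partial>Gam ?I) =
     (\<integral>\<^sup>+x. (\<integral>\<^sup>+u. (\<integral>\<^sup>+y. (\<integral>\<^sup>+v. f (?R ?I (x(i := u)) (y(i := v))) (?S ?I (x(i := u)) (y(i := v))) \<partial>stdn) \<partial>Gam J) \<partial>stdn) \<partial>Gam J)"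
    by (subst nn_integral_Gam_insert[OF insert.hyps], measurable,
        intro nn_integral_cong nn_integral_Gam_insert[OF insert.hyps]) measurable
  also have "\<dots> = (\<integral>\<^sup>+x. (\<integral>\<^sup>+y. (\<integral>\<^sup>+u. (\<integral>\<^sup>+v. f ((?R J x y)(i := a * u + b * v)) ((?S J x y)(i := - b * u + a * v)) \<partial>stdn) \<partial>stdn) \<partial>Gam J) \<partial>Gam J)"
    unfolding R by (intro nn_integral_cong sfp.Fubini') measurable
  also have "\<dots> = (\<integral>\<^sup>+x. (\<integral>\<^sup>+y. (\<integral>\<^sup>+u. (\<integral>\<^sup>+v. f ((?R J x y)(i := u)) ((?S J x y)(i := v)) \<partial>stdn) \<partial>stdn) \<partial>Gam J) \<partial>Gam J)"
    by (intro nn_integral_cong nn_integral_rotation[OF a ab]) measurable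
  also have "\<dots> = (\<integral>\<^sup>+x. (\<integral>\<^sup>+y. (\<integral>\<^sup>+u. (\<integral>\<^sup>+v. f (x(i := u)) (y(i := v)) \<partial>stdn) \<partial>stdn) \<partial>Gam J) \<partial>Gam J)"
    by (rule insert.IH[where f = "\<lambda>x y. (\<integral>\<^sup>+u. (\<integral>\<^sup>+v. f (x(i := u)) (y(i := v)) \<partial>stdn) \<partial>stdn)"]) measurable
  also have "\<dots> = (\<integral>\<^sup>+x. (\<integral>\<^sup>+u. (\<integral>\<^sup>+y. (\<integral>\<^sup>+v. f (x(i := u)) (y(i := v)) \<partial>stdn) \<partial>Gam J) \<partial>stdn) \<partial>Gam J)"
  proof (intro nn_integral_cong)
    fix x assume "x \<in> space (Gam J)"
    then have [simp]: "x \<in> space (?B J)" by (simp add: space_Gam space_PiM)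
    show "(\<integral>\<^sup>+y. (\<integral>\<^sup>+u. (\<integral>\<^sup>+v. f (x(i := u)) (y(i := v)) \<partial>stdn) \<partial>stdn) \<partial>Gam J) =
      (\<integral>\<^sup>+u. (\<integral>\<^sup>+y. (\<integral>\<^sup>+v. f (x(i := u)) (y(i := v)) \<partial>stdn) \<partial>Gam J) \<partial>stdn)"
      by (rule sfp.Fubini'[symmetric]) measurable
  qed
  also have "\<dots> = (\<integral>\<^sup>+x. (\<integral>\<^sup>+y. f x y \<partial>Gam ?I) \<partial>Gam ?I)"
  proof -
    have [simp]: "x(i := u) \<in> space (?B ?I)" if "x \<in> space (Gam J)" for x u
      using that by (auto simp: space_Gam space_PiM PiE_iff extensional_def)
    show ?thesis
      by (subst nn_integral_Gam_insert[OF insert.hyps], measurable,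
        intro nn_integral_cong nn_integral_Gam_insert[OF insert.hyps, symmetric]) measurable
  qed
  finally show ?case .
qed

lemma distr_Gam_rotation:
  assumes a: "0 < a" and ab: "a\<^sup>2 + b\<^sup>2 = (1::real)" and J: "finite J"
  shows "distr (Gam J \<Otimes>\<^sub>M Gam J) (Gam J \<Otimes>\<^sub>M Gam J)
     (\<lambda>(x, y). (\<lambda>j\<in>J. a * x j + b * y j, \<lambda>j\<in>J. - b * x j + a * y j)) = Gam J \<Otimes>\<^sub>M Gam J" (is "distr ?P ?P ?R = ?P")
proof (rule measure_eqI)
  interpret sfG: sigma_finite_measure "Gam J" by (rule sigma_finite_Gam)
  have R [measurable]: "?R \<in> ?P \<rightarrow>\<^sub>M ?P" by measurable
  fix A assume "A \<in> sets (distr ?P ?P ?R)"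
  then have A [measurable]: "A \<in> sets ?P" by simp
  have "sets ?P = sets (PiM J (\<lambda>_. borel) \<Otimes>\<^sub>M PiM J (\<lambda>_. borel))"
    by (intro sets_pair_measure_cong) simp_all
  then have [measurable]: "A \<in> sets (PiM J (\<lambda>_. borel) \<Otimes>\<^sub>M PiM J (\<lambda>_. borel))"
    using A by simp
  have "emeasure (distr ?P ?P ?R) A = (\<integral>\<^sup>+z. indicator A (?R z) \<partial>?P)"
    using nn_integral_distr[OF R, of "indicator A"] A by simp
  also have "\<dots> = (\<integral>\<^sup>+x. (\<integral>\<^sup>+y. indicator A (\<lambda>j\<in>J. a * x j + b * y j, \<lambda>j\<in>J. - b * x j + a * y j) \<partial>Gam J) \<partial>Gam J)"
    by (subst sfG.nn_integral_fst[symmetric]) auto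
  also have "\<dots> = (\<integral>\<^sup>+x. (\<integral>\<^sup>+y. indicator A (x, y) \<partial>Gam J) \<partial>Gam J)"
    by (rule nn_integral_Gam_rotation[OF a ab J, where f="\<lambda>x y. indicator A (x, y)"]) measurable
  also have "\<dots> = emeasure ?P A"
    by (subst sfG.nn_integral_fst) auto
  finally show "emeasure (distr ?P ?P ?R) A = emeasure ?P A" .
qed simp

lemma distr_Gam_combination:
  assumes a: "0 < a" and ab: "a\<^sup>2 + b\<^sup>2 = (1::real)" and J: "finite J"
  shows "distr (Gam J \<Otimes>\<^sub>M Gam J) (Gam J) (\<lambda>(x, y). \<lambda>j\<in>J. a * x j + b * y j) = Gam J"
proof -
  let ?P = "Gam J \<Otimes>\<^sub>M Gam J"
  let ?R = "\<lambda>(x, y). (\<lambda>j\<in>J. a * x j + b * y j, \<lambda>j\<in>J. - b * x j + a * y j)"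
  have R: "?R \<in> ?P \<rightarrow>\<^sub>M ?P" by measurable
  have "distr ?P (Gam J) (\<lambda>(x, y). \<lambda>j\<in>J. a * x j + b * y j) = distr ?P (Gam J) (fst \<circ> ?R)"
    by (intro distr_cong) auto
  also have "\<dots> = distr (distr ?P ?P ?R) (Gam J) fst"
    using R by (intro distr_distr[symmetric]) auto
  also have "\<dots> = distr ?P (Gam J) fst"
    by (simp only: distr_Gam_rotation[OF a ab J])
  also have "\<dots> = Gam J"
    by (rule prob_space.distr_pair_fst) (rule prob_space_Gam)+
  finally show ?thesis .
qed

section \<open>The log-sum-exp function\<close>

lemma Max_image_attained:
  assumes "finite I" "I \<noteq> {}"
  shows "\<exists>i\<in>I. Max (f ` I) = f i"
proof -
  have "Max (f ` I) \<in> f ` I" using assms by (intro Max_in) simp_all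
  then show ?thesis by blast
qed

text \<open>Third-order Maclaurin formula, evaluated at t = 1, for the cumulant generating function
  of \<open>h\<close> under the weights \<open>p\<close>. Its derivatives are cumulants of the law
  tilted by exp(t h); the third is at most 6 H^3 with H the maximum of |h|, and the 6 cancels
  against \<open>fact 3\<close>.\<close>

lemma ln_mgf_taylor:
  fixes h p :: "'i \<Rightarrow> real"
  assumes I: "finite I" "I \<noteq> {}" and p: "\<And>i. i \<in> I \<Longrightarrow> 0 < p i" "(\<Sum>i\<in>I. p i) = 1"
  shows "\<bar>ln (\<Sum>i\<in>I. p i * exp (h i)) - (\<Sum>i\<in>I. p i * h i)
    - ((\<Sum>i\<in>I. p i * (h i)\<^sup>2) - (\<Sum>i\<in>I. p i * h i)\<^sup>2) / 2\<bar> \<le> (\<Sum>i\<in>I. \<bar>h i\<bar> ^ 3)"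
proof -
  define S where "S k t = (\<Sum>i\<in>I. p i * h i ^ k * exp (t * h i))" for k :: nat and t
  define H where "H = Max ((\<lambda>i. \<bar>h i\<bar>) ` I)"
  have H: "\<bar>h i\<bar> \<le> H" if "i \<in> I" for i unfolding H_def using I that by (intro Max_ge) auto
  obtain i0 where i0: "i0 \<in> I" "H = \<bar>h i0\<bar>"
    using Max_image_attained[OF I, of "\<lambda>i. \<bar>h i\<bar>"] unfolding H_def by blast
  have H0: "0 \<le> H" using i0 by simp
  have H3: "H ^ 3 \<le> (\<Sum>i\<in>I. \<bar>h i\<bar> ^ 3)"
    unfolding i0(2) using i0(1) I(1) by (intro member_le_sum) simp_all
  have dS: "(S k has_real_derivative S (Suc k) t) (at t)" for k t
    unfolding S_def
  proof (rule DERIV_sum)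
    fix i
    have "((\<lambda>t. exp (t * h i)) has_real_derivative exp (t * h i) * h i) (at t)"
      by (auto intro!: derivative_eq_intros)
    from DERIV_cmult[OF this, of "p i * h i ^ k"]
    show "((\<lambda>t. p i * h i ^ k * exp (t * h i)) has_real_derivative p i * h i ^ Suc k * exp (t * h i)) (at t)"
      by (simp add: mult_ac)
  qed
  have S0: "0 < S 0 t" for t unfolding S_def using I p by (intro sum_pos) auto
  have SB: "\<bar>S k t / S 0 t\<bar> \<le> H ^ k" for k t
  proof -
    have "\<bar>S k t\<bar> \<le> (\<Sum>i\<in>I. \<bar>p i * h i ^ k * exp (t * h i)\<bar>)"
      unfolding S_def by (rule sum_abs)
    also have "\<dots> \<le> (\<Sum>i\<in>I. H ^ k * (p i * exp (t * h i)))"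
    proof (rule sum_mono)
      fix i assume i: "i \<in> I"
      have "\<bar>h i\<bar> ^ k \<le> H ^ k" using H[OF i] by (intro power_mono) auto
      then have "p i * \<bar>h i\<bar> ^ k * exp (t * h i) \<le> p i * H ^ k * exp (t * h i)"
        using p(1)[OF i] by (intro mult_right_mono mult_left_mono) auto
      then show "\<bar>p i * h i ^ k * exp (t * h i)\<bar> \<le> H ^ k * (p i * exp (t * h i))"
        using p(1)[OF i] by (simp add: abs_mult power_abs mult_ac)
    qed
    also have "\<dots> = H ^ k * S 0 t" unfolding S_def by (simp add: sum_distrib_left)
    finally have "\<bar>S k t\<bar> / S 0 t \<le> H ^ k" using S0[of t] by (simp only: pos_divide_le_eq)
    then show ?thesis using S0[of t] by (simp add: abs_divide)
  qed
  define R where "R k t = S k t / S 0 t" for k :: nat and t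
  \<comment> \<open>Cumulant generating function, then mean, variance and third cumulant of the
    tilted law, written in its raw moments \<open>R k\<close>.\<close>
  define q where "q = (\<lambda>m::nat. if m = 0 then (\<lambda>t. ln (S 0 t)) else if m = 1 then R 1
     else if m = 2 then (\<lambda>t. R 2 t - (R 1 t)\<^sup>2)
     else (\<lambda>t. R 3 t - 3 * (R 1 t) * (R 2 t) + 2 * (R 1 t) ^ 3))"
  have dR: "(R k has_real_derivative (R (Suc k) t - R k t * R 1 t)) (at t)" for k t
  proof -
    have "((\<lambda>t. S k t / S 0 t) has_real_derivative ((S (Suc k) t * S 0 t - S k t * S (Suc 0) t) / (S 0 t * S 0 t))) (at t)"
      by (rule DERIV_divide[OF dS dS]) (use S0[of t] in auto)
    moreover have "(S (Suc k) t * S 0 t - S k t * S (Suc 0) t) / (S 0 t * S 0 t) = S (Suc k) t / S 0 t - (S k t / S 0 t) * (S 1 t / S 0 t)"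
      using S0[of t] by (simp add: diff_divide_distrib)
    ultimately show ?thesis unfolding R_def by (simp only: One_nat_def)
  qed
  have dR1: "(R 1 has_real_derivative (R 2 t - R 1 t * R 1 t)) (at t)" for t
    using dR[of 1 t] by (simp add: numeral_2_eq_2)
  have dR2: "(R 2 has_real_derivative (R 3 t - R 2 t * R 1 t)) (at t)" for t
    using dR[of 2 t] by (simp add: numeral_3_eq_3)
  have dq: "(q m has_real_derivative q (Suc m) t) (at t)" if "m < 3" for m :: nat and t
  proof -
    have "m = 0 \<or> m = 1 \<or> m = 2" using that by linarith
    then consider "m = 0" | "m = 1" | "m = 2" by blast
    then show ?thesis
    proof cases
      case 1
      have "((\<lambda>t. ln (S 0 t)) has_real_derivative (1 / S 0 t * S (Suc 0) t)) (at t)"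
        using S0[of t] by (intro DERIV_chain2[OF DERIV_ln_divide dS]) auto
      then show ?thesis using 1 by (simp add: q_def R_def)
    next
      case 2
      show ?thesis using dR1[of t] 2 by (simp add: q_def power2_eq_square)
    next
      case 3
      have "((\<lambda>t. R 2 t - R 1 t * R 1 t) has_real_derivative
        (R 3 t - R 2 t * R 1 t) - ((R 2 t - R 1 t * R 1 t) * R 1 t + (R 2 t - R 1 t * R 1 t) * R 1 t)) (at t)"
        by (intro DERIV_diff DERIV_mult dR1 dR2)
      then show ?thesis using 3 by (simp add: q_def algebra_simps power2_eq_square power3_eq_cube)
    qed
  qed
  have "\<exists>t>0. t < 1 \<and> q 0 1 = (\<Sum>m<3. q m 0 / fact m * 1 ^ m) + q 3 t / fact 3 * 1 ^ 3"
    by (rule Maclaurin) (use dq in auto)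
  then obtain t where t: "q 0 1 = (\<Sum>m<3. q m 0 / fact m * 1 ^ m) + q 3 t / fact 3 * 1 ^ 3" by blast
  have q3: "\<bar>q 3 t\<bar> \<le> 6 * H ^ 3"
  proof -
    define a b c where "a = R 1 t" and "b = R 2 t" and "c = R 3 t"
    have B: "\<bar>a\<bar> \<le> H" "\<bar>b\<bar> \<le> H\<^sup>2" "\<bar>c\<bar> \<le> H ^ 3"
      using SB[of 1 t] SB[of 2 t] SB[of 3 t] by (auto simp: a_def b_def c_def R_def)
    have "\<bar>a * b\<bar> \<le> H * H\<^sup>2" unfolding abs_mult using B H0 by (intro mult_mono) auto
    moreover have "\<bar>a ^ 3\<bar> \<le> H ^ 3" unfolding power_abs using B by (intro power_mono) auto
    moreover have "q 3 t = c - 3 * (a * b) + 2 * a ^ 3"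
      by (simp add: q_def a_def b_def c_def)
    moreover have "H * H\<^sup>2 = H ^ 3" by (simp add: power2_eq_square power3_eq_cube)
    ultimately show ?thesis using B by linarith
  qed
  have Z: "S 0 0 = 1" "S 1 0 = (\<Sum>i\<in>I. p i * h i)" "S 2 0 = (\<Sum>i\<in>I. p i * (h i)\<^sup>2)"
    using p by (simp_all add: S_def)
  have "q 0 1 = S 1 0 + (S 2 0 - (S 1 0)\<^sup>2) / 2 + q 3 t / 6"
  proof -
    have "(\<Sum>m<3. f m) = f 0 + f 1 + f (2::nat)" for f :: "nat \<Rightarrow> real"
      by (simp add: numeral_3_eq_3 numeral_2_eq_2)
    moreover have "q 0 0 = 0" "q 1 0 = S 1 0" "q 2 0 = S 2 0 - (S 1 0)\<^sup>2"
      by (simp_all add: q_def R_def Z(1))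
    moreover have "fact 2 = (2::real)" "fact 3 = (6::real)" by (simp_all add: fact_numeral)
    ultimately show ?thesis using t by simp
  qed
  moreover have "q 0 1 = ln (\<Sum>i\<in>I. p i * exp (h i))"
    by (simp add: q_def S_def)
  ultimately show ?thesis using q3 H3 unfolding Z by linarith
qed

lemma variance_eq_pairs:
  fixes h p :: "'i \<Rightarrow> real"
  assumes "(\<Sum>i\<in>I. p i) = 1"
  shows "(\<Sum>i\<in>I. p i * (h i)\<^sup>2) - (\<Sum>i\<in>I. p i * h i)\<^sup>2 = (\<Sum>i\<in>I. \<Sum>j\<in>I. p i * p j * (h i - h j)\<^sup>2) / 2"
proof -
  have "(\<Sum>i\<in>I. \<Sum>j\<in>I. p i * p j * (h i - h j)\<^sup>2) =
     (\<Sum>i\<in>I. \<Sum>j\<in>I. (p i * (h i)\<^sup>2) * p j) + (\<Sum>i\<in>I. \<Sum>j\<in>I. p i * (p j * (h j)\<^sup>2)) - 2 * (\<Sum>i\<in>I. \<Sum>j\<in>I. (p i * h i) * (p j * h j))"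
    by (simp add: power2_diff algebra_simps sum.distrib sum_subtractf sum_distrib_left power2_eq_square)
  also have "\<dots> = 2 * ((\<Sum>i\<in>I. p i * (h i)\<^sup>2) - (\<Sum>i\<in>I. p i * h i)\<^sup>2)"
    unfolding sum_product[symmetric] by (simp add: assms power2_eq_square)
  finally show ?thesis by simp
qed

text \<open>Smooth surrogate for the maximum over \<open>I\<close>; \<open>lse_bounds\<close> shows
  that the error vanishes as \<beta> grows.\<close>

definition lse :: "'i set \<Rightarrow> real \<Rightarrow> ('i \<Rightarrow> real) \<Rightarrow> real" where
  "lse I \<beta> z = ln (\<Sum>i\<in>I. exp (\<beta> * z i)) / \<beta>"

lemma lse_bounds:
  assumes I: "finite I" "I \<noteq> {}" and b: "0 < \<beta>"
  shows "Max (z ` I) \<le> lse I \<beta> z" "lse I \<beta> z \<le> Max (z ` I) + ln (card I) / \<beta>"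
proof -
  obtain i0 where i0: "i0 \<in> I" "Max (z ` I) = z i0"
    using Max_image_attained[OF I, of z] by blast
  have "exp (\<beta> * z i0) \<le> (\<Sum>i\<in>I. exp (\<beta> * z i))"
    by (rule member_le_sum) (use i0 I in auto)
  then have "\<beta> * z i0 \<le> ln (\<Sum>i\<in>I. exp (\<beta> * z i))"
    using I by (subst ln_ge_iff) (auto intro: sum_pos)
  then show "Max (z ` I) \<le> lse I \<beta> z"
    using b by (simp add: lse_def i0 field_simps)
  have "(\<Sum>i\<in>I. exp (\<beta> * z i)) \<le> (\<Sum>i\<in>I. exp (\<beta> * Max (z ` I)))"
    using b I by (intro sum_mono) auto
  also have "\<dots> = exp (ln (card I) + \<beta> * Max (z ` I))"
    using I by (simp add: exp_add card_gt_0_iff)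
  finally have "ln (\<Sum>i\<in>I. exp (\<beta> * z i)) \<le> ln (card I) + \<beta> * Max (z ` I)"
    using I by (subst ln_exp[symmetric], subst ln_le_cancel_iff) (auto intro: sum_pos)
  then show "lse I \<beta> z \<le> Max (z ` I) + ln (card I) / \<beta>"
    using b by (simp add: lse_def field_simps)
qed

lemma lse_mono_shift:
  assumes I: "finite I" "I \<noteq> {}" and b: "0 < \<beta>" and le: "\<And>i. i \<in> I \<Longrightarrow> z i \<le> z' i + c"
  shows "lse I \<beta> z \<le> lse I \<beta> z' + c"
proof -
  have "(\<Sum>i\<in>I. exp (\<beta> * z i)) \<le> (\<Sum>i\<in>I. exp (\<beta> * (z' i + c)))"
    using b le by (intro sum_mono) auto
  also have "\<dots> = exp (\<beta> * c) * (\<Sum>i\<in>I. exp (\<beta> * z' i))"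
    by (simp add: exp_add algebra_simps sum_distrib_left)
  finally have "ln (\<Sum>i\<in>I. exp (\<beta> * z i)) \<le> ln (exp (\<beta> * c) * (\<Sum>i\<in>I. exp (\<beta> * z' i)))"
    using I by (subst ln_le_cancel_iff) (auto intro!: sum_pos mult_pos_pos)
  also have "\<dots> = \<beta> * c + ln (\<Sum>i\<in>I. exp (\<beta> * z' i))"
    using I sum_pos[of I "\<lambda>i. exp (\<beta> * z' i)"] by (subst ln_mult) auto
  finally show ?thesis using b by (simp add: lse_def field_simps)
qed

text \<open>The class of functions in which the replacement argument runs: large enough to contain
  \<open>lse\<close>, stable under Gaussian averaging, and Lipschitz in the l1 sense so that every
  Gaussian expectation exists.\<close>

definition Lip :: "'i set \<Rightarrow> (('i \<Rightarrow> real) \<Rightarrow> real) \<Rightarrow> bool" where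
  "Lip I f \<longleftrightarrow> f \<in> borel_measurable (PiM UNIV (\<lambda>_. borel)) \<and> (\<forall>z z'. f z \<le> f z' + (\<Sum>i\<in>I. \<bar>z i - z' i\<bar>))"

lemma Lip_lse:
  assumes I: "finite I" "I \<noteq> {}" and b: "0 < \<beta>"
  shows "Lip I (lse I \<beta>)"
  unfolding Lip_def
proof (intro conjI allI)
  show "lse I \<beta> \<in> borel_measurable (PiM UNIV (\<lambda>_. borel))"
    unfolding lse_def by measurable
  fix z z' :: "'a \<Rightarrow> real"
  show "lse I \<beta> z \<le> lse I \<beta> z' + (\<Sum>i\<in>I. \<bar>z i - z' i\<bar>)"
  proof (rule lse_mono_shift[OF I b])
    fix i assume "i \<in> I"
    then have "\<bar>z i - z' i\<bar> \<le> (\<Sum>i\<in>I. \<bar>z i - z' i\<bar>)"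
      using I by (intro member_le_sum) auto
    then show "z i \<le> z' i + (\<Sum>i\<in>I. \<bar>z i - z' i\<bar>)" by linarith
  qed
qed

text \<open>Here \<open>p\<close> are the Gibbs weights at \<open>z\<close>. The variance in
  \<open>ln_mgf_taylor\<close> is rewritten through pairs by \<open>variance_eq_pairs\<close>; this
  is why only the increments of the two Gaussian families will have to be compared.\<close>

lemma lse_expansion:
  assumes I: "finite I" "I \<noteq> {}" and b: "0 < \<beta>"
  defines "p \<equiv> \<lambda>z i. exp (\<beta> * z i) / (\<Sum>i\<in>I. exp (\<beta> * z i))"
  shows "\<bar>lse I \<beta> (\<lambda>i. z i + h i) - (lse I \<beta> z + (\<Sum>i\<in>I. p z i * h i)
     + \<beta> / 4 * (\<Sum>i\<in>I. \<Sum>j\<in>I. p z i * p z j * (h i - h j)\<^sup>2))\<bar> \<le> \<beta>\<^sup>2 * (\<Sum>i\<in>I. \<bar>h i\<bar> ^ 3)"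
proof -
  let ?S = "\<Sum>i\<in>I. exp (\<beta> * z i)"
  have S: "0 < ?S" using I by (intro sum_pos) auto
  have p1: "(\<Sum>i\<in>I. p z i) = 1" unfolding p_def sum_divide_distrib[symmetric] using S by simp
  have p0: "0 < p z i" for i unfolding p_def using S by simp
  let ?h = "\<lambda>i. \<beta> * h i"
  have T: "\<bar>ln (\<Sum>i\<in>I. p z i * exp (?h i)) - (\<Sum>i\<in>I. p z i * ?h i)
    - ((\<Sum>i\<in>I. \<Sum>j\<in>I. p z i * p z j * (?h i - ?h j)\<^sup>2) / 2) / 2\<bar> \<le> (\<Sum>i\<in>I. \<bar>?h i\<bar> ^ 3)"
    using ln_mgf_taylor[OF I p0 p1, of ?h] variance_eq_pairs[OF p1, of ?h] by simp
  have 1: "(\<Sum>i\<in>I. exp (\<beta> * (z i + h i))) = ?S * (\<Sum>i\<in>I. p z i * exp (?h i))"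
    using S by (simp add: sum_distrib_left p_def exp_add distrib_left)
  have 2: "0 < (\<Sum>i\<in>I. p z i * exp (?h i))" using I p0 by (intro sum_pos) auto
  have 3: "lse I \<beta> (\<lambda>i. z i + h i) = lse I \<beta> z + ln (\<Sum>i\<in>I. p z i * exp (?h i)) / \<beta>"
    unfolding lse_def 1 using S 2 by (simp add: ln_mult_pos add_divide_distrib)
  have 4: "(\<Sum>i\<in>I. p z i * ?h i) = \<beta> * (\<Sum>i\<in>I. p z i * h i)"
    by (simp add: sum_distrib_left mult_ac)
  have 5: "(\<Sum>i\<in>I. \<Sum>j\<in>I. p z i * p z j * (?h i - ?h j)\<^sup>2) = \<beta>\<^sup>2 * (\<Sum>i\<in>I. \<Sum>j\<in>I. p z i * p z j * (h i - h j)\<^sup>2)"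
    by (simp add: sum_distrib_left right_diff_distrib[symmetric] power_mult_distrib mult_ac)
  have 6: "(\<Sum>i\<in>I. \<bar>?h i\<bar> ^ 3) = \<beta> ^ 3 * (\<Sum>i\<in>I. \<bar>h i\<bar> ^ 3)"
    using b by (simp add: sum_distrib_left abs_mult power_mult_distrib)
  let ?L = "ln (\<Sum>i\<in>I. p z i * exp (?h i))" and ?A = "\<Sum>i\<in>I. p z i * h i"
    and ?B = "\<Sum>i\<in>I. \<Sum>j\<in>I. p z i * p z j * (h i - h j)\<^sup>2" and ?C = "\<Sum>i\<in>I. \<bar>h i\<bar> ^ 3"
  have "\<bar>?L - \<beta> * ?A - \<beta>\<^sup>2 * ?B / 4\<bar> \<le> \<beta> ^ 3 * ?C"
    using T unfolding 4 5 6 by simp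
  then have "\<bar>?L - \<beta> * ?A - \<beta>\<^sup>2 * ?B / 4\<bar> / \<beta> \<le> \<beta> ^ 3 * ?C / \<beta>"
    using b by (intro divide_right_mono) auto
  moreover have "\<bar>?L - \<beta> * ?A - \<beta>\<^sup>2 * ?B / 4\<bar> / \<beta> = \<bar>?L / \<beta> - ?A - \<beta> / 4 * ?B\<bar>"
  proof -
    have "\<bar>?L - \<beta> * ?A - \<beta>\<^sup>2 * ?B / 4\<bar> / \<beta> = \<bar>(?L - \<beta> * ?A - \<beta>\<^sup>2 * ?B / 4) / \<beta>\<bar>"
      using b by simp
    also have "(?L - \<beta> * ?A - \<beta>\<^sup>2 * ?B / 4) / \<beta> = ?L / \<beta> - ?A - \<beta> / 4 * ?B"
      using b by (simp add: diff_divide_distrib power2_eq_square)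
    finally show ?thesis .
  qed
  moreover have "\<beta> ^ 3 * ?C / \<beta> = \<beta>\<^sup>2 * ?C" using b by (simp add: power2_eq_square power3_eq_cube)
  ultimately have "\<bar>?L / \<beta> - ?A - \<beta> / 4 * ?B\<bar> \<le> \<beta>\<^sup>2 * ?C" by simp
  then show ?thesis unfolding 3 by (simp add: algebra_simps)
qed

section \<open>Gaussian comparison\<close>

text \<open>Heat-flow operator: the expectation of \<open>f\<close> at \<open>z\<close> plus
  \<open>c\<close> times the centred Gaussian family with coefficient vectors
  \<open>v i\<close>.\<close>

definition smear :: "'a set \<Rightarrow> real \<Rightarrow> ('i \<Rightarrow> 'a \<Rightarrow> real) \<Rightarrow> (('i \<Rightarrow> real) \<Rightarrow> real) \<Rightarrow> ('i \<Rightarrow> real) \<Rightarrow> real" where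
  "smear J c v f z = (\<integral>x. f (\<lambda>i. z i + c * lin J (v i) x) \<partial>Gam J)"

lemma measurable_lin_compose [measurable (raw)]:
  assumes "g \<in> N \<rightarrow>\<^sub>M PiM J (\<lambda>_. borel)"
  shows "(\<lambda>w. lin J v (g w)) \<in> borel_measurable N"
  using measurable_compose[OF assms lin_measurable] .

lemma measurable_Lip_compose:
  assumes "Lip I f" "\<And>i. (\<lambda>w. g w i) \<in> borel_measurable N"
  shows "(\<lambda>w. f (g w)) \<in> borel_measurable N"
proof -
  have "g \<in> N \<rightarrow>\<^sub>M PiM UNIV (\<lambda>_. borel)"
    using assms(2) by (intro measurable_PiM_single') auto
  moreover have "f \<in> borel_measurable (PiM UNIV (\<lambda>_. borel))"
    using assms(1) by (simp add: Lip_def)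
  ultimately show ?thesis by (rule measurable_compose)
qed

lemma LipD:
  assumes "Lip I f"
  shows "\<bar>f z - f z'\<bar> \<le> (\<Sum>i\<in>I. \<bar>z i - z' i\<bar>)"
proof -
  have "f z \<le> f z' + (\<Sum>i\<in>I. \<bar>z i - z' i\<bar>)" "f z' \<le> f z + (\<Sum>i\<in>I. \<bar>z' i - z i\<bar>)"
    using assms unfolding Lip_def by blast+
  moreover have "(\<Sum>i\<in>I. \<bar>z' i - z i\<bar>) = (\<Sum>i\<in>I. \<bar>z i - z' i\<bar>)"
    by (intro sum.cong refl abs_minus_commute)
  ultimately show ?thesis by linarith
qed

lemma integrable_Lip:
  assumes f: "Lip I f" and N: "prob_space N"
    and X: "\<And>i. (\<lambda>w. X i w) \<in> borel_measurable N" "\<And>i. i \<in> I \<Longrightarrow> integrable N (X i)"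
  shows "integrable N (\<lambda>w. f (\<lambda>i. z i + X i w))"
proof (rule Bochner_Integration.integrable_bound)
  interpret prob_space N by fact
  show "integrable N (\<lambda>w. \<bar>f z\<bar> + (\<Sum>i\<in>I. \<bar>X i w\<bar>))" using X by auto
  show "(\<lambda>w. f (\<lambda>i. z i + X i w)) \<in> borel_measurable N"
    using X by (intro measurable_Lip_compose[OF f]) auto
  have "\<bar>f (\<lambda>i. z i + X i w)\<bar> \<le> \<bar>f z\<bar> + (\<Sum>i\<in>I. \<bar>X i w\<bar>)" for w
    using LipD[OF f, of "\<lambda>i. z i + X i w" z] by simp
  then show "AE w in N. norm (f (\<lambda>i. z i + X i w)) \<le> norm (\<bar>f z\<bar> + (\<Sum>i\<in>I. \<bar>X i w\<bar>))"
    by (intro AE_I2) (auto intro: order_trans[OF _ abs_ge_self])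
qed

lemma integrable_smear:
  assumes f: "Lip I f" and J: "finite J"
  shows "integrable (Gam J) (\<lambda>x. f (\<lambda>i. z i + c * lin J (v i) x))"
  by (intro integrable_Lip[OF f prob_space_Gam]) (auto intro!: integrable_lin J)

lemma Lip_smear:
  assumes f: "Lip I f" and J: "finite J"
  shows "Lip I (smear J c v f)"
  unfolding Lip_def
proof (intro conjI allI)
  interpret prob_space "Gam J" by (rule prob_space_Gam)
  show "smear J c v f \<in> borel_measurable (PiM UNIV (\<lambda>_. borel))"
    unfolding smear_def
    by (intro borel_measurable_lebesgue_integral) (simp add: case_prod_beta', intro measurable_Lip_compose[OF f], measurable)
  fix z z' :: "'a \<Rightarrow> real"
  have "smear J c v f z \<le> (\<integral>x. f (\<lambda>i. z' i + c * lin J (v i) x) + (\<Sum>i\<in>I. \<bar>z i - z' i\<bar>) \<partial>Gam J)"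
    unfolding smear_def
  proof (rule integral_mono)
    fix x
    show "f (\<lambda>i. z i + c * lin J (v i) x) \<le> f (\<lambda>i. z' i + c * lin J (v i) x) + (\<Sum>i\<in>I. \<bar>z i - z' i\<bar>)"
      using LipD[OF f, of "\<lambda>i. z i + c * lin J (v i) x" "\<lambda>i. z' i + c * lin J (v i) x"] by simp
  qed (auto intro!: integrable_smear[OF f J])
  also have "\<dots> = smear J c v f z' + (\<Sum>i\<in>I. \<bar>z i - z' i\<bar>)"
    unfolding smear_def using integrable_smear[OF f J] by (simp add: prob_space)
  finally show "smear J c v f z \<le> smear J c v f z' + (\<Sum>i\<in>I. \<bar>z i - z' i\<bar>)" .
qed

lemma smear_mono:
  assumes f: "Lip I f" and g: "Lip I g" and J: "finite J" and le: "\<And>z. f z \<le> g z + d"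
  shows "smear J c v f z \<le> smear J c v g z + d"
proof -
  interpret prob_space "Gam J" by (rule prob_space_Gam)
  have "smear J c v f z \<le> (\<integral>x. g (\<lambda>i. z i + c * lin J (v i) x) + d \<partial>Gam J)"
    unfolding smear_def
    by (rule integral_mono) (auto intro!: le integrable_smear[OF f J] integrable_smear[OF g J])
  also have "\<dots> = smear J c v g z + d"
    unfolding smear_def using integrable_smear[OF g J] by (simp add: prob_space)
  finally show ?thesis .
qed

lemma integrable_pair_lin:
  assumes J: "finite J" and K: "finite K"
  shows "integrable (Gam J \<Otimes>\<^sub>M Gam K) (\<lambda>p. lin J v (fst p))" "integrable (Gam J \<Otimes>\<^sub>M Gam K) (\<lambda>p. lin K w (snd p))"
proof -
  interpret J: prob_space "Gam J" by (rule prob_space_Gam)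
  interpret K: prob_space "Gam K" by (rule prob_space_Gam)
  interpret P: pair_sigma_finite "Gam J" "Gam K" by (rule pair_sigma_finite_Gam)
  have 1: "distr (Gam J \<Otimes>\<^sub>M Gam K) (Gam J) fst = Gam J"
    by (rule K.distr_pair_fst)
  have 2: "distr (Gam J \<Otimes>\<^sub>M Gam K) (Gam K) snd = Gam K"
  proof -
    have "distr (Gam J \<Otimes>\<^sub>M Gam K) (Gam K) snd = distr (distr (Gam K \<Otimes>\<^sub>M Gam J) (Gam J \<Otimes>\<^sub>M Gam K) (\<lambda>(x, y). (y, x))) (Gam K) snd"
      by (subst P.distr_pair_swap) simp
    also have "\<dots> = distr (Gam K \<Otimes>\<^sub>M Gam J) (Gam K) fst"
      by (subst distr_distr) (auto intro!: distr_cong)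
    finally show ?thesis by (simp add: J.distr_pair_fst)
  qed
  show "integrable (Gam J \<Otimes>\<^sub>M Gam K) (\<lambda>p. lin J v (fst p))"
    using integrable_lin[OF J, of v] by (subst (asm) 1[symmetric]) (auto simp: integrable_distr_eq)
  show "integrable (Gam J \<Otimes>\<^sub>M Gam K) (\<lambda>p. lin K w (snd p))"
    using integrable_lin[OF K, of w] by (subst (asm) 2[symmetric]) (auto simp: integrable_distr_eq)
qed

lemma integrable_pair_Lip:
  assumes f: "Lip I f" and J: "finite J" and K: "finite K"
  shows "integrable (Gam J \<Otimes>\<^sub>M Gam K) (\<lambda>p. f (\<lambda>i. z i + (c * lin J (v i) (fst p) + d * lin K (w i) (snd p))))"
proof (rule integrable_Lip[OF f])
  show "prob_space (Gam J \<Otimes>\<^sub>M Gam K)" by (intro prob_space_pair prob_space_Gam)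
qed (auto intro!: integrable_pair_lin J K Bochner_Integration.integrable_add)

lemma smear_smear:
  assumes f: "Lip I f" and J: "finite J" and K: "finite K"
  shows "smear J c v (smear K d w f) z =
    (\<integral>p. f (\<lambda>i. z i + (c * lin J (v i) (fst p) + d * lin K (w i) (snd p))) \<partial>(Gam J \<Otimes>\<^sub>M Gam K))"
proof -
  interpret P: pair_sigma_finite "Gam J" "Gam K" by (rule pair_sigma_finite_Gam)
  show ?thesis
    using P.integral_fst'[OF integrable_pair_Lip[OF f J K, of z c v d w]]
    unfolding smear_def by (simp add: add.assoc)
qed

lemma smear_commute:
  assumes f: "Lip I f" and J: "finite J" and K: "finite K"
  shows "smear J c v (smear K d w f) z = smear K d w (smear J c v f) z"
proof -
  interpret P: pair_sigma_finite "Gam J" "Gam K" by (rule pair_sigma_finite_Gam)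
  have "smear J c v (smear K d w f) z =
    (\<integral>x. (\<integral>y. f (\<lambda>i. z i + (c * lin J (v i) x + d * lin K (w i) y)) \<partial>Gam K) \<partial>Gam J)"
    unfolding smear_def by (simp add: add.assoc)
  also have "\<dots> = (\<integral>y. (\<integral>x. f (\<lambda>i. z i + (c * lin J (v i) x + d * lin K (w i) y)) \<partial>Gam J) \<partial>Gam K)"
    by (rule P.Fubini_integral[symmetric])
      (use integrable_pair_Lip[OF f J K, of z c v d w] in \<open>simp add: case_prod_beta'\<close>)
  also have "\<dots> = smear K d w (smear J c v f) z"
    unfolding smear_def by (simp add: add_ac)
  finally show ?thesis .
qed

text \<open>Scales add in quadrature because c x + d y, for independent standard Gaussian vectors x
  and y, has the law of sqrt(c^2 + d^2) times one such vector
  (\<open>distr_Gam_combination\<close>).\<close>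

lemma smear_semigroup:
  assumes f: "Lip I f" and J: "finite J" and c: "0 < c" and d: "0 \<le> d"
  shows "smear J c v (smear J d v f) z = smear J (sqrt (c\<^sup>2 + d\<^sup>2)) v f z"
proof -
  define r where "r = sqrt (c\<^sup>2 + d\<^sup>2)"
  have "0 < c\<^sup>2 + d\<^sup>2" using c by (intro add_pos_nonneg) auto
  then have r: "0 < r" "r\<^sup>2 = c\<^sup>2 + d\<^sup>2" unfolding r_def by auto
  have 1: "0 < c / r" "(c / r)\<^sup>2 + (d / r)\<^sup>2 = 1"
    using r c \<open>0 < c\<^sup>2 + d\<^sup>2\<close> by (auto simp: power_divide add_divide_distrib[symmetric])
  let ?R = "\<lambda>(x, y). \<lambda>j\<in>J. c / r * x j + d / r * y j"
  have lin: "c * lin J u x + d * lin J u y = r * lin J u (?R (x, y))" for u x y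
    using r by (simp add: lin_def sum_distrib_left sum.distrib[symmetric] algebra_simps)
  have "smear J r v f z = (\<integral>x. f (\<lambda>i. z i + r * lin J (v i) x) \<partial>distr (Gam J \<Otimes>\<^sub>M Gam J) (Gam J) ?R)"
    unfolding distr_Gam_combination[OF 1 J] smear_def ..
  also have "\<dots> = (\<integral>p. f (\<lambda>i. z i + r * lin J (v i) (?R p)) \<partial>(Gam J \<Otimes>\<^sub>M Gam J))"
    by (rule integral_distr) (measurable, intro measurable_Lip_compose[OF f], measurable)
  also have "\<dots> = (\<integral>p. f (\<lambda>i. z i + (c * lin J (v i) (fst p) + d * lin J (v i) (snd p))) \<partial>(Gam J \<Otimes>\<^sub>M Gam J))"
    unfolding lin by simp
  also have "\<dots> = smear J c v (smear J d v f) z"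
    by (rule smear_smear[OF f J J, symmetric])
  finally show ?thesis unfolding r_def by simp
qed

text \<open>Taking expectations in \<open>lse_expansion\<close>: the linear term is centred and
  vanishes, and the quadratic one turns into squared distances between coefficient vectors.\<close>

lemma smear_lse_expansion:
  fixes v :: "'i \<Rightarrow> 'a \<Rightarrow> real"
  assumes I: "finite I" "I \<noteq> {}" and b: "0 < \<beta>" and J: "finite J" and c: "0 \<le> c"
  defines "p \<equiv> \<lambda>z i. exp (\<beta> * z i) / (\<Sum>i\<in>I. exp (\<beta> * z i))"
  shows "\<bar>smear J c v (lse I \<beta>) z - (lse I \<beta> z
     + \<beta> / 4 * c\<^sup>2 * (\<Sum>i\<in>I. \<Sum>j\<in>I. p z i * p z j * (\<Sum>k\<in>J. (v i k - v j k)\<^sup>2)))\<bar>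
     \<le> \<beta>\<^sup>2 * c ^ 3 * (\<Sum>i\<in>I. \<integral>x. \<bar>lin J (v i) x\<bar> ^ 3 \<partial>Gam J)"
proof -
  interpret prob_space "Gam J" by (rule prob_space_Gam)
  let ?X = "\<lambda>i x. lin J (v i) x"
  let ?T = "\<lambda>x. lse I \<beta> z + (\<Sum>i\<in>I. p z i * (c * ?X i x))
     + \<beta> / 4 * (\<Sum>i\<in>I. \<Sum>j\<in>I. p z i * p z j * (c * ?X i x - c * ?X j x)\<^sup>2)"
  have d: "(c * ?X i x - c * ?X j x)\<^sup>2 = c\<^sup>2 * (lin J (\<lambda>k. v i k - v j k) x)\<^sup>2" for i j x
    by (simp add: lin_def right_diff_distrib[symmetric] power_mult_distrib[symmetric] sum_subtractf left_diff_distrib)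
  have iT: "integrable (Gam J) ?T"
    unfolding d by (intro Bochner_Integration.integrable_add integrable_const integrable_mult_right
      Bochner_Integration.integrable_sum integrable_lin integrable_lin_sq J)
  have "(\<integral>x. ?T x \<partial>Gam J) = lse I \<beta> z
     + \<beta> / 4 * c\<^sup>2 * (\<Sum>i\<in>I. \<Sum>j\<in>I. p z i * p z j * (\<Sum>k\<in>J. (v i k - v j k)\<^sup>2))"
    unfolding d
    by (simp add: integrable_lin[OF J] integrable_lin_sq[OF J] integral_lin[OF J] integral_lin_sq[OF J] prob_space sum_distrib_left sum_divide_distrib mult_ac)
  moreover have "\<bar>smear J c v (lse I \<beta>) z - (\<integral>x. ?T x \<partial>Gam J)\<bar> \<le> (\<integral>x. \<beta>\<^sup>2 * (\<Sum>i\<in>I. \<bar>c * ?X i x\<bar> ^ 3) \<partial>Gam J)"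
  proof -
    have iL: "integrable (Gam J) (\<lambda>x. lse I \<beta> (\<lambda>i. z i + c * ?X i x))"
      by (rule integrable_smear[OF Lip_lse[OF I b] J])
    have "\<bar>smear J c v (lse I \<beta>) z - (\<integral>x. ?T x \<partial>Gam J)\<bar> = \<bar>\<integral>x. lse I \<beta> (\<lambda>i. z i + c * ?X i x) - ?T x \<partial>Gam J\<bar>"
      unfolding smear_def by (subst Bochner_Integration.integral_diff[OF iL iT]) simp
    also have "\<dots> \<le> (\<integral>x. \<bar>lse I \<beta> (\<lambda>i. z i + c * ?X i x) - ?T x\<bar> \<partial>Gam J)"
      by (rule integral_abs_bound)
    also have "\<dots> \<le> (\<integral>x. \<beta>\<^sup>2 * (\<Sum>i\<in>I. \<bar>c * ?X i x\<bar> ^ 3) \<partial>Gam J)"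
    proof (rule integral_mono)
      show "integrable (Gam J) (\<lambda>x. \<bar>lse I \<beta> (\<lambda>i. z i + c * ?X i x) - ?T x\<bar>)"
        by (intro integrable_abs Bochner_Integration.integrable_diff iL iT)
      show "integrable (Gam J) (\<lambda>x. \<beta>\<^sup>2 * (\<Sum>i\<in>I. \<bar>c * ?X i x\<bar> ^ 3))"
        unfolding abs_mult power_mult_distrib
        by (intro integrable_mult_right Bochner_Integration.integrable_sum integrable_lin_abs_power J)
      fix x
      show "\<bar>lse I \<beta> (\<lambda>i. z i + c * ?X i x) - ?T x\<bar> \<le> \<beta>\<^sup>2 * (\<Sum>i\<in>I. \<bar>c * ?X i x\<bar> ^ 3)"
        unfolding p_def by (rule lse_expansion[OF I b])
    qed
    finally show ?thesis .
  qed
  moreover have "(\<integral>x. \<beta>\<^sup>2 * (\<Sum>i\<in>I. \<bar>c * ?X i x\<bar> ^ 3) \<partial>Gam J) = \<beta>\<^sup>2 * c ^ 3 * (\<Sum>i\<in>I. \<integral>x. \<bar>?X i x\<bar> ^ 3 \<partial>Gam J)"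
    using c by (simp add: abs_mult power_mult_distrib integrable_lin_abs_power[OF J] sum_distrib_left mult.assoc)
  ultimately show ?thesis by (simp only:)
qed

text \<open>
  Lindeberg replacement: in \<open>k\<close> steps of size \<open>1 / sqrt k\<close>, each costing an error of third order, the
  smearing by one Gaussian family is exchanged for the other.
\<close>

lemma smear_lse_comparison:
  assumes I: "finite I" "I \<noteq> {}" and b: "0 < \<beta>" and J: "finite J" and K: "finite K"
    and le: "\<And>i j. i \<in> I \<Longrightarrow> j \<in> I \<Longrightarrow> (\<Sum>k\<in>K. (w i k - w j k)\<^sup>2) \<le> (\<Sum>k\<in>J. (v i k - v j k)\<^sup>2)"
  shows "smear K 1 w (lse I \<beta>) z \<le> smear J 1 v (lse I \<beta>) z"
proof -
  let ?F = "lse I \<beta>"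
  define C where "C = \<beta>\<^sup>2 * (\<Sum>i\<in>I. \<integral>x. \<bar>lin J (v i) x\<bar> ^ 3 \<partial>Gam J) + \<beta>\<^sup>2 * (\<Sum>i\<in>I. \<integral>x. \<bar>lin K (w i) x\<bar> ^ 3 \<partial>Gam K)"
  note LF = Lip_lse[OF I b]
  have one: "smear K e w ?F z \<le> smear J e v ?F z + C * e ^ 3" if e: "0 \<le> e" for e z
  proof -
    define p where "p i = exp (\<beta> * z i) / (\<Sum>i\<in>I. exp (\<beta> * z i))" for i
    have p: "0 \<le> p i" for i unfolding p_def by (simp add: sum_nonneg)
    let ?V = "\<Sum>i\<in>I. \<Sum>j\<in>I. p i * p j * (\<Sum>k\<in>J. (v i k - v j k)\<^sup>2)"
    let ?W = "\<Sum>i\<in>I. \<Sum>j\<in>I. p i * p j * (\<Sum>k\<in>K. (w i k - w j k)\<^sup>2)"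
    have "?W \<le> ?V" by (intro sum_mono mult_left_mono le mult_nonneg_nonneg p)
    then have "\<beta> / 4 * e\<^sup>2 * ?W \<le> \<beta> / 4 * e\<^sup>2 * ?V" using b by (intro mult_left_mono) auto
    moreover have "\<bar>smear J e v ?F z - (?F z + \<beta> / 4 * e\<^sup>2 * ?V)\<bar> \<le> \<beta>\<^sup>2 * e ^ 3 * (\<Sum>i\<in>I. \<integral>x. \<bar>lin J (v i) x\<bar> ^ 3 \<partial>Gam J)"
      unfolding p_def by (rule smear_lse_expansion[OF I b J e])
    moreover have "\<bar>smear K e w ?F z - (?F z + \<beta> / 4 * e\<^sup>2 * ?W)\<bar> \<le> \<beta>\<^sup>2 * e ^ 3 * (\<Sum>i\<in>I. \<integral>x. \<bar>lin K (w i) x\<bar> ^ 3 \<partial>Gam K)"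
      unfolding p_def by (rule smear_lse_expansion[OF I b K e])
    moreover have "C * e ^ 3 = \<beta>\<^sup>2 * e ^ 3 * (\<Sum>i\<in>I. \<integral>x. \<bar>lin J (v i) x\<bar> ^ 3 \<partial>Gam J) + \<beta>\<^sup>2 * e ^ 3 * (\<Sum>i\<in>I. \<integral>x. \<bar>lin K (w i) x\<bar> ^ 3 \<partial>Gam K)"
      by (simp add: C_def algebra_simps)
    ultimately show ?thesis by linarith
  qed
  have steps: "smear K (sqrt k * e) w ?F z \<le> smear J (sqrt k * e) v ?F z + real k * (C * e ^ 3)" if e: "0 < e" for k :: nat and e z
  proof (induction k arbitrary: z)
    case 0
    then show ?case using one[of 0 z] by simp
  next
    case (Suc k)
    have sq: "sqrt (e\<^sup>2 + (sqrt k * e)\<^sup>2) = sqrt (Suc k) * e"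
    proof -
      have "e\<^sup>2 + (sqrt k * e)\<^sup>2 = real (Suc k) * e\<^sup>2" by (simp add: power_mult_distrib algebra_simps)
      then show ?thesis using e by (simp add: real_sqrt_mult)
    qed
    have nn: "0 \<le> sqrt k * e" using e by simp
    have "smear K (sqrt (Suc k) * e) w ?F z = smear K e w (smear K (sqrt k * e) w ?F) z"
      using smear_semigroup[OF LF K e nn] by (simp only: sq)
    also have "\<dots> \<le> smear K e w (smear J (sqrt k * e) v ?F) z + real k * (C * e ^ 3)"
      by (intro smear_mono[OF Lip_smear[OF LF K] Lip_smear[OF LF J] K] Suc.IH)
    \<comment> \<open>The one-step comparison \<open>one\<close> concerns the smearing of
      \<open>?F\<close> itself, so the remaining \<open>w\<close>-step is first moved
      innermost.\<close>
    also have "smear K e w (smear J (sqrt k * e) v ?F) z = smear J (sqrt k * e) v (smear K e w ?F) z"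
      by (rule smear_commute[OF LF K J])
    also have "\<dots> \<le> smear J (sqrt k * e) v (smear J e v ?F) z + C * e ^ 3"
      using e by (intro smear_mono[OF Lip_smear[OF LF K] Lip_smear[OF LF J] J] one) simp
    also have "smear J (sqrt k * e) v (smear J e v ?F) z = smear J e v (smear J (sqrt k * e) v ?F) z"
      by (rule smear_commute[OF LF J J])
    also have "\<dots> = smear J (sqrt (Suc k) * e) v ?F z"
      using smear_semigroup[OF LF J e nn] by (simp only: sq)
    finally show ?case by (simp add: algebra_simps)
  qed
  have "smear K 1 w ?F z \<le> smear J 1 v ?F z + C / sqrt (Suc k)" for k :: nat
  proof -
    define s where "s = sqrt (Suc k)"
    have s: "0 < s" "s\<^sup>2 = real (Suc k)" by (auto simp: s_def)
    have "smear K (s * (1 / s)) w ?F z \<le> smear J (s * (1 / s)) v ?F z + real (Suc k) * (C * (1 / s) ^ 3)"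
      unfolding s_def by (rule steps) simp
    moreover have "real (Suc k) * (C * (1 / s) ^ 3) = C / s"
      unfolding s(2)[symmetric] using s(1) by (simp add: power_divide power2_eq_square power3_eq_cube)
    ultimately show ?thesis using s by (simp add: s_def)
  qed
  moreover have "(\<lambda>k. smear J 1 v ?F z + C / sqrt (Suc k)) \<longlonglongrightarrow> smear J 1 v ?F z + 0"
  proof (intro tendsto_add tendsto_const)
    have "filterlim (\<lambda>k. sqrt (real (Suc k))) at_top sequentially"
      by (intro filterlim_compose[OF sqrt_at_top] filterlim_compose[OF filterlim_real_sequentially] filterlim_Suc)
    then show "(\<lambda>k. C / sqrt (Suc k)) \<longlonglongrightarrow> 0"
      by (intro tendsto_divide_0[OF tendsto_const] filterlim_at_top_imp_at_infinity)
  qed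
  ultimately show ?thesis
    by (intro LIMSEQ_le_const[where X="\<lambda>k. smear J 1 v ?F z + C / sqrt (Suc k)"]) auto
qed

lemma measurable_Max_image [measurable (raw)]:
  fixes X :: "'i \<Rightarrow> 'w \<Rightarrow> real"
  assumes "finite I" "\<And>i. i \<in> I \<Longrightarrow> X i \<in> borel_measurable N"
  shows "(\<lambda>w. Max ((\<lambda>i. X i w) ` I)) \<in> borel_measurable N"
  using assms by (rule borel_measurable_Max)

lemma abs_Max_image_le:
  fixes h :: "'i \<Rightarrow> real"
  assumes I: "finite I" "I \<noteq> {}"
  shows "\<bar>Max (h ` I)\<bar> \<le> (\<Sum>i\<in>I. \<bar>h i\<bar>)"
proof -
  obtain i where "i \<in> I" "Max (h ` I) = h i" using Max_image_attained[OF I, of h] by blast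
  then show ?thesis using I member_le_sum[of i I "\<lambda>i. \<bar>h i\<bar>"] by simp
qed

lemma integrable_Max_image:
  fixes X :: "'i \<Rightarrow> 'w \<Rightarrow> real"
  assumes I: "finite I" "I \<noteq> {}" and X: "\<And>i. i \<in> I \<Longrightarrow> integrable N (X i)"
  shows "integrable N (\<lambda>w. Max ((\<lambda>i. X i w) ` I))"
proof (rule Bochner_Integration.integrable_bound)
  show "integrable N (\<lambda>w. \<Sum>i\<in>I. \<bar>X i w\<bar>)" using X by auto
  show "(\<lambda>w. Max ((\<lambda>i. X i w) ` I)) \<in> borel_measurable N"
    using X I by (intro measurable_Max_image) auto
  show "AE w in N. norm (Max ((\<lambda>i. X i w) ` I)) \<le> norm (\<Sum>i\<in>I. \<bar>X i w\<bar>)"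
    using abs_Max_image_le[OF I] by (intro AE_I2) (auto simp: sum_nonneg intro: order_trans[OF _ abs_ge_self])
qed

theorem sudakov_fernique:
  assumes I: "finite I" "I \<noteq> {}" and J: "finite J" and K: "finite K"
    and le: "\<And>i j. i \<in> I \<Longrightarrow> j \<in> I \<Longrightarrow> (\<Sum>k\<in>K. (w i k - w j k)\<^sup>2) \<le> (\<Sum>k\<in>J. (v i k - v j k)\<^sup>2)"
  shows "(\<integral>y. Max ((\<lambda>i. lin K (w i) y) ` I) \<partial>Gam K) \<le> (\<integral>x. Max ((\<lambda>i. lin J (v i) x) ` I) \<partial>Gam J)"
proof (rule field_le_epsilon)
  interpret J: prob_space "Gam J" by (rule prob_space_Gam)
  interpret K: prob_space "Gam K" by (rule prob_space_Gam)
  fix e :: real assume e: "0 < e"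
  \<comment> \<open>Chosen so that the gap between \<open>lse\<close> and the maximum is at most
    \<open>e\<close>; the added 1 keeps \<beta> positive when \<open>I\<close> is a
    singleton.\<close>
  define \<beta> where "\<beta> = (ln (card I) + 1) / e"
  have c1: "1 \<le> card I" using I by (simp add: Suc_leI card_gt_0_iff)
  then have b: "0 < \<beta>" unfolding \<beta>_def using e by (intro divide_pos_pos add_nonneg_pos) auto
  have be: "ln (card I) / \<beta> \<le> e"
    using b e unfolding \<beta>_def by (simp add: field_simps)
  note LF = Lip_lse[OF I b]
  have "(\<integral>y. Max ((\<lambda>i. lin K (w i) y) ` I) \<partial>Gam K) \<le> smear K 1 w (lse I \<beta>) (\<lambda>_. 0)"
    unfolding smear_def
    by (rule integral_mono)
      (auto intro!: integrable_Max_image I integrable_lin K integrable_smear[OF LF, of K "\<lambda>_. 0" 1 w, simplified] lse_bounds b)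
  also have "\<dots> \<le> smear J 1 v (lse I \<beta>) (\<lambda>_. 0)"
    by (rule smear_lse_comparison[OF I b J K le])
  also have "\<dots> \<le> (\<integral>x. Max ((\<lambda>i. lin J (v i) x) ` I) + e \<partial>Gam J)"
    unfolding smear_def
  proof (rule integral_mono)
    show "integrable (Gam J) (\<lambda>x. lse I \<beta> (\<lambda>i. 0 + 1 * lin J (v i) x))"
      by (rule integrable_smear[OF LF J])
    show "integrable (Gam J) (\<lambda>x. Max ((\<lambda>i. lin J (v i) x) ` I) + e)"
      by (auto intro!: integrable_Max_image I integrable_lin J)
    show "lse I \<beta> (\<lambda>i. 0 + 1 * lin J (v i) x) \<le> Max ((\<lambda>i. lin J (v i) x) ` I) + e" for x
      using lse_bounds(2)[OF I b, of "\<lambda>i. lin J (v i) x"] be by simp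
  qed
  also have "\<dots> = (\<integral>x. Max ((\<lambda>i. lin J (v i) x) ` I) \<partial>Gam J) + e"
    by (subst Bochner_Integration.integral_add) (auto intro!: integrable_Max_image I integrable_lin J simp: J.prob_space)
  finally show "(\<integral>y. Max ((\<lambda>i. lin K (w i) y) ` I) \<partial>Gam K) \<le> (\<integral>x. Max ((\<lambda>i. lin J (v i) x) ` I) \<partial>Gam J) + e" .
qed

section \<open>Separated clusters\<close>

text \<open>On [u, u+1] the density is at least its value at u+1, and (u+1)^2/2 <= u^2 + 1 because
  (u-1)^2 >= 0. The crude exponent u^2 suffices: at u = sqrt(ln m) the bound is of order
  1/m.\<close>

lemma stdn_tail_lower:
  assumes u: "0 \<le> u"
  shows "exp (- u\<^sup>2) / (exp 1 * sqrt (2 * pi)) \<le> measure stdn {u..}"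
proof -
  have "(u + 1)\<^sup>2 / 2 \<le> u\<^sup>2 + 1"
    using zero_le_power2[of "u - 1"] by (simp add: power2_eq_square algebra_simps)
  then have "exp (- (u\<^sup>2 + 1)) \<le> exp (- (u + 1)\<^sup>2 / 2)" by simp
  then have "exp (- u\<^sup>2) / exp 1 \<le> exp (- (u + 1)\<^sup>2 / 2)" by (simp add: exp_diff exp_minus)
  then have "exp (- u\<^sup>2) / exp 1 / sqrt (2 * pi) \<le> exp (- (u + 1)\<^sup>2 / 2) / sqrt (2 * pi)"
    by (rule divide_right_mono) simp
  then have 1: "exp (- u\<^sup>2) / (exp 1 * sqrt (2 * pi)) \<le> std_normal_density (u + 1)"
    by (simp add: std_normal_density_def)
  have "ennreal (std_normal_density (u + 1)) = (\<integral>\<^sup>+x. ennreal (std_normal_density (u + 1)) * indicator {u..u + 1} x \<partial>lborel)"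
    by (subst nn_integral_cmult_indicator) auto
  also have "\<dots> \<le> (\<integral>\<^sup>+x. ennreal (std_normal_density x) * indicator {u..} x \<partial>lborel)"
  proof (intro nn_integral_mono)
    fix x
    have "std_normal_density (u + 1) \<le> std_normal_density x" if "u \<le> x" "x \<le> u + 1"
    proof -
      have "x\<^sup>2 \<le> (u + 1)\<^sup>2" using that u by (intro power_mono) auto
      then show ?thesis by (simp add: std_normal_density_def divide_right_mono)
    qed
    then show "ennreal (std_normal_density (u + 1)) * indicator {u..u + 1} x \<le> ennreal (std_normal_density x) * indicator {u..} x"
      by (auto simp: indicator_def intro!: ennreal_leI)
  qed
  also have "\<dots> = emeasure stdn {u..}"
    unfolding stdn_def by (rule emeasure_density[symmetric]) auto
  finally have "std_normal_density (u + 1) \<le> measure stdn {u..}"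
    by (simp add: stdn.emeasure_eq_measure)
  with 1 show ?thesis by linarith
qed

definition \<delta>\<^sub>0 :: real where
  "\<delta>\<^sub>0 = 1 - exp (- (1 / (exp 1 * sqrt (2 * pi))))"

lemma \<delta>\<^sub>0_pos: "0 < \<delta>\<^sub>0"
  unfolding \<delta>\<^sub>0_def by simp

lemma coordinate_eq_lin:
  assumes "finite S" "i \<in> S"
  shows "x i = lin S (\<lambda>j. if j = i then 1 else 0) x"
  using assms by (simp add: lin_def if_distrib[of "\<lambda>c. c * _"] sum.delta cong: if_cong)

lemma integrable_coordinate:
  assumes "finite S" "i \<in> S"
  shows "integrable (Gam S) (\<lambda>x. x i)"
  unfolding coordinate_eq_lin[OF assms] using integrable_lin[OF assms(1)] .

text \<open>With probability at least \<open>\<delta>\<^sub>0\<close> some coordinate reaches u =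
  sqrt(ln m). On the remaining event the maximum is still at least -|x i0| for a fixed coordinate
  i0, and the mean of |x i0| is at most 1.\<close>

lemma expectation_Max_iid:
  assumes S: "finite S" "S \<noteq> {}"
  shows "\<delta>\<^sub>0 * sqrt (ln (card S)) - 1 \<le> (\<integral>x. Max (x ` S) \<partial>Gam S)"
proof -
  interpret prob_space "Gam S" by (rule prob_space_Gam)
  let ?m = "card S"
  have m: "1 \<le> ?m" using S by (simp add: Suc_leI card_gt_0_iff)
  define u where "u = sqrt (ln ?m)"
  have u: "0 \<le> u" "exp (- u\<^sup>2) = 1 / ?m" using m by (auto simp: u_def exp_minus divide_inverse)
  define c where "c = 1 / (exp 1 * sqrt (2 * pi))"
  have c: "c / ?m \<le> measure stdn {u..}"
    using stdn_tail_lower[OF u(1)] unfolding u(2) c_def by (simp add: field_simps)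
  have "measure stdn {..<u} = 1 - measure stdn {u..}"
  proof -
    have "measure stdn (space stdn - {u..}) = 1 - measure stdn {u..}"
      by (rule stdn.prob_compl) simp
    moreover have "space stdn - {u..} = {..<u}" by auto
    ultimately show ?thesis by simp
  qed
  with c have lt: "measure stdn {..<u} \<le> exp (- (c / ?m))"
    using exp_ge_add_one_self[of "- (c / ?m)"] by linarith
  let ?E = "Pi\<^sub>E S (\<lambda>_. {..<u})"
  have "measure (Gam S) ?E = (\<Prod>i\<in>S. measure stdn {..<u})"
  proof -
    interpret F: finite_product_prob_space "\<lambda>_. stdn" S by unfold_locales (rule S(1))
    show ?thesis unfolding Gam_def by (rule F.prob_times) simp
  qed
  also have "\<dots> = measure stdn {..<u} ^ ?m" by simp
  also have "\<dots> \<le> exp (- (c / ?m)) ^ ?m" using lt by (intro power_mono) auto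
  also have "\<dots> = exp (- c)" using m by (simp add: exp_of_nat_mult[symmetric])
  finally have E: "measure (Gam S) ?E \<le> 1 - \<delta>\<^sub>0" by (simp add: \<delta>\<^sub>0_def c_def)
  have Em: "?E \<in> sets (Gam S)" using S by (simp only: sets_Gam) (intro sets_PiM_I_finite, auto)
  obtain i0 where i0: "i0 \<in> S" using S by auto
  have abs1: "(\<integral>x. \<bar>x i0\<bar> \<partial>Gam S) \<le> 1"
  proof -
    let ?v = "\<lambda>j. if j = i0 then 1 else (0::real)"
    have "(\<integral>x. \<bar>x i0\<bar> \<partial>Gam S) \<le> (\<integral>x. (1 + (lin S ?v x)\<^sup>2) / 2 \<partial>Gam S)"
    proof (rule integral_mono)
      show "integrable (Gam S) (\<lambda>x. \<bar>x i0\<bar>)" using integrable_coordinate[OF S(1) i0] by simp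
      show "integrable (Gam S) (\<lambda>x. (1 + (lin S ?v x)\<^sup>2) / 2)"
        using integrable_lin_sq[OF S(1), of ?v] by simp
      fix x :: "'a \<Rightarrow> real"
      have "0 \<le> (\<bar>x i0\<bar> - 1)\<^sup>2" by simp
      then show "\<bar>x i0\<bar> \<le> (1 + (lin S ?v x)\<^sup>2) / 2"
        unfolding coordinate_eq_lin[OF S(1) i0, of x, symmetric]
        by (simp add: power2_eq_square algebra_simps)
    qed
    also have "\<dots> = 1"
    proof -
      have "(\<Sum>j\<in>S. (?v j)\<^sup>2) = 1"
        using S i0 by (simp add: if_distrib[of "\<lambda>c. c\<^sup>2"] sum.delta cong: if_cong)
      then show ?thesis
        using integrable_lin_sq[OF S(1), of ?v] by (simp add: integral_lin_sq[OF S(1)] prob_space)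
    qed
    finally show ?thesis .
  qed
  have "\<delta>\<^sub>0 * u - 1 \<le> u * (1 - measure (Gam S) ?E) - (\<integral>x. \<bar>x i0\<bar> \<partial>Gam S)"
  proof (intro diff_mono abs1)
    have "u * \<delta>\<^sub>0 \<le> u * (1 - measure (Gam S) ?E)" using E u(1) by (intro mult_left_mono) auto
    then show "\<delta>\<^sub>0 * u \<le> u * (1 - measure (Gam S) ?E)" by (simp only: mult.commute)
  qed
  also have "\<dots> = (\<integral>x. u * (1 - indicator ?E x) - \<bar>x i0\<bar> \<partial>Gam S)"
  proof -
    have "integrable (Gam S) (\<lambda>x. indicator ?E x :: real)"
      by (rule integrable_real_indicator[OF Em]) (simp add: emeasure_eq_measure)
    moreover have "(\<integral>x. indicator ?E x \<partial>Gam S) = measure (Gam S) ?E"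
      using sets.sets_into_space[OF Em] by (simp add: Int_absorb2)
    ultimately show ?thesis
      using integrable_coordinate[OF S(1) i0] by (simp add: prob_space)
  qed
  also have "\<dots> \<le> (\<integral>x. Max (x ` S) \<partial>Gam S)"
  proof (rule integral_mono)
    have "integrable (Gam S) (\<lambda>x. indicator ?E x :: real)"
      by (rule integrable_real_indicator[OF Em]) (simp add: emeasure_eq_measure)
    then show "integrable (Gam S) (\<lambda>x. u * (1 - indicator ?E x) - \<bar>x i0\<bar>)"
      using integrable_coordinate[OF S(1) i0] by simp
    show "integrable (Gam S) (\<lambda>x. Max (x ` S))"
      using integrable_Max_image[OF S, where X = "\<lambda>i x. x i"] integrable_coordinate[OF S(1)] by simp
    fix x :: "'a \<Rightarrow> real" assume x: "x \<in> space (Gam S)"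
    show "u * (1 - indicator ?E x) - \<bar>x i0\<bar> \<le> Max (x ` S)"
    proof (cases "x \<in> ?E")
      case True
      have "- \<bar>x i0\<bar> \<le> x i0" by simp
      also have "\<dots> \<le> Max (x ` S)" using S i0 by (intro Max_ge) auto
      finally show ?thesis using True by simp
    next
      case False
      then obtain i where i: "i \<in> S" "u \<le> x i" using x by (auto simp: space_Gam PiE_iff)
      have "u \<le> x i" by fact
      also have "\<dots> \<le> Max (x ` S)" using S i by (intro Max_ge) auto
      finally show ?thesis using False by simp
    qed
  qed
  finally show ?thesis unfolding u_def .
qed

section \<open>Expected suprema of finite Gaussian families\<close>

definition gsup :: "'a set \<Rightarrow> ('a \<Rightarrow> real) set \<Rightarrow> real" where
  "gsup J A = (\<integral>x. Max ((\<lambda>t. lin J t x) ` A) \<partial>Gam J)"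

abbreviation dist2 :: "'a set \<Rightarrow> ('a \<Rightarrow> real) \<Rightarrow> ('a \<Rightarrow> real) \<Rightarrow> real" where
  "dist2 J s t \<equiv> L2_set (\<lambda>k. s k - t k) J"

lemma dist2_triangle: "dist2 J r t \<le> dist2 J r s + dist2 J s t"
  using L2_set_triangle_ineq[of "\<lambda>k. r k - s k" "\<lambda>k. s k - t k" J] by simp

lemma dist2_commute: "dist2 J s t = dist2 J t s"
  unfolding L2_set_def by (simp add: power2_commute)

lemma gsup_mono:
  assumes J: "finite J" and AB: "A \<subseteq> B" "finite B" "A \<noteq> {}"
  shows "gsup J A \<le> gsup J B"
  unfolding gsup_def
proof (rule integral_mono)
  have A: "finite A" "B \<noteq> {}" using AB finite_subset by auto
  show "integrable (Gam J) (\<lambda>x. Max ((\<lambda>t. lin J t x) ` A))" "integrable (Gam J) (\<lambda>x. Max ((\<lambda>t. lin J t x) ` B))"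
    using AB A by (auto intro!: integrable_Max_image integrable_lin J)
  show "Max ((\<lambda>t. lin J t x) ` A) \<le> Max ((\<lambda>t. lin J t x) ` B)" for x
    using AB A by (intro Max_mono) auto
qed

lemma gsup_nonneg:
  assumes J: "finite J" and A: "finite A" "A \<noteq> {}"
  shows "0 \<le> gsup J A"
proof -
  obtain t where t: "t \<in> A" using A by auto
  have "(\<integral>x. lin J t x \<partial>Gam J) \<le> gsup J A"
    unfolding gsup_def
    by (rule integral_mono) (use t A in \<open>auto intro!: integrable_Max_image integrable_lin J Max_ge\<close>)
  then show ?thesis by (simp add: integral_lin[OF J])
qed

lemma lin_diff: "lin J (\<lambda>k. s k - t k) x = lin J s x - lin J t x"
  by (simp add: lin_def sum_subtractf left_diff_distrib)

lemma gsup_translate: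
  assumes J: "finite J" and A: "finite A" "A \<noteq> {}"
  shows "(\<integral>x. Max ((\<lambda>s. lin J (\<lambda>k. s k - t k) x) ` A) \<partial>Gam J) = gsup J A"
proof -
  have "Max ((\<lambda>s. lin J (\<lambda>k. s k - t k) x) ` A) = Max ((\<lambda>s. lin J s x) ` A) - lin J t x" for x
  proof -
    have "Max ((\<lambda>s. lin J s x + (- lin J t x)) ` A) = Max ((\<lambda>s. lin J s x) ` A) + (- lin J t x)"
      by (rule Max_add_commute) (use A in auto)
    then show ?thesis by (simp add: lin_diff)
  qed
  then have "(\<integral>x. Max ((\<lambda>s. lin J (\<lambda>k. s k - t k) x) ` A) \<partial>Gam J) = (\<integral>x. Max ((\<lambda>s. lin J s x) ` A) - lin J t x \<partial>Gam J)"
    by simp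
  also have "\<dots> = gsup J A - (\<integral>x. lin J t x \<partial>Gam J)"
    unfolding gsup_def using A by (intro Bochner_Integration.integral_diff integrable_Max_image integrable_lin J)
  finally show ?thesis by (simp add: integral_lin[OF J])
qed

lemma L2_set_sum_sq: "(L2_set f A)\<^sup>2 = (\<Sum>i\<in>A. (f i)\<^sup>2)"
  unfolding L2_set_def by (simp add: sum_nonneg)

text \<open>
  Comparison with a process whose clusters are independent copies, cluster \<open>i\<close> being shifted by an
  independent normal variable (coordinate \<open>Inl i\<close>): looking only at the cluster with the largest shift
  gives the bound, without concentration of measure.
\<close>

theorem super_sudakov:
  fixes t :: "'b \<Rightarrow> 'a \<Rightarrow> real"
  assumes J: "finite J" and S: "finite S" "S \<noteq> {}" and a: "0 < a"
    and sep: "\<And>i j. i \<in> S \<Longrightarrow> j \<in> S \<Longrightarrow> i \<noteq> j \<Longrightarrow> a \<le> dist2 J (t i) (t j)"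
    and H: "\<And>i. i \<in> S \<Longrightarrow> finite (H i)" "\<And>i. i \<in> S \<Longrightarrow> H i \<noteq> {}"
    and Hb: "\<And>i s. i \<in> S \<Longrightarrow> s \<in> H i \<Longrightarrow> dist2 J s (t i) \<le> a / 4"
    and g: "\<And>i. i \<in> S \<Longrightarrow> b \<le> gsup J (H i)"
  shows "a / 4 * (\<delta>\<^sub>0 * sqrt (ln (card S)) - 1) + b \<le> gsup J (\<Union>i\<in>S. H i)"
proof -
  define I where "I = Sigma S H"
  have I: "finite I" "I \<noteq> {}" using S H by (auto simp: I_def)
  define A :: "('b + 'b \<times> 'a) set" where "A = Inl ` S"
  define B :: "('b + 'b \<times> 'a) set" where "B = Inr ` (S \<times> J)"
  define w :: "'b \<times> ('a \<Rightarrow> real) \<Rightarrow> 'b + 'b \<times> 'a \<Rightarrow> real" where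
    "w = (\<lambda>(i, s) q. case q of Inl j \<Rightarrow> if j = i then a / 4 else 0 | Inr (j, k) \<Rightarrow> if j = i then s k - t i k else 0)"
  have AB: "A \<inter> B = {}" "finite A" "finite B" using S J by (auto simp: A_def B_def)
  have sumAB: "(\<Sum>q\<in>A \<union> B. F q) = (\<Sum>j\<in>S. F (Inl j)) + (\<Sum>j\<in>S. \<Sum>k\<in>J. F (Inr (j, k)))" for F :: "_ \<Rightarrow> real"
    using AB by (subst sum.union_disjoint) (auto simp: A_def B_def sum.reindex sum.cartesian_product)
  have incr: "(\<Sum>q\<in>A \<union> B. (w p q - w p' q)\<^sup>2) \<le> (\<Sum>k\<in>J. (snd p k - snd p' k)\<^sup>2)"
    if p: "p \<in> I" "p' \<in> I" for p p'
  proof -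
    obtain i s j s' where ps: "p = (i, s)" "p' = (j, s')" by (cases p; cases p')
    have ij: "i \<in> S" "j \<in> S" "s \<in> H i" "s' \<in> H j" using p ps by (auto simp: I_def)
    show ?thesis
    proof (cases "i = j")
      case True
      have "(\<Sum>q\<in>A \<union> B. (w p q - w p' q)\<^sup>2) = (\<Sum>l\<in>S. \<Sum>k\<in>J. if l = i then (s k - s' k)\<^sup>2 else 0)"
        unfolding sumAB ps w_def using True by (auto intro!: sum.cong)
      also have "\<dots> = (\<Sum>l\<in>S. if l = i then (\<Sum>k\<in>J. (s k - s' k)\<^sup>2) else 0)"
        by (intro sum.cong) auto
      also have "\<dots> = (\<Sum>k\<in>J. (s k - s' k)\<^sup>2)" using S ij by simp
      finally show ?thesis by (simp add: ps)
    next
      case False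
      \<comment> \<open>Points of different clusters differ by four orthogonal pieces of length at
        most a/4, hence by at most a/2; the triangle inequality leaves a - a/4 - a/4 = a/2 for the
        original points. This balance fixes the radius a/4 and the size a/4 of the shift.\<close>
      have "(\<Sum>q\<in>A \<union> B. (w p q - w p' q)\<^sup>2) =
        (\<Sum>l\<in>S. (if l = i then (a/4)\<^sup>2 else 0) + (if l = j then (a/4)\<^sup>2 else 0)) +
        (\<Sum>l\<in>S. (if l = i then (dist2 J s (t i))\<^sup>2 else 0) + (if l = j then (dist2 J s' (t j))\<^sup>2 else 0))"
        unfolding sumAB ps w_def L2_set_sum_sq using False
        by (intro arg_cong2[where f = "(+)"] sum.cong) (auto simp: power2_commute)
      also have "\<dots> = (a/4)\<^sup>2 + (a/4)\<^sup>2 + ((dist2 J s (t i))\<^sup>2 + (dist2 J s' (t j))\<^sup>2)"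
        using S ij by (simp add: sum.distrib)
      also have "\<dots> \<le> (a/4)\<^sup>2 + (a/4)\<^sup>2 + ((a/4)\<^sup>2 + (a/4)\<^sup>2)"
        using Hb ij by (intro add_mono power_mono order_refl) auto
      also have "\<dots> = (a/2)\<^sup>2" by (simp add: power2_eq_square)
      also have "\<dots> \<le> (dist2 J s s')\<^sup>2"
      proof (rule power_mono)
        have "a \<le> dist2 J (t i) (t j)" using sep ij False by auto
        moreover have "dist2 J (t i) (t j) \<le> dist2 J (t i) s + dist2 J s (t j)" by (rule dist2_triangle)
        moreover have "dist2 J s (t j) \<le> dist2 J s s' + dist2 J s' (t j)" by (rule dist2_triangle)
        moreover have "dist2 J (t i) s \<le> a / 4"
          using Hb[OF ij(1,3)] by (subst dist2_commute)
        moreover have "dist2 J s' (t j) \<le> a / 4" by (rule Hb[OF ij(2,4)])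
        ultimately show "a / 2 \<le> dist2 J s s'" by linarith
      qed (use a in auto)
      finally show ?thesis by (simp add: ps L2_set_sum_sq)
    qed
  qed
  let ?F = "\<lambda>y. Max ((\<lambda>p. lin (A \<union> B) (w p) y) ` I)"
  have "(\<integral>y. ?F y \<partial>Gam (A \<union> B)) \<le> (\<integral>x. Max ((\<lambda>p. lin J (snd p) x) ` I) \<partial>Gam J)"
    by (rule sudakov_fernique[OF I J _ incr]) (use AB in auto)
  also have "\<dots> = gsup J (\<Union>i\<in>S. H i)"
  proof -
    have "(\<lambda>p. lin J (snd p) x) ` I = (\<lambda>t. lin J t x) ` (\<Union>i\<in>S. H i)" for x
      by (force simp: I_def image_iff)
    then show ?thesis by (simp add: gsup_def)
  qed
  finally have up: "(\<integral>y. ?F y \<partial>Gam (A \<union> B)) \<le> gsup J (\<Union>i\<in>S. H i)" .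

  interpret P: pair_sigma_finite "Gam A" "Gam B" by (rule pair_sigma_finite_Gam)
  interpret GA: prob_space "Gam A" by (rule prob_space_Gam)
  interpret GB: prob_space "Gam B" by (rule prob_space_Gam)
  have mg: "distr (Gam A \<Otimes>\<^sub>M Gam B) (Gam (A \<union> B)) (merge A B) = Gam (A \<union> B)"
    unfolding Gam_def by (rule PG.distr_merge[OF AB])
  have mgm: "merge A B \<in> (Gam A \<Otimes>\<^sub>M Gam B) \<rightarrow>\<^sub>M Gam (A \<union> B)"
    unfolding Gam_def by (rule measurable_merge)
  have iF: "integrable (Gam (A \<union> B)) ?F"
    by (intro integrable_Max_image I integrable_lin) (use AB in auto)
  then have iFm: "integrable (Gam A \<Otimes>\<^sub>M Gam B) (\<lambda>z. ?F (merge A B z))"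
    by (subst (asm) mg[symmetric]) (rule integrable_distr[OF mgm])
  have "(\<integral>y. ?F y \<partial>Gam (A \<union> B)) = (\<integral>z. ?F (merge A B z) \<partial>(Gam A \<Otimes>\<^sub>M Gam B))"
    using integral_distr[OF mgm, of ?F] iF unfolding mg by simp
  also have "\<dots> = (\<integral>x. (\<integral>y. ?F (merge A B (x, y)) \<partial>Gam B) \<partial>Gam A)"
    by (rule P.integral_fst'[OF iFm, symmetric])
  finally have FF: "(\<integral>y. ?F y \<partial>Gam (A \<union> B)) = (\<integral>x. (\<integral>y. ?F (merge A B (x, y)) \<partial>Gam B) \<partial>Gam A)" .

  let ?Y = "\<lambda>i s (y :: 'b + 'b \<times> 'a \<Rightarrow> real). lin J (\<lambda>k. s k - t i k) (\<lambda>k\<in>J. y (Inr (i, k)))"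
  have linw: "lin (A \<union> B) (w (i, s)) (merge A B (x, y)) = a / 4 * x (Inl i) + ?Y i s y" if i: "i \<in> S" for i s x y
  proof -
    have "lin (A \<union> B) (w (i, s)) (merge A B (x, y)) =
      (\<Sum>j\<in>S. if j = i then a / 4 * x (Inl i) else 0) + (\<Sum>j\<in>S. if j = i then ?Y i s y else 0)"
      unfolding lin_def sumAB
      by (intro arg_cong2[where f = "(+)"] sum.cong) (auto simp: w_def A_def B_def merge_def intro!: sum.cong)
    then show ?thesis using S i by simp
  qed
  have reidx: "distr (Gam B) (Gam J) (\<lambda>y. \<lambda>k\<in>J. y (Inr (i, k))) = Gam J" if "i \<in> S" for i
    unfolding Gam_def by (rule distr_PiM_reindex) (use that in \<open>auto simp: B_def inj_on_def prob_space_stdn\<close>)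
  have reidxm: "(\<lambda>y. \<lambda>k\<in>J. y (Inr (i, k))) \<in> Gam B \<rightarrow>\<^sub>M Gam J" if "i \<in> S" for i
    unfolding Gam_def by (rule measurable_restrict) (use that in \<open>auto simp: B_def\<close>)
  have iY: "integrable (Gam B) (?Y i s)" if i: "i \<in> S" for i s
    using integrable_lin[OF J, of "\<lambda>k. s k - t i k"]
    by (subst (asm) reidx[OF i, symmetric]) (rule integrable_distr[OF reidxm[OF i]])
  have EY: "(\<integral>y. Max ((\<lambda>s. ?Y i s y) ` H i) \<partial>Gam B) = gsup J (H i)" if i: "i \<in> S" for i
  proof -
    have "(\<integral>y. Max ((\<lambda>s. ?Y i s y) ` H i) \<partial>Gam B) =
      (\<integral>x. Max ((\<lambda>s. lin J (\<lambda>k. s k - t i k) x) ` H i) \<partial>distr (Gam B) (Gam J) (\<lambda>y. \<lambda>k\<in>J. y (Inr (i, k))))"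
      by (rule integral_distr[OF reidxm[OF i], symmetric]) (intro measurable_Max_image H i, measurable)
    also have "\<dots> = gsup J (H i)"
      unfolding reidx[OF i] by (rule gsup_translate[OF J H[OF i]])
    finally show ?thesis .
  qed
  \<comment> \<open>The cluster \<open>i\<close> is selected by the shifts \<open>x\<close> alone.
    For fixed \<open>x\<close> the integral over the independent copies \<open>y\<close> therefore
    sees one fixed cluster, whose expected supremum is \<open>gsup J (H i)\<close>.\<close>
  have inner: "a / 4 * Max (x ` A) + b \<le> (\<integral>y. ?F (merge A B (x, y)) \<partial>Gam B)" for x
  proof -
    obtain i where i: "i \<in> S" "Max (x ` A) = x (Inl i)"
      using Max_image_attained[of A x] AB S by (auto simp: A_def)
    have "a / 4 * Max (x ` A) + b \<le> a / 4 * x (Inl i) + gsup J (H i)"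
      using i g by simp
    also have "\<dots> = (\<integral>y. a / 4 * x (Inl i) + Max ((\<lambda>s. ?Y i s y) ` H i) \<partial>Gam B)"
      using i H by (subst Bochner_Integration.integral_add) (auto intro!: integrable_Max_image iY simp: EY GB.prob_space)
    also have "\<dots> \<le> (\<integral>y. ?F (merge A B (x, y)) \<partial>Gam B)"
    proof (rule integral_mono)
      show "integrable (Gam B) (\<lambda>y. a / 4 * x (Inl i) + Max ((\<lambda>s. ?Y i s y) ` H i))"
        using i H by (auto intro!: integrable_Max_image iY)
      show "integrable (Gam B) (\<lambda>y. ?F (merge A B (x, y)))"
      proof (rule integrable_Max_image[OF I])
        fix p assume "p \<in> I"
        then obtain i s where "p = (i, s)" "i \<in> S" by (auto simp: I_def)
        then show "integrable (Gam B) (\<lambda>y. lin (A \<union> B) (w p) (merge A B (x, y)))"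
          by (simp add: linw iY)
      qed
      fix y
      obtain s where s: "s \<in> H i" "Max ((\<lambda>s. ?Y i s y) ` H i) = ?Y i s y"
        using Max_image_attained[OF H[OF i(1)], of "\<lambda>s. ?Y i s y"] by blast
      have "a / 4 * x (Inl i) + Max ((\<lambda>s. ?Y i s y) ` H i) = lin (A \<union> B) (w (i, s)) (merge A B (x, y))"
        using linw[OF i(1)] s by simp
      also have "\<dots> \<le> ?F (merge A B (x, y))"
        using I i s by (intro Max_ge) (auto simp: I_def)
      finally show "a / 4 * x (Inl i) + Max ((\<lambda>s. ?Y i s y) ` H i) \<le> ?F (merge A B (x, y))" .
    qed
    finally show ?thesis .
  qed
  have cardA: "card A = card S" unfolding A_def by (rule card_image) simp
  have Ane: "A \<noteq> {}" using S by (simp add: A_def)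
  have iMA: "integrable (Gam A) (\<lambda>x. Max (x ` A))"
    using integrable_Max_image[OF AB(2) Ane, where X = "\<lambda>i x. x i"] integrable_coordinate[OF AB(2)] by simp
  have "a / 4 * (\<delta>\<^sub>0 * sqrt (ln (card S)) - 1) + b \<le> a / 4 * (\<integral>x. Max (x ` A) \<partial>Gam A) + b"
    using expectation_Max_iid[OF AB(2) Ane] a unfolding cardA by (intro add_mono mult_left_mono) auto
  also have "\<dots> = (\<integral>x. a / 4 * Max (x ` A) + b \<partial>Gam A)"
    using iMA by (simp add: GA.prob_space)
  also have "\<dots> \<le> (\<integral>x. (\<integral>y. ?F (merge A B (x, y)) \<partial>Gam B) \<partial>Gam A)"
    by (intro integral_mono inner P.integrable_fst'[OF iFm]) (use iMA in auto)
  finally show ?thesis using up FF by linarith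
qed

section \<open>From the median to the mean\<close>

definition supabs :: "'a set \<Rightarrow> ('a \<Rightarrow> real) set \<Rightarrow> ('a \<Rightarrow> real) \<Rightarrow> real" where
  "supabs J A x = Max ((\<lambda>t. \<bar>lin J t x\<bar>) ` A)"

lemma lin_combination: "lin J t (\<lambda>j\<in>J. a * x j + b * y j) = a * lin J t x + b * lin J t y"
  by (simp add: lin_def sum_distrib_left sum.distrib algebra_simps)

text \<open>The density of a normal variable with deviation \<sigma> is at most 1/sqrt(2 pi
  \<sigma>^2), so [-1, 1] has mass at most twice that. Mass 1/2 forces sqrt(2 pi \<sigma>^2) <= 4,
  and 2 pi >= 4 gives \<sigma> <= 2.\<close>

lemma norm_le_if_lin_small:
  assumes J: "finite J" and P: "1 / 2 \<le> measure (Gam J) {x \<in> space (Gam J). \<bar>lin J t x\<bar> \<le> 1}"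
  shows "L2_set t J \<le> 2"
proof (cases "0 < (\<Sum>j\<in>J. (t j)\<^sup>2)")
  case False
  then have "(\<Sum>j\<in>J. (t j)\<^sup>2) = 0" using sum_nonneg[of J "\<lambda>j. (t j)\<^sup>2"] by force
  then show ?thesis by (simp add: L2_set_def)
next
  case True
  interpret prob_space "Gam J" by (rule prob_space_Gam)
  define \<sigma> where "\<sigma> = sqrt (\<Sum>j\<in>J. (t j)\<^sup>2)"
  have \<sigma>: "0 < \<sigma>" using True by (simp add: \<sigma>_def)
  have D: "distributed (Gam J) lborel (lin J t) (normal_density 0 \<sigma>)"
    unfolding \<sigma>_def by (rule distributed_lin[OF J True])
  let ?c = "1 / sqrt (2 * pi * \<sigma>\<^sup>2)"
  have "emeasure (Gam J) (lin J t -` {-1..1} \<inter> space (Gam J)) = (\<integral>\<^sup>+x. ennreal (normal_density 0 \<sigma> x) * indicator {-1..1} x \<partial>lborel)"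
    by (rule distributed_emeasure[OF D]) simp
  also have "\<dots> \<le> (\<integral>\<^sup>+x. ennreal ?c * indicator {-1..1::real} x \<partial>lborel)"
  proof (intro nn_integral_mono mult_right_mono ennreal_leI)
    fix x :: real
    have "exp (- (x - 0)\<^sup>2 / (2 * \<sigma>\<^sup>2)) \<le> 1" by simp
    then show "normal_density 0 \<sigma> x \<le> ?c"
      unfolding normal_density_def using mult_left_mono[of "exp (- (x - 0)\<^sup>2 / (2 * \<sigma>\<^sup>2))" 1 ?c] by simp
  qed simp
  also have "\<dots> = ennreal ?c * 2"
    by (subst nn_integral_cmult_indicator) auto
  also have "\<dots> = ennreal (?c * 2)" by (subst ennreal_mult) auto
  finally have "measure (Gam J) (lin J t -` {-1..1} \<inter> space (Gam J)) \<le> ?c * 2"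
    by (simp add: emeasure_eq_measure)
  moreover have "lin J t -` {-1..1} \<inter> space (Gam J) = {x \<in> space (Gam J). \<bar>lin J t x\<bar> \<le> 1}"
    by (auto simp: abs_le_iff)
  ultimately have "1 / 2 \<le> ?c * 2" using P by simp
  then have "sqrt (2 * pi * \<sigma>\<^sup>2) \<le> 4" using \<sigma> by (simp add: field_simps)
  moreover have "2 * \<sigma> \<le> sqrt (2 * pi * \<sigma>\<^sup>2)"
  proof (rule real_le_rsqrt)
    have "4 * \<sigma>\<^sup>2 \<le> (2 * pi) * \<sigma>\<^sup>2" using pi_ge_two by (intro mult_right_mono) auto
    then show "(2 * \<sigma>)\<^sup>2 \<le> 2 * pi * \<sigma>\<^sup>2" by (simp add: power_mult_distrib)
  qed
  ultimately show ?thesis by (simp add: L2_set_def \<sigma>_def)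
qed

context
  fixes J :: "'a set" and A :: "('a \<Rightarrow> real) set"
  assumes J: "finite J" and A: "finite A" "A \<noteq> {}"
begin

lemma abs_lin_le_supabs: "t \<in> A \<Longrightarrow> \<bar>lin J t x\<bar> \<le> supabs J A x"
  unfolding supabs_def using A by (intro Max_ge) auto

lemma supabs_leI: "(\<And>t. t \<in> A \<Longrightarrow> \<bar>lin J t x\<bar> \<le> c) \<Longrightarrow> supabs J A x \<le> c"
  unfolding supabs_def using A by (intro Max.boundedI) auto

lemma supabs_nonneg: "0 \<le> supabs J A x"
proof -
  obtain t where "t \<in> A" using A by auto
  then show ?thesis using abs_lin_le_supabs[of t x] by linarith
qed

lemma measurable_supabs [measurable]: "supabs J A \<in> borel_measurable (Gam J)"
  unfolding supabs_def using A by (intro measurable_Max_image) auto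

text \<open>The two rotated vectors are again independent and standard Gaussian, so the joint
  probability factors.\<close>

lemma prob_rotated:
  assumes c: "0 < c" and cs: "c\<^sup>2 + s\<^sup>2 = 1"
  shows "measure (Gam J \<Otimes>\<^sub>M Gam J) {(x, y) \<in> space (Gam J \<Otimes>\<^sub>M Gam J).
      supabs J A (\<lambda>j\<in>J. c * x j + s * y j) \<le> r \<and> t < supabs J A (\<lambda>j\<in>J. - s * x j + c * y j)} =
    measure (Gam J) {x \<in> space (Gam J). supabs J A x \<le> r} * measure (Gam J) {x \<in> space (Gam J). t < supabs J A x}"
    (is ?thesis1)
  and sets_rotated: "{(x, y) \<in> space (Gam J \<Otimes>\<^sub>M Gam J).
      supabs J A (\<lambda>j\<in>J. c * x j + s * y j) \<le> r \<and> t < supabs J A (\<lambda>j\<in>J. - s * x j + c * y j)} \<in> sets (Gam J \<Otimes>\<^sub>M Gam J)"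
    (is ?thesis2)
proof -
  let ?P = "Gam J \<Otimes>\<^sub>M Gam J"
  interpret G: prob_space "Gam J" by (rule prob_space_Gam)
  let ?R = "\<lambda>(x, y). (\<lambda>j\<in>J. c * x j + s * y j, \<lambda>j\<in>J. - s * x j + c * y j)"
  let ?U = "{x \<in> space (Gam J). supabs J A x \<le> r}" and ?V = "{x \<in> space (Gam J). t < supabs J A x}"
  have R: "?R \<in> ?P \<rightarrow>\<^sub>M ?P" by measurable
  have UV: "?U \<in> sets (Gam J)" "?V \<in> sets (Gam J)" by measurable
  then have UVp: "?U \<times> ?V \<in> sets ?P" by (rule pair_measureI)
  have "measure (Gam J) ?U * measure (Gam J) ?V = measure ?P (?U \<times> ?V)"
    by (simp only: measure_def G.emeasure_pair_measure_Times[OF UV] enn2real_mult)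
  also have "\<dots> = measure (distr ?P ?P ?R) (?U \<times> ?V)"
    by (simp only: distr_Gam_rotation[OF c cs J])
  also have "\<dots> = measure ?P (?R -` (?U \<times> ?V) \<inter> space ?P)"
    by (rule measure_distr[OF R UVp])
  finally have m: "measure (Gam J) ?U * measure (Gam J) ?V = measure ?P (?R -` (?U \<times> ?V) \<inter> space ?P)" .
  have eq: "?R -` (?U \<times> ?V) \<inter> space ?P = {(x, y) \<in> space ?P.
      supabs J A (\<lambda>j\<in>J. c * x j + s * y j) \<le> r \<and> t < supabs J A (\<lambda>j\<in>J. - s * x j + c * y j)}"
    by (auto simp: space_pair_measure space_Gam)
  show ?thesis1 using m unfolding eq ..
  show ?thesis2 using measurable_sets[OF R UVp] unfolding eq .
qed

text \<open>
  The events that the first of two rotated copies is small and the second one large are disjoint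
  for different angles, since the second copy is a combination of the first copies of two
  rotations. Slopes \<open>k / N\<close> in place of equally spaced angles avoid trigonometry.
\<close>

lemma supabs_weak_tail:
  assumes half: "1 / 2 \<le> measure (Gam J) {x \<in> space (Gam J). supabs J A x \<le> 1}" and N: "0 < N"
  shows "measure (Gam J) {x \<in> space (Gam J). 4 * real N < supabs J A x} \<le> 2 / N"
proof -
  let ?P = "Gam J \<Otimes>\<^sub>M Gam J"
  interpret P: prob_space ?P by (intro prob_space_pair prob_space_Gam)
  define c where "c k = 1 / sqrt (1 + (k / real N)\<^sup>2)" for k
  define s where "s k = (k / real N) / sqrt (1 + (k / real N)\<^sup>2)" for k
  let ?w = "\<lambda>k. sqrt (1 + (k / real N)\<^sup>2)"
  have sq: "0 < ?w k" for k
    using zero_le_power2[of "k / real N"] by (simp add: add_pos_nonneg)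
  have c: "0 < c k" for k unfolding c_def using sq by simp
  have cs: "(c k)\<^sup>2 + (s k)\<^sup>2 = 1" for k
  proof -
    define m where "m = k / real N"
    have "0 < 1 + m\<^sup>2" by (simp add: add_pos_nonneg)
    then show ?thesis
      unfolding c_def s_def m_def[symmetric] power_divide by (simp add: add_divide_distrib[symmetric])
  qed
  define E where "E k = {(x, y) \<in> space ?P.
      supabs J A (\<lambda>j\<in>J. c k * x j + s k * y j) \<le> 1 \<and> 4 * real N < supabs J A (\<lambda>j\<in>J. - s k * x j + c k * y j)}" for k :: real
  let ?q = "measure (Gam J) {x \<in> space (Gam J). 4 * real N < supabs J A x}"
  have ME: "?q / 2 \<le> measure ?P (E k)" for k
    unfolding E_def prob_rotated[OF c cs] using half mult_right_mono[OF half, of ?q] by simp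
  have E_sets: "E k \<in> sets ?P" for k
    unfolding E_def by (rule sets_rotated[OF c cs])
  have disj: "E (real k) \<inter> E (real l) = {}" if kl: "k < N" "l < N" "k \<noteq> l" for k l :: nat
  proof (rule ccontr)
    assume "E (real k) \<inter> E (real l) \<noteq> {}"
    then obtain x y where xy: "(x, y) \<in> E (real k)" "(x, y) \<in> E (real l)" by auto
    let ?ck = "c (real k)" and ?sk = "s (real k)" and ?cl = "c (real l)" and ?sl = "s (real l)"
    let ?X = "\<lambda>j\<in>J. ?ck * x j + ?sk * y j" and ?X' = "\<lambda>j\<in>J. - ?sk * x j + ?ck * y j"
      and ?Y = "\<lambda>j\<in>J. ?cl * x j + ?sl * y j"
    have b: "supabs J A ?X \<le> 1" "4 * real N < supabs J A ?X'" "supabs J A ?Y \<le> 1"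
      using xy by (auto simp: E_def)
    \<comment> \<open>Sine of the difference of the two angles. Both normalising roots are at most
      sqrt 2, since all slopes are below 1, and the slopes differ by at least 1/N.\<close>
    define d where "d = ?ck * ?sl - ?sk * ?cl"
    have d: "1 / (2 * real N) \<le> \<bar>d\<bar>"
    proof -
      have w: "?w (real m) * ?w (real m') \<le> 2" if "m < N" "m' < N" for m m'
      proof -
        have "1 + (real m / real N)\<^sup>2 \<le> 2" if "m < N" for m
          using that N by (simp add: power_le_one)
        then have "?w (real m) \<le> sqrt 2" "?w (real m') \<le> sqrt 2"
          using that by (auto intro!: real_sqrt_le_mono)
        then have "?w (real m) * ?w (real m') \<le> sqrt 2 * sqrt 2"
          using sq[of "real m'"] by (intro mult_mono) auto
        then show ?thesis by simp
      qed
      have de: "d = (real l - real k) / real N / (?w (real k) * ?w (real l))"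
        by (simp add: d_def c_def s_def diff_divide_distrib mult_ac)
      have "1 \<le> \<bar>real l - real k\<bar>" using kl by linarith
      then have "1 / real N / 2 \<le> \<bar>real l - real k\<bar> / real N / 2"
        using N by (intro divide_right_mono) auto
      also have "\<dots> \<le> \<bar>real l - real k\<bar> / real N / (?w (real k) * ?w (real l))"
        using w[OF kl(1,2)] sq[of "real k"] sq[of "real l"] by (intro divide_left_mono) auto
      also have "\<dots> = \<bar>d\<bar>"
        using sq[of "real k"] sq[of "real l"] unfolding de by (simp add: abs_divide abs_mult)
      finally show ?thesis by simp
    qed
    have "supabs J A ?X' \<le> 4 * real N"
    proof (rule supabs_leI)
      fix t assume t: "t \<in> A"
      define \<alpha> \<beta> where "\<alpha> = lin J t x" and "\<beta> = lin J t y"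
      \<comment> \<open>The second vector of one rotation is expressed through the first vectors of
        both rotations, each bounded by 1 on these functionals. This gives 2/|d| <= 4 N, against the
        event that it exceeds 4 N.\<close>
      have "d * (- ?sk * \<alpha> + ?ck * \<beta>) = (?cl * \<alpha> + ?sl * \<beta>) - (?cl * ?ck + ?sl * ?sk) * (?ck * \<alpha> + ?sk * \<beta>)"
      proof -
        have "d * (- ?sk * \<alpha> + ?ck * \<beta>) = (?cl * \<alpha> + ?sl * \<beta>) * (?ck\<^sup>2 + ?sk\<^sup>2) - (?cl * ?ck + ?sl * ?sk) * (?ck * \<alpha> + ?sk * \<beta>)"
          unfolding d_def by algebra
        then show ?thesis by (simp only: cs mult_1_right)
      qed
      moreover have "\<bar>?cl * ?ck + ?sl * ?sk\<bar> \<le> 1"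
      proof -
        have "(?cl * ?ck + ?sl * ?sk)\<^sup>2 = (?ck\<^sup>2 + ?sk\<^sup>2) * (?cl\<^sup>2 + ?sl\<^sup>2) - d\<^sup>2"
          unfolding d_def by algebra
        also have "\<dots> \<le> 1\<^sup>2" by (simp add: cs)
        finally show ?thesis by (subst (asm) abs_le_square_iff[symmetric]) simp
      qed
      moreover have "\<bar>?ck * \<alpha> + ?sk * \<beta>\<bar> \<le> 1" "\<bar>?cl * \<alpha> + ?sl * \<beta>\<bar> \<le> 1"
        using abs_lin_le_supabs[OF t, of ?X] abs_lin_le_supabs[OF t, of ?Y] b
        unfolding lin_combination \<alpha>_def \<beta>_def by linarith+
      moreover from calculation have "\<bar>(?cl * ?ck + ?sl * ?sk) * (?ck * \<alpha> + ?sk * \<beta>)\<bar> \<le> 1 * 1"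
        unfolding abs_mult by (intro mult_mono) auto
      ultimately have "\<bar>d * (- ?sk * \<alpha> + ?ck * \<beta>)\<bar> \<le> 2" by linarith
      then have "\<bar>d\<bar> * \<bar>- ?sk * \<alpha> + ?ck * \<beta>\<bar> \<le> 2" by (simp only: abs_mult)
      moreover have "1 / (2 * real N) * \<bar>- ?sk * \<alpha> + ?ck * \<beta>\<bar> \<le> \<bar>d\<bar> * \<bar>- ?sk * \<alpha> + ?ck * \<beta>\<bar>"
        using d by (intro mult_right_mono) auto
      ultimately have "1 / (2 * real N) * \<bar>- ?sk * \<alpha> + ?ck * \<beta>\<bar> \<le> 2" by linarith
      then have "\<bar>- ?sk * \<alpha> + ?ck * \<beta>\<bar> \<le> 4 * real N" using N by (simp add: field_simps)
      then show "\<bar>lin J t ?X'\<bar> \<le> 4 * real N" unfolding lin_combination \<alpha>_def \<beta>_def .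
    qed
    with b show False by simp
  qed
  have "real N * (?q / 2) = (\<Sum>k<N. ?q / 2)" by simp
  also have "\<dots> \<le> (\<Sum>k<N. measure ?P (E (real k)))" by (intro sum_mono ME)
  also have "\<dots> = measure ?P (\<Union>k<N. E (real k))"
    by (rule P.finite_measure_finite_Union[symmetric]) (use E_sets disj in \<open>auto simp: disjoint_family_on_def\<close>)
  also have "\<dots> \<le> 1" by (rule P.prob_le_1)
  finally show ?thesis using N by (simp add: field_simps)
qed

text \<open>Fernique's argument: if (x + y)/sqrt 2 is small and (y - x)/sqrt 2 is large, then x and
  y are both large, which squares the tail. With the weak tail 2/N at level 4 N this yields half the
  tail at 8 N to be at most (2/N)^2, now integrable.\<close>

lemma supabs_fernique:
  assumes half: "1 / 2 \<le> measure (Gam J) {x \<in> space (Gam J). supabs J A x \<le> 1}" and N: "0 < N"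
  shows "measure (Gam J) {x \<in> space (Gam J). 8 * real N < supabs J A x} \<le> 8 / (real N)\<^sup>2"
proof -
  let ?P = "Gam J \<Otimes>\<^sub>M Gam J"
  interpret G: prob_space "Gam J" by (rule prob_space_Gam)
  interpret P: prob_space ?P by (intro prob_space_pair prob_space_Gam)
  define c :: real where "c = 1 / sqrt 2"
  have c: "0 < c" "c\<^sup>2 + c\<^sup>2 = 1" by (auto simp: c_def power_divide)
  let ?q = "\<lambda>t. measure (Gam J) {x \<in> space (Gam J). t < supabs J A x}"
  let ?V = "{x \<in> space (Gam J). 4 * real N < supabs J A x}"
  let ?E = "{(x, y) \<in> space ?P.
      supabs J A (\<lambda>j\<in>J. c * x j + c * y j) \<le> 1 \<and> 8 * real N < supabs J A (\<lambda>j\<in>J. - c * x j + c * y j)}"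
  have V: "?V \<in> sets (Gam J)" by measurable
  have "?q (8 * real N) / 2 \<le> measure ?P ?E"
    unfolding prob_rotated[OF c] using mult_right_mono[OF half, of "?q (8 * real N)"] by simp
  also have "\<dots> \<le> measure ?P (?V \<times> ?V)"
  proof (rule P.finite_measure_mono)
    show "?V \<times> ?V \<in> sets ?P" using V by (intro pair_measureI)
    show "?E \<subseteq> ?V \<times> ?V"
    proof
      fix z assume "z \<in> ?E"
      then obtain x y where z: "z = (x, y)" and xy: "(x, y) \<in> space ?P" and
        b: "supabs J A (\<lambda>j\<in>J. c * x j + c * y j) \<le> 1" "8 * real N < supabs J A (\<lambda>j\<in>J. - c * x j + c * y j)"
        by blast
      let ?X = "\<lambda>j\<in>J. c * x j + c * y j" and ?Y = "\<lambda>j\<in>J. - c * x j + c * y j"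
      obtain t where t: "t \<in> A" "8 * real N < \<bar>lin J t ?Y\<bar>"
        using b(2) supabs_leI[of ?Y "8 * real N"] by (meson not_le)
      have 1: "\<bar>c * lin J t x + c * lin J t y\<bar> \<le> 1"
        using abs_lin_le_supabs[OF t(1), of ?X] b(1) unfolding lin_combination by linarith
      have 2: "8 * real N < \<bar>c * lin J t y - c * lin J t x\<bar>"
        using t(2) unfolding lin_combination by simp
      have N1: "1 \<le> real N" using N by simp
      \<comment> \<open>Since 2 c = sqrt 2 <= 3/2, a value |u| <= 4 N would give 2 c |u| <= 6 N,
        below the 7 N that remain of 8 N after the error 1 <= N.\<close>
      have c34: "2 * c \<le> 3 / 2"
      proof -
        have "(2 * c)\<^sup>2 \<le> (3/2)\<^sup>2" by (simp add: c_def power_divide power_mult_distrib)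
        then show ?thesis by (rule power2_le_imp_le) simp
      qed
      have g: "4 * real N < \<bar>u\<bar>" if "7 * real N < 2 * c * \<bar>u\<bar>" for u
      proof (rule ccontr)
        assume "\<not> 4 * real N < \<bar>u\<bar>"
        then have "2 * c * \<bar>u\<bar> \<le> 3 / 2 * (4 * real N)" using c34 c by (intro mult_mono) auto
        with that N1 show False by linarith
      qed
      have "7 * n < \<bar>2 * p\<bar>" "7 * n < \<bar>2 * q\<bar>" if "\<bar>p + q\<bar> \<le> 1" "8 * n < \<bar>q - p\<bar>" "1 \<le> n" for p q n :: real
        using that by linarith+
      from this[OF 1 2 N1]
      have "7 * real N < \<bar>2 * (c * lin J t x)\<bar>" "7 * real N < \<bar>2 * (c * lin J t y)\<bar>" .
      then have "4 * real N < \<bar>lin J t x\<bar>" "4 * real N < \<bar>lin J t y\<bar>"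
        using c by (auto intro!: g simp: abs_mult)
      then show "z \<in> ?V \<times> ?V"
        using z xy abs_lin_le_supabs[OF t(1), of x] abs_lin_le_supabs[OF t(1), of y] by (auto simp: space_pair_measure)
    qed
  qed
  also have "\<dots> = ?q (4 * real N) * ?q (4 * real N)"
    by (simp only: measure_def G.emeasure_pair_measure_Times[OF V V] enn2real_mult)
  also have "\<dots> \<le> (2 / N) * (2 / N)"
    using supabs_weak_tail[OF half N] by (intro mult_mono) auto
  finally show ?thesis by (simp add: power2_eq_square)
qed

text \<open>Dyadic layers with the quadratic tail at N = 2^k: the bound is 8 plus the sum over k of
  16 * 2^k * 8 / 4^k, that is 8 + 256.\<close>

lemma gsup_le_if_half:
  assumes half: "1 / 2 \<le> measure (Gam J) {x \<in> space (Gam J). supabs J A x \<le> 1}"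
  shows "gsup J A \<le> 264"
proof -
  interpret G: prob_space "Gam J" by (rule prob_space_Gam)
  let ?p = "supabs J A"
  let ?V = "\<lambda>k::nat. {x \<in> space (Gam J). 8 * 2 ^ k < ?p x}"
  have V [measurable]: "?V k \<in> sets (Gam J)" for k by measurable
  have q: "measure (Gam J) (?V k) \<le> 8 * (1 / 4) ^ k" for k
    using supabs_fernique[OF half, of "2 ^ k"] by (simp add: power_divide power2_eq_square power_mult_distrib[symmetric])
  have pt: "ennreal (?p x) \<le> ennreal 8 + (\<Sum>k. ennreal (16 * 2 ^ k) * indicator (?V k) x)" if x: "x \<in> space (Gam J)" for x
  proof (cases "?p x \<le> 8")
    case True
    then have "ennreal (?p x) \<le> ennreal 8" by (rule ennreal_leI)
    also have "\<dots> \<le> ennreal 8 + (\<Sum>k. ennreal (16 * 2 ^ k) * indicator (?V k) x)" by simp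
    finally show ?thesis .
  next
    case False
    obtain K :: nat where "?p x / 8 < 2 ^ K" using real_arch_pow[of 2 "?p x / 8"] by auto
    then have "\<exists>K::nat. ?p x \<le> 8 * 2 ^ K" by (intro exI[of _ K]) simp
    define K where "K = (LEAST K::nat. ?p x \<le> 8 * 2 ^ K)"
    have K: "?p x \<le> 8 * 2 ^ K" unfolding K_def by (rule LeastI_ex) fact
    have "K \<noteq> 0" using K False by (cases K) auto
    then obtain k where k: "K = Suc k" by (cases K) auto
    have "\<not> ?p x \<le> 8 * 2 ^ k" unfolding K_def by (rule not_less_Least) (use k in \<open>simp add: K_def\<close>)
    then have xk: "x \<in> ?V k" using x by simp
    have "ennreal (?p x) \<le> ennreal (16 * 2 ^ k)" using K k by (intro ennreal_leI) simp
    also have "\<dots> = (\<Sum>i\<in>{k}. ennreal (16 * 2 ^ i) * indicator (?V i) x)" using xk by simp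
    also have "\<dots> \<le> (\<Sum>i. ennreal (16 * 2 ^ i) * indicator (?V i) x)"
      by (rule sum_le_suminf) auto
    also have "\<dots> \<le> ennreal 8 + \<dots>" by simp
    finally show ?thesis .
  qed
  have "(\<integral>\<^sup>+x. ennreal (?p x) \<partial>Gam J) \<le> (\<integral>\<^sup>+x. ennreal 8 + (\<Sum>k. ennreal (16 * 2 ^ k) * indicator (?V k) x) \<partial>Gam J)"
    by (intro nn_integral_mono pt)
  also have "\<dots> = ennreal 8 + (\<Sum>k. ennreal (16 * 2 ^ k) * emeasure (Gam J) (?V k))"
  proof -
    have "(\<integral>\<^sup>+x. ennreal 8 + (\<Sum>k. ennreal (16 * 2 ^ k) * indicator (?V k) x) \<partial>Gam J) =
      (\<integral>\<^sup>+x. ennreal 8 \<partial>Gam J) + (\<integral>\<^sup>+x. (\<Sum>k. ennreal (16 * 2 ^ k) * indicator (?V k) x) \<partial>Gam J)"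
      using V by (intro nn_integral_add) (auto intro!: borel_measurable_suminf)
    also have "(\<integral>\<^sup>+x. (\<Sum>k. ennreal (16 * 2 ^ k) * indicator (?V k) x) \<partial>Gam J) =
      (\<Sum>k. (\<integral>\<^sup>+x. ennreal (16 * 2 ^ k) * indicator (?V k) x \<partial>Gam J))"
      using V by (intro nn_integral_suminf borel_measurable_times_ennreal borel_measurable_indicator) auto
    also have "\<dots> = (\<Sum>k. ennreal (16 * 2 ^ k) * emeasure (Gam J) (?V k))"
      by (intro suminf_cong nn_integral_cmult_indicator V)
    finally show ?thesis by (simp only: nn_integral_const G.emeasure_space_1 mult_1_right)
  qed
  also have "\<dots> \<le> ennreal 8 + (\<Sum>k. ennreal (128 * (1 / 2) ^ k))"
  proof (intro add_left_mono suminf_le)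
    fix k :: nat
    have "ennreal (16 * 2 ^ k) * emeasure (Gam J) (?V k) = ennreal (16 * 2 ^ k * measure (Gam J) (?V k))"
      by (simp add: G.emeasure_eq_measure ennreal_mult)
    also have "\<dots> \<le> ennreal (16 * 2 ^ k * (8 * (1 / 4) ^ k))"
      by (intro ennreal_leI mult_left_mono q) auto
    also have "16 * 2 ^ k * (8 * (1 / 4) ^ k) = 128 * (1 / 2 :: real) ^ k"
      by (simp add: power_mult_distrib[symmetric])
    finally show "ennreal (16 * 2 ^ k) * emeasure (Gam J) (?V k) \<le> ennreal (128 * (1 / 2) ^ k)" .
  qed auto
  also have "(\<Sum>k. ennreal (128 * (1 / 2) ^ k)) = ennreal 256"
  proof -
    have "(\<lambda>k. 128 * (1 / 2 :: real) ^ k) sums (128 * (1 / (1 - 1 / 2)))"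
      by (intro sums_mult geometric_sums) simp
    then show ?thesis by (subst suminf_ennreal_eq[of _ 256]) auto
  qed
  also have "ennreal 8 + ennreal 256 = ennreal 264" by (subst ennreal_plus[symmetric]) auto
  finally have nn: "(\<integral>\<^sup>+x. ennreal (?p x) \<partial>Gam J) \<le> ennreal 264" .
  have ip: "integrable (Gam J) ?p"
    unfolding supabs_def using A by (intro integrable_Max_image integrable_abs integrable_lin J)
  have "gsup J A \<le> (\<integral>x. ?p x \<partial>Gam J)"
    unfolding gsup_def
  proof (rule integral_mono)
    show "integrable (Gam J) (\<lambda>x. Max ((\<lambda>t. lin J t x) ` A))"
      using A by (intro integrable_Max_image integrable_lin J)
    show "integrable (Gam J) ?p" by (rule ip)
    show "Max ((\<lambda>t. lin J t x) ` A) \<le> ?p x" for x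
      using A abs_lin_le_supabs[of _ x] by (intro Max.boundedI) (auto intro: order_trans[OF abs_ge_self])
  qed
  also have "\<dots> \<le> 264"
  proof -
    have "ennreal (\<integral>x. ?p x \<partial>Gam J) = (\<integral>\<^sup>+x. ennreal (?p x) \<partial>Gam J)"
      by (rule nn_integral_eq_integral[symmetric, OF ip]) (simp add: supabs_nonneg)
    then have "ennreal (\<integral>x. ?p x \<partial>Gam J) \<le> ennreal 264" using nn by (simp only:)
    then show ?thesis by (subst (asm) ennreal_le_iff) auto
  qed
  finally show ?thesis .
qed

end

section \<open>Chaining along a labelled partition tree\<close>

text \<open>
  Abstract form of the comparison: \<open>g\<close> is a set functional satisfying the super-Sudakov inequality
  \<open>growth\<close> with respect to the metric \<open>d\<close>.
\<close>

locale majorizing =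
  fixes d :: "'p \<Rightarrow> 'p \<Rightarrow> real" and g :: "'p set \<Rightarrow> real" and A :: "'p set" and c e :: real
  assumes finA: "finite A" and A_ne: "A \<noteq> {}" and c_pos: "0 < c" and e_nonneg: "0 \<le> e"
    and d_self: "d x x = 0" and d_commute: "d x y = d y x" and d_triangle: "d x z \<le> d x y + d y z"
    and d_nonneg: "0 \<le> d x y" and d_eq_0: "x \<in> A \<Longrightarrow> y \<in> A \<Longrightarrow> d x y = 0 \<Longrightarrow> x = y"
    and g_mono: "B \<subseteq> B' \<Longrightarrow> B' \<subseteq> A \<Longrightarrow> B \<noteq> {} \<Longrightarrow> g B \<le> g B'"
    and g_nonneg: "B \<subseteq> A \<Longrightarrow> B \<noteq> {} \<Longrightarrow> 0 \<le> g B"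
    and growth: "\<And>(S :: nat set) t H a b. finite S \<Longrightarrow> S \<noteq> {} \<Longrightarrow> 0 < a \<Longrightarrow>
      (\<And>i. i \<in> S \<Longrightarrow> t i \<in> A) \<Longrightarrow> (\<And>i. i \<in> S \<Longrightarrow> H i \<subseteq> A) \<Longrightarrow> (\<And>i. i \<in> S \<Longrightarrow> H i \<noteq> {}) \<Longrightarrow>
      (\<And>i j. i \<in> S \<Longrightarrow> j \<in> S \<Longrightarrow> i \<noteq> j \<Longrightarrow> a \<le> d (t i) (t j)) \<Longrightarrow>
      (\<And>i s. i \<in> S \<Longrightarrow> s \<in> H i \<Longrightarrow> d s (t i) \<le> a / 4) \<Longrightarrow>
      (\<And>i. i \<in> S \<Longrightarrow> b \<le> g (H i)) \<Longrightarrow>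
      a * (c * sqrt (ln (card S)) - e) + b \<le> g (\<Union>i\<in>S. H i)"
begin

text \<open>Labels start at 0, so \<open>l x + 1\<close> counts the greedy centres up to and
  including that of the cell of \<open>x\<close>.\<close>

definition good_labelling :: "'p set \<Rightarrow> real \<Rightarrow> ('p \<Rightarrow> nat) \<Rightarrow> bool" where
  "good_labelling B a l \<longleftrightarrow> (\<forall>x\<in>B.
     (\<forall>y\<in>B. l y = l x \<longrightarrow> d x y \<le> 2 * a) \<and>
     g {y\<in>B. l y = l x \<and> d y x \<le> a / 4} + a * (c * sqrt (ln (real (l x) + 1)) - e) \<le> g B)"

text \<open>A point \<open>x\<close> with label m was available at stages 0, ..., m, so each centre
  chosen there has a small ball with \<open>g\<close> at least that of the small ball around
  \<open>x\<close>. These m + 1 centres are separated by \<open>a\<close>; \<open>growth\<close>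
  applied to their small balls gives the decrement.\<close>

lemma good_labelling_exists:
  assumes B: "B \<subseteq> A" and a: "0 < a"
  shows "\<exists>l. good_labelling B a l"
proof -
  let ?G = "\<lambda>D s. g {y\<in>D. d y s \<le> a / 4}"
  have finB: "finite B" using B finA finite_subset by auto
  define ctr where "ctr D = (SOME t. t \<in> D \<and> (\<forall>s\<in>D. ?G D s \<le> ?G D t))" for D
  have ctr: "ctr D \<in> D" "\<And>s. s \<in> D \<Longrightarrow> ?G D s \<le> ?G D (ctr D)"
    if D: "D \<subseteq> B" "D \<noteq> {}" for D
  proof -
    have fD: "finite D" using D finB finite_subset by auto
    obtain t where "t \<in> D" "Max ((\<lambda>s. ?G D s) ` D) = ?G D t"
      using Max_image_attained[OF fD D(2), of "\<lambda>s. ?G D s"] by blast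
    then have "t \<in> D \<and> (\<forall>s\<in>D. ?G D s \<le> ?G D t)"
      using fD by (metis (no_types, lifting) Max_ge finite_imageI imageI)
    from someI[where P = "\<lambda>t. t \<in> D \<and> (\<forall>s\<in>D. ?G D s \<le> ?G D t)", OF this]
    show "ctr D \<in> D" "\<And>s. s \<in> D \<Longrightarrow> ?G D s \<le> ?G D (ctr D)"
      unfolding ctr_def by blast+
  qed
  \<comment> \<open>\<open>D n\<close> is what is left after removing \<open>n\<close> balls. Each
    removal takes at least the centre, so nothing remains after \<open>card B + 1\<close>
    rounds.\<close>
  define D where "D = rec_nat B (\<lambda>_ D. {y\<in>D. a \<le> d y (ctr D)})"
  have D0: "D 0 = B" and DS: "D (Suc n) = {y\<in>D n. a \<le> d y (ctr (D n))}" for n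
    by (simp_all add: D_def)
  have D_anti: "D j \<subseteq> D i" if "i \<le> j" for i j
    using that by (induction rule: dec_induct) (auto simp: DS)
  have DB: "D n \<subseteq> B" for n using D_anti[of 0 n] D0 by auto
  have card: "card (D n) + n \<le> card B" if "D n \<noteq> {}" for n
    using that
  proof (induction n)
    case 0
    then show ?case by (simp add: D0)
  next
    case (Suc n)
    have ne: "D n \<noteq> {}" using Suc.prems D_anti[of n "Suc n"] by auto
    have "ctr (D n) \<in> D n - D (Suc n)" using ctr(1)[OF DB ne] a by (auto simp: DS d_self)
    then have "D (Suc n) \<subset> D n" using D_anti[of n "Suc n"] by auto
    then have "card (D (Suc n)) < card (D n)" using finB DB finite_subset by (metis psubset_card_mono)
    with Suc.IH[OF ne] show ?case by simp
  qed
  have emp: "D (Suc (card B)) = {}" using card[of "Suc (card B)"] by fastforce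
  define l where "l x = (LEAST n. x \<notin> D (Suc n))" for x
  have l1: "x \<notin> D (Suc (l x))" for x
    unfolding l_def by (rule LeastI[of _ "card B"]) (simp add: emp)
  have l2: "x \<in> D (l x)" if "x \<in> B" for x
  proof (cases "l x")
    case 0
    then show ?thesis using that by (simp add: D0)
  next
    case (Suc m)
    then have "m < l x" by simp
    then have "x \<in> D (Suc m)" unfolding l_def using not_less_Least by blast
    then show ?thesis using Suc by simp
  qed
  have l3: "d x (ctr (D (l x))) < a" if "x \<in> B" for x
    using l1[of x] l2[OF that] by (simp add: DS)
  have "good_labelling B a l"
    unfolding good_labelling_def
  proof (intro ballI conjI impI)
    fix x assume x: "x \<in> B"
    show "d x y \<le> 2 * a" if "y \<in> B" "l y = l x" for y
      using d_triangle[of x y "ctr (D (l x))"] l3[OF x] l3[OF that(1)] that(2)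
      by (simp add: d_commute[of "ctr (D (l x))" y])
    define H where "H j = {y\<in>D j. d y (ctr (D j)) \<le> a / 4}" for j
    let ?C = "{y\<in>B. l y = l x \<and> d y x \<le> a / 4}"
    have xD: "x \<in> D j" if "j \<le> l x" for j using l2[OF x] D_anti[OF that] by auto
    have ne: "D j \<noteq> {}" if "j \<le> l x" for j using xD[OF that] by auto
    have cj: "ctr (D j) \<in> D j" if "j \<le> l x" for j by (rule ctr(1)[OF DB ne[OF that]])
    have gH: "g ?C \<le> g (H j)" if j: "j \<le> l x" for j
    proof -
      have "g ?C \<le> g {y\<in>D j. d y x \<le> a / 4}"
      proof (rule g_mono)
        show "?C \<subseteq> {y\<in>D j. d y x \<le> a / 4}" using l2 D_anti[OF j] by fastforce
        show "{y\<in>D j. d y x \<le> a / 4} \<subseteq> A" using DB B by auto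
        show "?C \<noteq> {}" using x a by (auto simp: d_self)
      qed
      also have "\<dots> \<le> g (H j)" unfolding H_def by (rule ctr(2)[OF DB ne[OF j] xD[OF j]])
      finally show ?thesis .
    qed
    have "a * (c * sqrt (ln (card {..l x})) - e) + g ?C \<le> g (\<Union>j\<in>{..l x}. H j)"
    proof (rule growth[where t = "\<lambda>j. ctr (D j)"])
      show "0 < a" by fact
      show "ctr (D j) \<in> A" if "j \<in> {..l x}" for j using cj[of j] that DB B by auto
      show "H j \<subseteq> A" if "j \<in> {..l x}" for j unfolding H_def using DB B by auto
      show "H j \<noteq> {}" if "j \<in> {..l x}" for j unfolding H_def using cj[of j] that a by (auto simp: d_self)
      show "d s (ctr (D j)) \<le> a / 4" if "s \<in> H j" for j s using that by (simp add: H_def)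
      show "g ?C \<le> g (H j)" if "j \<in> {..l x}" for j using gH that by simp
      have sep: "a \<le> d (ctr (D j)) (ctr (D i))" if "i < j" "j \<le> l x" for i j
      proof -
        have "ctr (D j) \<in> D (Suc i)" using cj[OF that(2)] D_anti[of "Suc i" j] that(1) by auto
        then show ?thesis by (simp add: DS)
      qed
      show "a \<le> d (ctr (D i)) (ctr (D j))" if "i \<in> {..l x}" "j \<in> {..l x}" "i \<noteq> j" for i j
        using that sep[of i j] sep[of j i] by (cases "i < j") (auto simp: d_commute)
    qed auto
    also have "\<dots> \<le> g B"
    proof (rule g_mono)
      show "(\<Union>j\<in>{..l x}. H j) \<subseteq> B" using DB by (auto simp: H_def)
      have "ctr (D 0) \<in> H 0" using cj[of 0] a by (simp add: H_def d_self)
      then show "(\<Union>j\<in>{..l x}. H j) \<noteq> {}" by blast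
    qed fact
    finally show "g ?C + a * (c * sqrt (ln (real (l x) + 1)) - e) \<le> g B" by (simp add: add_ac)
  qed
  then show ?thesis by blast
qed

definition labelling :: "'p set \<Rightarrow> real \<Rightarrow> 'p \<Rightarrow> nat" where
  "labelling B a = (SOME l. good_labelling B a l)"

lemma good_labelling_labelling: "B \<subseteq> A \<Longrightarrow> 0 < a \<Longrightarrow> good_labelling B a (labelling B a)"
  unfolding labelling_def using good_labelling_exists by (rule someI_ex)

end

text \<open>The factor 20 puts the root on the same footing as all other cells: a cell at level k +
  1 has diameter at most \<open>2 * rad k = 20 * rad (Suc k)\<close>.\<close>

locale majorizing_tree = majorizing d g A c e
  for d :: "'p \<Rightarrow> 'p \<Rightarrow> real" and g A c e +
  fixes a\<^sub>0 :: real
  assumes a\<^sub>0: "0 < a\<^sub>0" and diam: "x \<in> A \<Longrightarrow> y \<in> A \<Longrightarrow> d x y \<le> 20 * a\<^sub>0"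
begin

text \<open>The ratio 10 makes 20 / 10^2 = 1/5 at most 1/4, so a cell two levels down fits into a
  small ball of the greedy step.\<close>

definition rad :: "nat \<Rightarrow> real" where "rad k = a\<^sub>0 / 10 ^ k"

primrec cell :: "nat \<Rightarrow> 'p \<Rightarrow> 'p set" where
  "cell 0 x = A"
| "cell (Suc k) x = {y \<in> cell k x. labelling (cell k x) (rad k) y = labelling (cell k x) (rad k) x}"

definition lab :: "nat \<Rightarrow> 'p \<Rightarrow> nat" where "lab k x = labelling (cell k x) (rad k) x"

primrec code :: "nat \<Rightarrow> 'p \<Rightarrow> nat list" where
  "code 0 x = []"
| "code (Suc k) x = lab k x # code k x"

text \<open>Chosen from the cell and not from \<open>x\<close>, so that points with equal codes
  share their representatives; the union bound over codes relies on this.\<close>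

definition rep :: "nat \<Rightarrow> 'p \<Rightarrow> 'p" where "rep k x = (SOME y. y \<in> cell k x)"

lemma rad_pos: "0 < rad k" by (simp add: rad_def a\<^sub>0)

lemma rad_Suc: "rad (Suc k) = rad k / 10" by (simp add: rad_def)

lemma cell_subset: "cell k x \<subseteq> A" by (induction k) auto

lemma cell_self: "x \<in> A \<Longrightarrow> x \<in> cell k x" by (induction k) auto

lemma cell_labelling: "good_labelling (cell k x) (rad k) (labelling (cell k x) (rad k))"
  by (rule good_labelling_labelling[OF cell_subset rad_pos])

lemma rep_in_cell: "x \<in> A \<Longrightarrow> rep k x \<in> cell k x"
  unfolding rep_def by (rule someI) (rule cell_self)

lemma code_eq_imp: "code k x = code k y \<Longrightarrow> cell k x = cell k y"
  by (induction k) (auto simp: lab_def)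

lemma cell_diam:
  assumes "y \<in> cell k x" "z \<in> cell k x"
  shows "d y z \<le> 20 * rad k"
proof (cases k)
  case 0
  then show ?thesis using assms diam by (simp add: rad_def)
next
  case (Suc m)
  then have "y \<in> cell m x" "z \<in> cell m x" "labelling (cell m x) (rad m) z = labelling (cell m x) (rad m) y"
    using assms by auto
  then have "d y z \<le> 2 * rad m"
    using cell_labelling[of m x] unfolding good_labelling_def by blast
  then show ?thesis by (simp add: Suc rad_Suc)
qed

text \<open>The greedy choice at level \<open>k\<close> controls the cell two levels below: its diameter is below \<open>rad k / 4\<close>.\<close>

lemma cell_drop:
  assumes x: "x \<in> A"
  shows "g (cell (Suc (Suc k)) x) + rad k * (c * sqrt (ln (real (lab k x) + 1)) - e) \<le> g (cell k x)"
proof -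
  let ?C = "{y \<in> cell k x. labelling (cell k x) (rad k) y = labelling (cell k x) (rad k) x \<and> d y x \<le> rad k / 4}"
  have "g (cell (Suc (Suc k)) x) \<le> g ?C"
  proof (rule g_mono)
    show "cell (Suc (Suc k)) x \<subseteq> ?C"
    proof
      fix y assume y: "y \<in> cell (Suc (Suc k)) x"
      have "d y x \<le> 20 * rad (Suc (Suc k))" using y cell_self[OF x] by (rule cell_diam)
      also have "\<dots> \<le> rad k / 4" using rad_pos[of k] by (simp add: rad_Suc)
      finally show "y \<in> ?C" using y by simp
    qed
    show "?C \<subseteq> A" using cell_subset by auto
    show "cell (Suc (Suc k)) x \<noteq> {}" using cell_self[OF x, of "Suc (Suc k)"] by blast
  qed
  moreover have "g ?C + rad k * (c * sqrt (ln (real (lab k x) + 1)) - e) \<le> g (cell k x)"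
    using cell_labelling[of k x] cell_self[OF x, of k] unfolding good_labelling_def lab_def by blast
  ultimately show ?thesis by simp
qed

lemma rad_sum: "(\<Sum>k<K. rad k) \<le> 2 * a\<^sub>0"
proof -
  have "(\<Sum>k<K. rad k) + 2 * rad K \<le> 2 * a\<^sub>0"
  proof (induction K)
    case 0
    show ?case by (simp add: rad_def)
  next
    case (Suc K)
    then show ?case using rad_pos[of K] by (simp add: rad_Suc)
  qed
  then show ?thesis using rad_pos[of K] by linarith
qed

text \<open>\<open>cell_drop\<close> compares levels k and k + 2, so the sum telescopes to two
  initial terms minus two final ones; hence the factor 2 in front of \<open>g A\<close>. The errors
  \<open>e * rad k\<close> form a geometric series.\<close>

lemma path_sum:
  assumes x: "x \<in> A"
  shows "(\<Sum>k<K. rad k * sqrt (ln (real (lab k x) + 1))) \<le> (2 * g A + 2 * e * a\<^sub>0) / c"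
proof -
  let ?G = "\<lambda>k. g (cell k x)"
  have "(\<Sum>k<K. rad k * (c * sqrt (ln (real (lab k x) + 1)) - e)) \<le> ?G 0 + ?G 1 - ?G K - ?G (Suc K)"
  proof (induction K)
    case (Suc K)
    then show ?case using cell_drop[OF x, of K] by simp
  qed simp
  also have "\<dots> \<le> 2 * g A"
  proof -
    have ne: "cell k x \<noteq> {}" for k using cell_self[OF x, of k] by blast
    have "?G 1 \<le> g A" by (rule g_mono[OF cell_subset order_refl ne])
    moreover have "0 \<le> ?G k" for k by (rule g_nonneg[OF cell_subset ne])
    from this[of K] this[of "Suc K"] have "0 \<le> ?G K + ?G (Suc K)" by linarith
    ultimately show ?thesis by simp
  qed
  finally have 1: "(\<Sum>k<K. rad k * (c * sqrt (ln (real (lab k x) + 1)) - e)) \<le> 2 * g A" .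
  have "(\<Sum>k<K. rad k * (c * sqrt (ln (real (lab k x) + 1)) - e)) =
    c * (\<Sum>k<K. rad k * sqrt (ln (real (lab k x) + 1))) - e * (\<Sum>k<K. rad k)"
    by (simp add: right_diff_distrib sum_subtractf sum_distrib_left mult_ac)
  moreover have "e * (\<Sum>k<K. rad k) \<le> e * (2 * a\<^sub>0)"
    using e_nonneg rad_sum by (intro mult_left_mono)
  ultimately have "c * (\<Sum>k<K. rad k * sqrt (ln (real (lab k x) + 1))) \<le> 2 * g A + 2 * e * a\<^sub>0"
    using 1 by simp
  then show ?thesis using c_pos by (simp add: pos_le_divide_eq mult.commute)
qed

text \<open>Budget of a branch in the union bound. Over all labels the factors of one level sum to
  at most 1/4, so the total budget decays geometrically with depth; the shift by 2 keeps label 0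
  well below 1 as well.\<close>

definition wt :: "nat list \<Rightarrow> real" where "wt cs = (\<Prod>i\<leftarrow>cs. 1 / (real i + 2) ^ 4)"

lemma sum_inverse_fourth: "(\<Sum>i\<le>M. 1 / (real i + 2) ^ 4) \<le> 1 / 4"
proof -
  \<comment> \<open>Strengthened to a telescoping form: with r = i + 1 >= 2 one has 1/(r+1)^4 <=
    (1/r - 1/(r+1))/4.\<close>
  have "(\<Sum>i\<le>M. 1 / (real i + 2) ^ 4) \<le> (1 - 1 / (real M + 2)) / 4"
  proof (induction M)
    case 0
    show ?case by simp
  next
    case (Suc M)
    define r where "r = real M + 2"
    have r: "2 \<le> r" by (simp add: r_def)
    have "1 / (r + 1) ^ 4 \<le> 1 / (4 * (r * (r + 1)))"
    proof (rule divide_left_mono)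
      have "4 * (r * (r + 1)) \<le> (r + 1)\<^sup>2 * (r * (r + 1))"
        using r power_mono[of 2 "r + 1" 2] by (intro mult_right_mono) auto
      also have "\<dots> \<le> (r + 1)\<^sup>2 * ((r + 1) * (r + 1))"
        using r by (intro mult_left_mono mult_right_mono) auto
      also have "\<dots> = (r + 1) ^ 4" by (simp add: power_numeral_reduce)
      finally show "4 * (r * (r + 1)) \<le> (r + 1) ^ 4" .
    qed (use r in auto)
    also have "\<dots> = (1 / r - 1 / (r + 1)) / 4" using r by (simp add: divide_simps)
    finally show ?case using Suc by (simp add: r_def add.commute[of 1])
  qed
  also have "\<dots> \<le> 1 / 4" by simp
  finally show ?thesis .
qed

lemma wt_nonneg: "0 \<le> wt cs"
  unfolding wt_def by (induction cs) auto

lemma sum_wt_codes: "(\<Sum>cs\<in>code k ` A. wt cs) \<le> (1 / 4) ^ k"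
proof (induction k)
  case 0
  have "code 0 ` A = {[]}" using A_ne by auto
  then show ?case by (simp add: wt_def)
next
  case (Suc k)
  define M where "M = Max (lab k ` A)"
  have M: "lab k x \<le> M" if "x \<in> A" for x unfolding M_def using that finA by (intro Max_ge) auto
  have fin: "finite (code k ` A)" using finA by simp
  have "(\<Sum>cs\<in>code (Suc k) ` A. wt cs) \<le> (\<Sum>cs\<in>(\<lambda>(i, cs). i # cs) ` ({..M} \<times> code k ` A). wt cs)"
    by (rule sum_mono2) (use fin M wt_nonneg in auto)
  also have "\<dots> = (\<Sum>(i, cs)\<in>{..M} \<times> code k ` A. wt (i # cs))"
    by (subst sum.reindex) (auto simp: inj_on_def case_prod_beta')
  also have "\<dots> = (\<Sum>i\<le>M. \<Sum>cs\<in>code k ` A. 1 / (real i + 2) ^ 4 * wt cs)"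
    by (subst sum.cartesian_product[symmetric]) (simp add: wt_def)
  also have "\<dots> = (\<Sum>i\<le>M. 1 / (real i + 2) ^ 4) * (\<Sum>cs\<in>code k ` A. wt cs)"
    by (simp only: sum_product)
  also have "\<dots> \<le> (1 / 4) * (1 / 4) ^ k"
    using sum_inverse_fourth Suc.IH by (intro mult_mono) (auto intro!: sum_nonneg wt_nonneg)
  finally show ?case by simp
qed

text \<open>Allowed deviation, in units of distance, of the link from level k to k + 1. The summand
  b for label i satisfies exp(-b^2/2) = (i+2)^(-4), a factor of \<open>wt\<close>; the sum of these
  b dominates their l2 norm, so exp(-thr^2/2) is within the budget of the branch.\<close>

definition thr :: "nat \<Rightarrow> 'p \<Rightarrow> real" where
  "thr k x = (\<Sum>j<Suc k. sqrt (8 * ln (real (lab j x) + 2)))"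

lemma exp_thr_le_wt: "exp (- (thr k x)\<^sup>2 / 2) \<le> wt (code (Suc k) x)"
proof -
  let ?b = "\<lambda>j. sqrt (8 * ln (real (lab j x) + 2))"
  have l0: "0 \<le> ln (real n + 2)" for n :: nat by simp
  have "L2_set ?b {..<Suc k} \<le> thr k x"
    unfolding thr_def by (rule L2_set_le_sum) (simp add: l0)
  then have "(L2_set ?b {..<Suc k})\<^sup>2 \<le> (thr k x)\<^sup>2" by (intro power_mono) auto
  then have "(\<Sum>j<Suc k. 8 * ln (real (lab j x) + 2)) \<le> (thr k x)\<^sup>2"
    unfolding L2_set_sum_sq by (simp add: l0)
  then have "exp (- (thr k x)\<^sup>2 / 2) \<le> exp (- (\<Sum>j<Suc k. 8 * ln (real (lab j x) + 2)) / 2)"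
    by simp
  also have "\<dots> = (\<Prod>j<Suc k. 1 / (real (lab j x) + 2) ^ 4)"
  proof -
    have "- (\<Sum>j<Suc k. 8 * ln (real (lab j x) + 2)) / 2 = (\<Sum>j<Suc k. - (4 * ln (real (lab j x) + 2)))"
      by (simp only: sum_negf[symmetric] sum_divide_distrib) (simp add: sum_negf)
    moreover have "exp (- (4 * ln (real n + 2))) = 1 / (real n + 2) ^ 4" for n :: nat
    proof -
      have "exp (4 * ln (real n + 2)) = exp (ln (real n + 2)) ^ 4"
        using exp_of_nat_mult[of 4 "ln (real n + 2)"] by simp
      then show ?thesis by (simp add: exp_minus divide_inverse)
    qed
    ultimately show ?thesis by (simp only: exp_sum finite_lessThan)
  qed
  also have "\<dots> = wt (code (Suc k) x)"
  proof -
    have "(\<Prod>j<k. 1 / (real (lab j x) + 2) ^ 4) = wt (code k x)" for k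
      by (induction k) (auto simp: wt_def mult.commute)
    from this[of "Suc k"] show ?thesis .
  qed
  finally show ?thesis .
qed

lemma thr_eq_if_code_eq:
  assumes "code (Suc k) x = code (Suc k) y"
  shows "thr k x = thr k y"
proof -
  have "code k x = code k y \<Longrightarrow> \<forall>j<k. lab j x = lab j y" for k
    by (induction k) (auto simp: less_Suc_eq)
  from this[OF assms] show ?thesis unfolding thr_def by (intro sum.cong) auto
qed

lemma code_prefix: "code (Suc k) x = code (Suc k) y \<Longrightarrow> code k x = code k y"
  by simp

lemma thr_nonneg: "0 \<le> thr k x"
  unfolding thr_def by (intro sum_nonneg) simp

text \<open>Exchanging the two summations costs only a factor 2, because the radii from level j on
  sum to at most \<open>2 * rad j\<close>. The square roots with \<open>+ 2\<close> inside are then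
  reduced to those of \<open>path_sum\<close> at the price of a factor 3 and an additive
  term.\<close>

lemma weighted_thr_sum:
  assumes x: "x \<in> A"
  shows "(\<Sum>k<K. rad k * thr k x) \<le> 6 * ((2 * g A + 2 * e * a\<^sub>0) / c + 2 * a\<^sub>0)"
proof -
  let ?b = "\<lambda>j. sqrt (8 * ln (real (lab j x) + 2))"
  have b0: "0 \<le> ?b j" for j by simp
  \<comment> \<open>The extra term on the left is a potential that pays for the old labels still
    contained in every later \<open>thr\<close>.\<close>
  have "(\<Sum>k<K. rad k * thr k x) + 2 * (rad K * (\<Sum>j<K. ?b j)) \<le> 2 * (\<Sum>j<K. rad j * ?b j)"
  proof (induction K)
    case 0
    show ?case by simp
  next
    case (Suc K)
    have "0 \<le> rad K * (\<Sum>j<K. ?b j)" using rad_pos[of K] by (intro mult_nonneg_nonneg sum_nonneg) auto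
    moreover have "0 \<le> rad K * ?b K" using rad_pos[of K] b0 by (intro mult_nonneg_nonneg) auto
    ultimately show ?case using Suc by (simp add: thr_def rad_Suc distrib_left)
  qed
  moreover have "0 \<le> rad K * (\<Sum>j<K. ?b j)" using rad_pos[of K] by (intro mult_nonneg_nonneg sum_nonneg) auto
  moreover have "(\<Sum>j<K. rad j * ?b j) \<le> (\<Sum>j<K. 3 * (rad j * sqrt (ln (real (lab j x) + 1))) + 3 * rad j)"
  proof (rule sum_mono)
    fix j
    have "?b j \<le> 3 * (sqrt (ln (real (lab j x) + 1)) + 1)"
    proof -
      let ?l = "real (lab j x)"
      have "ln (?l + 2) \<le> ln (2 * (?l + 1))" by simp
      also have "\<dots> = ln 2 + ln (?l + 1)" by (subst ln_mult) auto
      also have "\<dots> \<le> 1 + ln (?l + 1)" using ln_2_less_1 by simp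
      finally have "ln (?l + 2) \<le> 1 + ln (?l + 1)" .
      moreover have "0 \<le> ln (?l + 1)" by (rule ln_ge_zero) simp
      ultimately have "8 * ln (?l + 2) \<le> 9 * (1 + ln (?l + 1))" by (intro mult_mono) simp_all
      then have "?b j \<le> sqrt (9 * (1 + ln (?l + 1)))" by (rule real_sqrt_le_mono)
      also have "\<dots> = 3 * sqrt (1 + ln (?l + 1))" by (simp only: real_sqrt_mult) (simp add: real_sqrt_unique)
      also have "\<dots> \<le> 3 * (1 + sqrt (ln (?l + 1)))"
        using sqrt_add_le_add_sqrt[of 1 "ln (?l + 1)"] by simp
      finally show ?thesis by (simp add: add.commute)
    qed
    then have "rad j * ?b j \<le> rad j * (3 * (sqrt (ln (real (lab j x) + 1)) + 1))"
      using rad_pos[of j] by (intro mult_left_mono) auto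
    then show "rad j * ?b j \<le> 3 * (rad j * sqrt (ln (real (lab j x) + 1))) + 3 * rad j"
      by (simp add: algebra_simps)
  qed
  moreover have "(\<Sum>j<K. 3 * (rad j * sqrt (ln (real (lab j x) + 1))) + 3 * rad j) =
     3 * (\<Sum>j<K. rad j * sqrt (ln (real (lab j x) + 1))) + 3 * (\<Sum>j<K. rad j)"
    by (simp only: sum.distrib sum_distrib_left)
  moreover have "S \<le> 6 * (R + 2 * a)"
    if "S + 2 * T \<le> 2 * B" "0 \<le> T" "B \<le> Q" "Q = 3 * W + 3 * V" "W \<le> R" "V \<le> 2 * a" for S T B Q W V R a :: real
    using that unfolding distrib_left by linarith
  ultimately show ?thesis using path_sum[OF x, of K] rad_sum[of K] by blast
qed

text \<open>Chaining from the common root representative to each point: links at level k have length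
  at most \<open>20 * rad k\<close> and deviate by at most \<open>thr k\<close> times that. Bad
  events depend on codes only, and their total mass is at most the sum of 2 / 4^(k+1), below 2/3.
  The constant is 20 * 6 from \<open>weighted_thr_sum\<close>, doubled for two points.\<close>

theorem subgaussian_process_bound:
  fixes Y :: "'p \<Rightarrow> 'w \<Rightarrow> real"
  assumes M: "prob_space M" and Y: "\<And>x. x \<in> A \<Longrightarrow> Y x \<in> borel_measurable M"
    and tail: "\<And>x y u. x \<in> A \<Longrightarrow> y \<in> A \<Longrightarrow> 0 < d x y \<Longrightarrow> 0 \<le> u \<Longrightarrow>
      measure M {\<omega> \<in> space M. u * d x y \<le> \<bar>Y x \<omega> - Y y \<omega>\<bar>} \<le> 2 * exp (- u\<^sup>2 / 2)"
  shows "\<exists>N\<in>sets M. measure M N < 1 \<and> (\<forall>\<omega>\<in>space M - N. \<forall>x\<in>A. \<forall>y\<in>A.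
     \<bar>Y x \<omega> - Y y \<omega>\<bar> \<le> 240 * ((2 * g A + 2 * e * a\<^sub>0) / c + 2 * a\<^sub>0))"
proof -
  interpret prob_space M by fact
  have repA: "rep k x \<in> A" if "x \<in> A" for k x using rep_in_cell[OF that] cell_subset by blast
  have "\<exists>K. \<forall>x\<in>A. cell K x = {x}"
  proof -
    \<comment> \<open>Least distance between distinct points; the inserted 1 makes the minimum exist
      when \<open>A\<close> is a singleton. Cells of diameter below \<open>m\<close> are
      singletons.\<close>
    define m where "m = Min (insert 1 ((\<lambda>(x, y). d x y) ` {p \<in> A \<times> A. fst p \<noteq> snd p}))"
    have fin: "finite (insert 1 ((\<lambda>(x, y). d x y) ` {p \<in> A \<times> A. fst p \<noteq> snd p}))" using finA by simp
    have "0 < d x y" if "x \<in> A" "y \<in> A" "x \<noteq> y" for x y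
      using that d_eq_0 d_nonneg[of x y] by fastforce
    then have m: "0 < m" unfolding m_def by (subst Min_gr_iff[OF fin]) auto
    have md: "m \<le> d x y" if "x \<in> A" "y \<in> A" "x \<noteq> y" for x y
      unfolding m_def by (rule Min_le[OF fin]) (use that in force)
    obtain K where K: "20 * a\<^sub>0 / m < 10 ^ K" using real_arch_pow[of 10 "20 * a\<^sub>0 / m"] by auto
    have "20 * rad K < m" using K m unfolding rad_def by (simp add: field_simps)
    then have "cell K x = {x}" if "x \<in> A" for x
      using that cell_self[OF that, of K] cell_diam[of _ K x x] md cell_subset[of K x] by fastforce
    then show ?thesis by blast
  qed
  then obtain K where K: "\<And>x. x \<in> A \<Longrightarrow> cell K x = {x}" by blast
  \<comment> \<open>Without the positivity clause a link of length 0 would make the whole space bad;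
    such a link joins equal points and contributes nothing.\<close>
  define bad where "bad k x = {\<omega> \<in> space M. 0 < d (rep (Suc k) x) (rep k x) \<and>
     thr k x * d (rep (Suc k) x) (rep k x) \<le> \<bar>Y (rep (Suc k) x) \<omega> - Y (rep k x) \<omega>\<bar>}" for k x
  have bad_sets: "bad k x \<in> sets M" if "x \<in> A" for k x
  proof -
    have [measurable]: "Y (rep (Suc k) x) \<in> borel_measurable M" "Y (rep k x) \<in> borel_measurable M"
      using Y repA that by auto
    show ?thesis unfolding bad_def by measurable
  qed
  have bad_meas: "measure M (bad k x) \<le> 2 * wt (code (Suc k) x)" if x: "x \<in> A" for k x
  proof (cases "0 < d (rep (Suc k) x) (rep k x)")
    case True
    then have "bad k x = {\<omega> \<in> space M. thr k x * d (rep (Suc k) x) (rep k x) \<le> \<bar>Y (rep (Suc k) x) \<omega> - Y (rep k x) \<omega>\<bar>}"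
      by (simp add: bad_def)
    then have "measure M (bad k x) \<le> 2 * exp (- (thr k x)\<^sup>2 / 2)"
      using tail[OF repA[OF x] repA[OF x] True thr_nonneg] by simp
    then show ?thesis using exp_thr_le_wt[of k x] by linarith
  next
    case False
    then show ?thesis by (simp add: bad_def wt_nonneg)
  qed
  have bad_code: "bad k x = bad k y" if "code (Suc k) x = code (Suc k) y" for k x y
  proof -
    have "rep (Suc k) x = rep (Suc k) y" "rep k x = rep k y" "thr k x = thr k y"
      using code_eq_imp[OF that] code_eq_imp[OF code_prefix[OF that]] thr_eq_if_code_eq[OF that]
      unfolding rep_def by simp_all
    then show ?thesis by (simp add: bad_def)
  qed
  define N where "N = (\<Union>k<K. \<Union>x\<in>A. bad k x)"
  have N: "N \<in> sets M" unfolding N_def using bad_sets finA by auto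
  have level: "measure M (\<Union>x\<in>A. bad k x) \<le> 2 * (1 / 4) ^ Suc k" for k
  proof -
    \<comment> \<open>One point per code: the union then runs over codes, whose budgets are
      summable, and not over points.\<close>
    define r where "r cs = (SOME x. x \<in> A \<and> code (Suc k) x = cs)" for cs
    have r: "r cs \<in> A" "code (Suc k) (r cs) = cs" if "cs \<in> code (Suc k) ` A" for cs
    proof -
      from that have "\<exists>x. x \<in> A \<and> code (Suc k) x = cs" by blast
      from someI_ex[OF this] show "r cs \<in> A" "code (Suc k) (r cs) = cs" unfolding r_def by blast+
    qed
    have "(\<Union>x\<in>A. bad k x) \<subseteq> (\<Union>cs\<in>code (Suc k) ` A. bad k (r cs))"
    proof
      fix \<omega> assume "\<omega> \<in> (\<Union>x\<in>A. bad k x)"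
      then obtain x where x: "x \<in> A" "\<omega> \<in> bad k x" by blast
      have cx: "code (Suc k) x \<in> code (Suc k) ` A" using x by blast
      have "bad k x = bad k (r (code (Suc k) x))" by (rule bad_code) (rule r(2)[OF cx, symmetric])
      then show "\<omega> \<in> (\<Union>cs\<in>code (Suc k) ` A. bad k (r cs))" using x cx by blast
    qed
    then have "measure M (\<Union>x\<in>A. bad k x) \<le> measure M (\<Union>cs\<in>code (Suc k) ` A. bad k (r cs))"
      using bad_sets r finA by (intro finite_measure_mono sets.finite_UN) auto
    also have "\<dots> \<le> (\<Sum>cs\<in>code (Suc k) ` A. measure M (bad k (r cs)))"
      using bad_sets r finA by (intro finite_measure_subadditive_finite) auto
    also have "\<dots> \<le> (\<Sum>cs\<in>code (Suc k) ` A. 2 * wt cs)"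
      using bad_meas r by (intro sum_mono) metis
    also have "\<dots> \<le> 2 * (1 / 4) ^ Suc k"
      using sum_wt_codes[of "Suc k"] by (simp only: sum_distrib_left[symmetric])
    finally show ?thesis .
  qed
  have "measure M N \<le> (\<Sum>k<K. measure M (\<Union>x\<in>A. bad k x))"
    unfolding N_def using bad_sets finA by (intro finite_measure_subadditive_finite) auto
  also have "\<dots> \<le> (\<Sum>k<K. 2 * (1 / 4) ^ Suc k)" by (intro sum_mono level)
  also have "\<dots> \<le> 2 / 3 * (1 - (1 / 4) ^ K)" by (induction K) (auto simp: algebra_simps)
  also have "\<dots> < 1"
  proof -
    have "0 \<le> (1 / 4 :: real) ^ K" by simp
    then show ?thesis unfolding right_diff_distrib by linarith
  qed
  finally have N1: "measure M N < 1" .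
  let ?R = "120 * ((2 * g A + 2 * e * a\<^sub>0) / c + 2 * a\<^sub>0)"
  have dev: "\<bar>Y x \<omega> - Y (rep 0 x) \<omega>\<bar> \<le> ?R" if \<omega>: "\<omega> \<in> space M - N" and x: "x \<in> A" for \<omega> x
  proof -
    have step: "\<bar>Y (rep (Suc k) x) \<omega> - Y (rep k x) \<omega>\<bar> \<le> 20 * (rad k * thr k x)" if k: "k < K" for k
    proof (cases "0 < d (rep (Suc k) x) (rep k x)")
      case True
      have "rep (Suc k) x \<in> cell k x" using rep_in_cell[OF x, of "Suc k"] by simp
      then have "d (rep (Suc k) x) (rep k x) \<le> 20 * rad k" using rep_in_cell[OF x, of k] by (rule cell_diam)
      then have "thr k x * d (rep (Suc k) x) (rep k x) \<le> thr k x * (20 * rad k)"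
        using thr_nonneg by (intro mult_left_mono)
      moreover have "\<omega> \<notin> bad k x" using \<omega> x k by (auto simp: N_def)
      ultimately show ?thesis using True \<omega> by (simp add: bad_def mult_ac)
    next
      case False
      then have "d (rep (Suc k) x) (rep k x) = 0" using d_nonneg[of "rep (Suc k) x" "rep k x"] by linarith
      then have "rep (Suc k) x = rep k x" using d_eq_0 repA x by blast
      then show ?thesis using rad_pos[of k] thr_nonneg[of k x] by simp
    qed
    have "\<bar>Y (rep k x) \<omega> - Y (rep 0 x) \<omega>\<bar> \<le> 20 * (\<Sum>j<k. rad j * thr j x)" if "k \<le> K" for k
      using that
    proof (induction k)
      case (Suc k)
      then show ?case using step[of k] by simp
    qed simp
    from this[of K] have "\<bar>Y (rep K x) \<omega> - Y (rep 0 x) \<omega>\<bar> \<le> 20 * (\<Sum>j<K. rad j * thr j x)" by simp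
    moreover have "rep K x = x" using rep_in_cell[OF x, of K] K[OF x] by simp
    ultimately have "\<bar>Y x \<omega> - Y (rep 0 x) \<omega>\<bar> \<le> 20 * (\<Sum>j<K. rad j * thr j x)" by simp
    also have "\<dots> \<le> 20 * (6 * ((2 * g A + 2 * e * a\<^sub>0) / c + 2 * a\<^sub>0))"
      using weighted_thr_sum[OF x] by (rule mult_left_mono) simp
    finally show ?thesis by simp
  qed
  have "\<bar>Y x \<omega> - Y y \<omega>\<bar> \<le> 240 * ((2 * g A + 2 * e * a\<^sub>0) / c + 2 * a\<^sub>0)"
    if "\<omega> \<in> space M - N" "x \<in> A" "y \<in> A" for \<omega> x y
  proof -
    have "rep 0 x = rep 0 y" by (simp add: rep_def)
    then have "\<bar>Y x \<omega> - Y (rep 0 x) \<omega>\<bar> \<le> ?R" "\<bar>Y y \<omega> - Y (rep 0 x) \<omega>\<bar> \<le> ?R"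
      using dev[OF that(1,2)] dev[OF that(1,3)] by simp_all
    moreover have "\<bar>p - q\<bar> \<le> 2 * D" if "\<bar>p - r\<bar> \<le> D" "\<bar>q - r\<bar> \<le> D" for p q r D :: real
      using that by linarith
    ultimately have "\<bar>Y x \<omega> - Y y \<omega>\<bar> \<le> 2 * ?R" by blast
    then show ?thesis by simp
  qed
  then show ?thesis using N N1 by blast
qed

end

section \<open>Subgaussian vectors meet large bodies\<close>

lemma dotp_eq_lin: "dotp n x y = lin {..<n} y x"
  by (simp add: dotp_def lin_def mult.commute)

lemma norm2_eq_L2_set: "norm2 n x = L2_set x {..<n}"
  by (simp add: norm2_def dotp_def L2_set_def power2_eq_square)

section \<open>Nearest points and separation from a symmetric body\<close>

lemma closest_point_exists:
  fixes n :: nat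
  assumes K: "closedin (powertop_real {..<n}) K" and ne: "K \<noteq> {}"
  shows "\<exists>w\<in>K. \<forall>x\<in>K. (\<Sum>i<n. (w i - z i)\<^sup>2) \<le> (\<Sum>i<n. (x i - z i)\<^sup>2)"
proof -
  let ?X = "powertop_real {..<n}"
  let ?f = "\<lambda>x. \<Sum>i<n. (x i - z i)\<^sup>2"
  obtain x0 where x0: "x0 \<in> K" using ne by auto
  define r where "r = sqrt (?f x0)"
  have r2: "r\<^sup>2 = ?f x0" and r0: "0 \<le> r" unfolding r_def by (auto simp: sum_nonneg)
  have KX: "K \<subseteq> ({..<n} \<rightarrow>\<^sub>E UNIV)" using closedin_subset[OF K] by simp
  define B where "B = (\<Pi>\<^sub>E i\<in>{..<n}. {z i - r..z i + r})"
  have "compactin ?X B" unfolding B_def by (simp add: compactin_PiE compactin_euclidean_iff)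
  then have KB: "compactin ?X (K \<inter> B)" by (rule closed_Int_compactin[OF K])
  have f: "continuous_map ?X euclideanreal ?f" by (intro continuous_intros) auto
  have far: "x \<in> B" if x: "x \<in> K" "?f x \<le> r\<^sup>2" for x
  proof -
    have "\<bar>x i - z i\<bar> \<le> r" if i: "i < n" for i
    proof -
      have "(x i - z i)\<^sup>2 \<le> ?f x" using i by (intro member_le_sum[of i "{..<n}" "\<lambda>i. (x i - z i)\<^sup>2"]) auto
      then have "\<bar>x i - z i\<bar>\<^sup>2 \<le> r\<^sup>2" using x by simp
      then show ?thesis by (rule power2_le_imp_le[OF _ r0])
    qed
    then have "z i - r \<le> x i \<and> x i \<le> z i + r" if "i < n" for i using that by (fastforce simp: abs_le_iff)
    then show ?thesis using x KX unfolding B_def by (auto simp: PiE_iff)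
  qed
  have "compact (?f ` (K \<inter> B))"
    using image_compactin[OF KB f] by (simp add: compactin_euclidean_iff)
  moreover have x0B: "x0 \<in> K \<inter> B" using x0 far[of x0] r2 by simp
  ultimately obtain v where v: "v \<in> ?f ` (K \<inter> B)" "\<And>u. u \<in> ?f ` (K \<inter> B) \<Longrightarrow> v \<le> u"
    using compact_attains_inf[of "?f ` (K \<inter> B)"] by blast
  then obtain w where w: "w \<in> K \<inter> B" "v = ?f w" by auto
  show ?thesis
  proof (intro bexI[of _ w] ballI)
    show "w \<in> K" using w by simp
    fix x assume x: "x \<in> K"
    show "?f w \<le> ?f x"
    proof (cases "x \<in> B")
      case True
      then show ?thesis using v(2)[of "?f x"] w x by simp
    next
      case False
      have "?f w \<le> ?f x0" using v(2)[of "?f x0"] w x0B by simp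
      also have "\<dots> \<le> ?f x" using far[OF x] False r2 by linarith
      finally show ?thesis .
    qed
  qed
qed

lemma closest_point_variational:
  assumes K: "convex_set n K" and w: "w \<in> K" and min: "\<And>x. x \<in> K \<Longrightarrow> (\<Sum>i<n. (w i - z i)\<^sup>2) \<le> (\<Sum>i<n. (x i - z i)\<^sup>2)"
    and x: "x \<in> K"
  shows "(\<Sum>i<n. (z i - w i) * x i) \<le> (\<Sum>i<n. (z i - w i) * w i)"
proof -
  define P where "P = (\<Sum>i<n. (w i - z i) * (x i - w i))"
  define Q where "Q = (\<Sum>i<n. (x i - w i)\<^sup>2)"
  have Q: "0 \<le> Q" unfolding Q_def by (simp add: sum_nonneg)
  have ineq: "0 \<le> 2 * P + u * Q" if u: "0 < u" "u \<le> 1" for u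
  proof -
    have "(\<lambda>i\<in>{..<n}. (1 - u) * w i + u * x i) \<in> K"
      using K w x u unfolding convex_set_def by (auto simp: restrict_def)
    from min[OF this] have "(\<Sum>i<n. (w i - z i)\<^sup>2) \<le> (\<Sum>i<n. ((1 - u) * w i + u * x i - z i)\<^sup>2)" by simp
    also have "\<dots> = (\<Sum>i<n. (w i - z i)\<^sup>2 + u * (2 * ((w i - z i) * (x i - w i))) + u * (u * (x i - w i)\<^sup>2))"
      by (intro sum.cong refl) (simp add: power2_eq_square algebra_simps)
    also have "\<dots> = (\<Sum>i<n. (w i - z i)\<^sup>2) + u * (2 * P) + u * (u * Q)"
      by (simp only: sum.distrib sum_distrib_left[symmetric] P_def Q_def)
    finally have "0 \<le> u * (2 * P + u * Q)" by (simp add: distrib_left)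
    then show ?thesis using u by (simp add: zero_le_mult_iff)
  qed
  have "0 \<le> P"
  proof (rule ccontr)
    assume "\<not> 0 \<le> P"
    then have P: "P < 0" by simp
    \<comment> \<open>Small enough that u Q <= -P, so 2 P + u Q <= P < 0 contradicts minimality; Q +
      1 avoids division by zero.\<close>
    define u where "u = min 1 (- P / (Q + 1))"
    have u: "0 < u" "u \<le> 1" unfolding u_def using P Q by (auto intro!: divide_neg_pos)
    have "u * Q \<le> - P / (Q + 1) * Q" unfolding u_def using Q by (intro mult_right_mono) auto
    also have "\<dots> \<le> - P"
      using P Q by (simp add: divide_simps mult_le_0_iff)
    finally show False using ineq[OF u] P by linarith
  qed
  moreover have "P = (\<Sum>i<n. (z i - w i) * w i) - (\<Sum>i<n. (z i - w i) * x i)"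
    unfolding P_def sum_subtractf[symmetric] by (intro sum.cong refl) (simp add: algebra_simps)
  ultimately show ?thesis by simp
qed

text \<open>The functional is a multiple of the normal z - w at the point w of \<open>K\<close>
  nearest to z. Symmetry of \<open>K\<close> turns the one-sided bound into one on the absolute
  value.\<close>

lemma symmetric_body_separation:
  assumes K: "symmetric_body n K" and z: "z \<in> euclid n" "z \<notin> K"
  shows "\<exists>\<theta>\<in>euclid n. (\<forall>x\<in>K. \<bar>dotp n x \<theta>\<bar> \<le> 1) \<and> 1 < dotp n z \<theta>"
proof -
  have cl: "closedin (powertop_real {..<n}) K" and cv: "convex_set n K" and sy: "K = dilate n (-1) K"
    and int: "powertop_real {..<n} interior_of K \<noteq> {}"
    using K by (auto simp: symmetric_body_def convex_body_def)
  have ne: "K \<noteq> {}" using int interior_of_subset[of _ K] by auto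
  have KX: "K \<subseteq> euclid n" using closedin_subset[OF cl] by (simp add: euclid_def)
  obtain w where w: "w \<in> K" "\<And>x. x \<in> K \<Longrightarrow> (\<Sum>i<n. (w i - z i)\<^sup>2) \<le> (\<Sum>i<n. (x i - z i)\<^sup>2)"
    using closest_point_exists[OF cl ne, of z] by blast
  let ?p = "\<lambda>x. \<Sum>i<n. (z i - w i) * x i"
  have le: "?p x \<le> ?p w" if "x \<in> K" for x
    by (rule closest_point_variational[OF cv w that])
  have abs: "\<bar>?p x\<bar> \<le> ?p w" if x: "x \<in> K" for x
  proof -
    have "(\<lambda>i\<in>{..<n}. -1 * x i) \<in> dilate n (-1) K" unfolding dilate_def using x by blast
    then have "(\<lambda>i\<in>{..<n}. -1 * x i) \<in> K" using sy by simp
    from le[OF this] have "- ?p x \<le> ?p w" by (simp add: sum_negf)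
    then show ?thesis using le[OF x] by linarith
  qed
  have h0: "0 \<le> ?p w" using abs[OF w(1)] by linarith
  have "0 < (\<Sum>i<n. (z i - w i)\<^sup>2)"
  proof (rule ccontr)
    assume "\<not> 0 < (\<Sum>i<n. (z i - w i)\<^sup>2)"
    then have "(\<Sum>i<n. (z i - w i)\<^sup>2) = 0" using sum_nonneg[of "{..<n}" "\<lambda>i. (z i - w i)\<^sup>2"] by force
    then have "\<forall>i<n. z i = w i" by (simp add: sum_nonneg_eq_0_iff)
    moreover have "z \<in> {..<n} \<rightarrow>\<^sub>E UNIV" "w \<in> {..<n} \<rightarrow>\<^sub>E UNIV"
      using z(1) w(1) KX unfolding euclid_def by auto
    ultimately have "z = w" by (intro PiE_ext[of z "{..<n}" "\<lambda>_. UNIV" w]) auto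
    then show False using w(1) z(2) by simp
  qed
  moreover have "?p z = ?p w + (\<Sum>i<n. (z i - w i)\<^sup>2)"
    unfolding sum.distrib[symmetric] by (intro sum.cong refl) (simp add: power2_eq_square algebra_simps)
  ultimately have gt: "?p w < ?p z" by linarith
  \<comment> \<open>A level strictly between the values at w and at z. It is positive even if the
    functional vanishes on \<open>K\<close>, so it can be divided by.\<close>
  define l where "l = (?p w + ?p z) / 2"
  have l: "0 < l" "?p w \<le> l" "l < ?p z" unfolding l_def using h0 gt by simp_all
  have d: "dotp n x (\<lambda>i\<in>{..<n}. (z i - w i) / l) = ?p x / l" for x
    by (simp add: dotp_def sum_divide_distrib mult.commute)
  show ?thesis
  proof (intro bexI[of _ "\<lambda>i\<in>{..<n}. (z i - w i) / l"] conjI ballI)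
    show "(\<lambda>i\<in>{..<n}. (z i - w i) / l) \<in> euclid n" by (simp add: euclid_def)
    show "1 < dotp n z (\<lambda>i\<in>{..<n}. (z i - w i) / l)" unfolding d using l by simp
    show "\<bar>dotp n x (\<lambda>i\<in>{..<n}. (z i - w i) / l)\<bar> \<le> 1" if "x \<in> K" for x
    proof -
      have "\<bar>?p x\<bar> \<le> l" using abs[OF that] l by linarith
      then show ?thesis unfolding d using l by (simp add: abs_divide)
    qed
  qed
qed

text \<open>The bound of \<open>subgaussian_process_bound\<close> with \<open>g A\<close> at most
  264 and the parameters of \<open>majorizing_tree_Gam\<close>.\<close>

definition c_body :: real where
  "c_body = 240 * ((2 * 264 + 2 * (1 / 4) * (1 / 5)) / (\<delta>\<^sub>0 / 4) + 2 * (1 / 5))"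

lemma c_body_pos: "0 < c_body"
  unfolding c_body_def using \<delta>\<^sub>0_pos by (intro mult_pos_pos add_pos_pos divide_pos_pos) auto

text \<open>Vectors of norm at most 2 are at distance at most 4 = 20 * (1/5). The other two
  constants come from \<open>super_sudakov\<close>, whose factor a/4 is absorbed into them.\<close>

lemma majorizing_tree_Gam:
  assumes A: "finite A" "A \<noteq> {}" "A \<subseteq> euclid n" and small: "\<And>t. t \<in> A \<Longrightarrow> L2_set t {..<n} \<le> 2"
  shows "majorizing_tree (dist2 {..<n}) (gsup {..<n}) A (\<delta>\<^sub>0 / 4) (1 / 4) (1 / 5)"
proof unfold_locales
  let ?J = "{..<n}"
  show "finite A" "A \<noteq> {}" by fact+
  show "0 < \<delta>\<^sub>0 / 4" using \<delta>\<^sub>0_pos by simp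
  show "dist2 ?J x x = 0" for x by (simp add: L2_set_def)
  show "dist2 ?J x y = dist2 ?J y x" for x y by (rule dist2_commute)
  show "dist2 ?J x z \<le> dist2 ?J x y + dist2 ?J y z" for x y z by (rule dist2_triangle)
  show "0 \<le> dist2 ?J x y" for x y by (rule L2_set_nonneg)
  show "x = y" if "x \<in> A" "y \<in> A" "dist2 ?J x y = 0" for x y
  proof -
    have "\<forall>i<n. x i = y i" using that(3) by (simp add: L2_set_eq_0_iff)
    then show ?thesis using that A(3) unfolding euclid_def by (intro PiE_ext[of x ?J "\<lambda>_. UNIV" y]) auto
  qed
  show "gsup ?J B \<le> gsup ?J B'" if "B \<subseteq> B'" "B' \<subseteq> A" "B \<noteq> {}" for B B'
    using that A(1) finite_subset[of B' A] by (intro gsup_mono) auto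
  show "0 \<le> gsup ?J B" if "B \<subseteq> A" "B \<noteq> {}" for B
    using that A(1) finite_subset[of B A] by (intro gsup_nonneg) auto
  show "dist2 ?J x y \<le> 20 * (1 / 5)" if "x \<in> A" "y \<in> A" for x y
  proof -
    have "dist2 ?J x y \<le> L2_set x ?J + L2_set (\<lambda>i. - y i) ?J"
      using L2_set_triangle_ineq[of x "\<lambda>i. - y i" ?J] by simp
    also have "L2_set (\<lambda>i. - y i) ?J = L2_set y ?J" by (simp add: L2_set_def)
    finally show ?thesis using small[OF that(1)] small[OF that(2)] by simp
  qed
  fix S :: "nat set" and t H a b
  assume S: "finite S" "S \<noteq> {}" "0 < a" and t: "\<And>i. i \<in> S \<Longrightarrow> t i \<in> A" and H: "\<And>i. i \<in> S \<Longrightarrow> H i \<subseteq> A" "\<And>i. i \<in> S \<Longrightarrow> H i \<noteq> {}"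
    and sep: "\<And>i j. i \<in> S \<Longrightarrow> j \<in> S \<Longrightarrow> i \<noteq> j \<Longrightarrow> a \<le> dist2 ?J (t i) (t j)"
    and near: "\<And>i s. i \<in> S \<Longrightarrow> s \<in> H i \<Longrightarrow> dist2 ?J s (t i) \<le> a / 4"
    and b: "\<And>i. i \<in> S \<Longrightarrow> b \<le> gsup ?J (H i)"
  have "a / 4 * (\<delta>\<^sub>0 * sqrt (ln (card S)) - 1) + b \<le> gsup ?J (\<Union>i\<in>S. H i)"
  proof (rule super_sudakov[OF _ S sep _ H(2) near b])
    show "finite (H i)" if "i \<in> S" for i using H(1)[OF that] A(1) by (rule finite_subset)
  qed auto
  then show "a * (\<delta>\<^sub>0 / 4 * sqrt (ln (card S)) - 1 / 4) + b \<le> gsup ?J (\<Union>i\<in>S. H i)"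
    by (simp add: algebra_simps)
qed auto

theorem subgaussian_meets_body:
  fixes M :: "'w measure"
  assumes T: "T \<subseteq> euclid n" "finite T" and s: "0 < s" and Y: "subgaussian n s M Y" and YT: "AE \<omega> in M. Y \<omega> \<in> T"
    and K: "symmetric_body n K" and mK: "1 / 2 \<le> measure (gauss n) K"
  shows "T \<inter> dilate n (c_body * s) K \<noteq> {}"
proof
  assume disj: "T \<inter> dilate n (c_body * s) K = {}"
  let ?J = "{..<n}" and ?C = "c_body * s"
  interpret M: prob_space M using Y by (simp add: subgaussian_def random_vector_def)
  interpret G: prob_space "Gam ?J" by (rule prob_space_Gam)
  have Ym: "Y \<in> M \<rightarrow>\<^sub>M PiM ?J (\<lambda>_. borel)" using Y by (simp add: subgaussian_def random_vector_def)
  have C: "0 < ?C" using c_body_pos s by simp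
  have "\<exists>\<theta>\<in>euclid n. (\<forall>x\<in>K. \<bar>dotp n x \<theta>\<bar> \<le> 1) \<and> ?C < dotp n y \<theta>" if y: "y \<in> T" for y
  proof -
    let ?z = "\<lambda>i\<in>?J. y i / ?C"
    have "?z \<notin> K"
    proof
      assume "?z \<in> K"
      then have "(\<lambda>i\<in>?J. ?C * ?z i) \<in> dilate n ?C K" unfolding dilate_def by blast
      moreover have "(\<lambda>i\<in>?J. ?C * ?z i) = y"
        using y T C by (auto simp: euclid_def fun_eq_iff PiE_iff extensional_def restrict_def)
      ultimately show False using y disj by auto
    qed
    then obtain \<theta> where \<theta>: "\<theta> \<in> euclid n" "\<forall>x\<in>K. \<bar>dotp n x \<theta>\<bar> \<le> 1" "1 < dotp n ?z \<theta>"
      using symmetric_body_separation[OF K, of ?z] by (auto simp: euclid_def)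
    have "dotp n ?z \<theta> = dotp n y \<theta> / ?C" by (simp add: dotp_def sum_divide_distrib)
    then have "?C < dotp n y \<theta>" using \<theta>(3) C by (simp add: less_divide_eq)
    then show ?thesis using \<theta> by blast
  qed
  then obtain \<theta> where \<theta>: "\<And>y. y \<in> T \<Longrightarrow> \<theta> y \<in> euclid n" "\<And>y x. y \<in> T \<Longrightarrow> x \<in> K \<Longrightarrow> \<bar>dotp n x (\<theta> y)\<bar> \<le> 1"
    "\<And>y. y \<in> T \<Longrightarrow> ?C < dotp n y (\<theta> y)" by metis
  \<comment> \<open>The chaining theorem bounds differences only. Adding the zero functional turns
    this into a bound on values without enlarging the seminorm beyond 1 on \<open>K\<close>.\<close>
  define zero :: "nat \<Rightarrow> real" where "zero = (\<lambda>i\<in>?J. 0)"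
  define A where "A = insert zero (\<theta> ` T)"
  have A: "finite A" "A \<noteq> {}" "A \<subseteq> euclid n" using T \<theta>(1) by (auto simp: A_def zero_def euclid_def)
  have lin_zero: "lin ?J zero x = 0" for x by (simp add: lin_def zero_def)
  have KX: "K \<subseteq> space (Gam ?J)"
    using K closedin_subset[of "powertop_real ?J" K] by (simp add: symmetric_body_def convex_body_def space_Gam)
  have sup1: "supabs ?J A x \<le> 1" if "x \<in> K" for x
    by (rule supabs_leI[OF finite_lessThan A(1,2)]) (use that \<theta>(2) in \<open>auto simp: A_def lin_zero dotp_eq_lin\<close>)
  have half: "1 / 2 \<le> measure (Gam ?J) {x \<in> space (Gam ?J). supabs ?J A x \<le> 1}"
  proof -
    have "measure (Gam ?J) K \<le> measure (Gam ?J) {x \<in> space (Gam ?J). supabs ?J A x \<le> 1}"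
    proof (rule G.finite_measure_mono)
      show "{x \<in> space (Gam ?J). supabs ?J A x \<le> 1} \<in> sets (Gam ?J)"
        using measurable_supabs[OF finite_lessThan A(1,2)] by measurable
    qed (use KX sup1 in auto)
    then show ?thesis using mK by (simp add: gauss_eq_Gam)
  qed
  have small: "L2_set t ?J \<le> 2" if t: "t \<in> A" for t
  proof (rule norm_le_if_lin_small)
    have "measure (Gam ?J) {x \<in> space (Gam ?J). supabs ?J A x \<le> 1} \<le> measure (Gam ?J) {x \<in> space (Gam ?J). \<bar>lin ?J t x\<bar> \<le> 1}"
    proof (rule G.finite_measure_mono)
      show "{x \<in> space (Gam ?J). \<bar>lin ?J t x\<bar> \<le> 1} \<in> sets (Gam ?J)" by measurable
      show "{x \<in> space (Gam ?J). supabs ?J A x \<le> 1} \<subseteq> {x \<in> space (Gam ?J). \<bar>lin ?J t x\<bar> \<le> 1}"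
        using abs_lin_le_supabs[OF finite_lessThan A(1,2) t] by (auto intro: order_trans)
    qed
    then show "1 / 2 \<le> measure (Gam ?J) {x \<in> space (Gam ?J). \<bar>lin ?J t x\<bar> \<le> 1}" using half by linarith
  qed simp
  interpret maj: majorizing_tree "dist2 ?J" "gsup ?J" A "\<delta>\<^sub>0 / 4" "1 / 4" "1 / 5"
    by (rule majorizing_tree_Gam[OF A small])
  define Z where "Z t \<omega> = lin ?J t (Y \<omega>) / s" for t \<omega>
  have Zm: "Z t \<in> borel_measurable M" for t
    unfolding Z_def using measurable_compose[OF Ym lin_measurable[of ?J t]] by simp
  have tail: "measure M {\<omega> \<in> space M. u * dist2 ?J x y \<le> \<bar>Z x \<omega> - Z y \<omega>\<bar>} \<le> 2 * exp (- u\<^sup>2 / 2)"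
    if d: "0 < dist2 ?J x y" and u: "0 \<le> u" for x y u
  proof -
    let ?d = "dist2 ?J x y"
    define \<eta> where "\<eta> = (\<lambda>i\<in>?J. (x i - y i) / ?d)"
    have \<eta>: "\<eta> \<in> euclid n" by (simp add: \<eta>_def euclid_def)
    have "L2_set \<eta> ?J = L2_set (\<lambda>i. (x i - y i) * (1 / ?d)) ?J"
      by (intro L2_set_cong) (auto simp: \<eta>_def)
    also have "\<dots> = ?d * (1 / ?d)"
      using d by (intro L2_set_left_distrib[symmetric]) simp
    finally have n1: "norm2 n \<eta> = 1" using d by (simp add: norm2_eq_L2_set)
    have "Z x \<omega> - Z y \<omega> = ?d / s * dotp n (Y \<omega>) \<eta>" for \<omega>
    proof -
      have "?d * dotp n (Y \<omega>) \<eta> = (\<Sum>i<n. (x i - y i) * Y \<omega> i)"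
        unfolding dotp_def sum_distrib_left using d by (intro sum.cong) (auto simp: \<eta>_def)
      also have "\<dots> = lin ?J x (Y \<omega>) - lin ?J y (Y \<omega>)"
        by (simp add: lin_def sum_subtractf left_diff_distrib)
      finally show ?thesis by (simp add: Z_def diff_divide_distrib)
    qed
    then have Zd: "\<bar>Z x \<omega> - Z y \<omega>\<bar> = ?d * (\<bar>dotp n (Y \<omega>) \<eta>\<bar> / s)" for \<omega>
      using d s by (simp add: abs_mult)
    have eq: "(u * ?d \<le> \<bar>Z x \<omega> - Z y \<omega>\<bar>) = (u * s \<le> \<bar>dotp n (Y \<omega>) \<eta>\<bar>)" for \<omega>
    proof -
      have "(u * ?d \<le> \<bar>Z x \<omega> - Z y \<omega>\<bar>) = (u \<le> \<bar>dotp n (Y \<omega>) \<eta>\<bar> / s)"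
        unfolding Zd mult.commute[of u] using d by (rule mult_le_cancel_left_pos)
      also have "\<dots> = (u * s \<le> \<bar>dotp n (Y \<omega>) \<eta>\<bar>)" using s by (rule pos_le_divide_eq)
      finally show ?thesis .
    qed
    have "measure M {\<omega> \<in> space M. \<bar>dotp n (Y \<omega>) \<eta>\<bar> \<ge> u * s} \<le> 2 * exp (- (u * s / s)\<^sup>2 / 2)"
    proof -
      have "\<forall>t\<ge>0. measure M {\<omega> \<in> space M. \<bar>dotp n (Y \<omega>) \<eta>\<bar> \<ge> t} \<le> 2 * exp (- (t / s)\<^sup>2 / 2)"
        using Y \<eta> n1 unfolding subgaussian_def by blast
      moreover have "0 \<le> u * s" using u s by simp
      ultimately show ?thesis by blast
    qed
    then show ?thesis unfolding eq using s by simp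
  qed
  obtain N where N: "N \<in> sets M" "measure M N < 1"
    "\<And>\<omega> x y. \<omega> \<in> space M - N \<Longrightarrow> x \<in> A \<Longrightarrow> y \<in> A \<Longrightarrow>
       \<bar>Z x \<omega> - Z y \<omega>\<bar> \<le> 240 * ((2 * gsup ?J A + 2 * (1 / 4) * (1 / 5)) / (\<delta>\<^sub>0 / 4) + 2 * (1 / 5))"
    using maj.subgaussian_process_bound[OF M.prob_space_axioms Zm tail] by blast
  \<comment> \<open>The exceptional set has mass below 1 and \<open>Y\<close> lies in
    \<open>T\<close> almost surely, so some outcome is good for both.\<close>
  have "\<exists>\<omega>\<in>space M - N. Y \<omega> \<in> T"
  proof (rule ccontr)
    assume no: "\<not> (\<exists>\<omega>\<in>space M - N. Y \<omega> \<in> T)"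
    from YT AE_space have "AE \<omega> in M. \<omega> \<in> N"
      by eventually_elim (use no in blast)
    then have "measure M N = 1" using M.prob_eq_1[OF N(1)] by simp
    then show False using N(2) by simp
  qed
  then obtain \<omega> where \<omega>: "\<omega> \<in> space M - N" "Y \<omega> \<in> T" by blast
  have "c_body < Z (\<theta> (Y \<omega>)) \<omega> - Z zero \<omega>"
    using \<theta>(3)[OF \<omega>(2)] s by (simp add: Z_def lin_zero dotp_eq_lin less_divide_eq)
  also have "\<dots> \<le> 240 * ((2 * gsup ?J A + 2 * (1 / 4) * (1 / 5)) / (\<delta>\<^sub>0 / 4) + 2 * (1 / 5))"
    using N(3)[OF \<omega>(1), of "\<theta> (Y \<omega>)" zero] \<omega>(2) by (auto simp: A_def intro: order_trans[OF abs_ge_self])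
  also have "\<dots> \<le> c_body"
    unfolding c_body_def using gsup_le_if_half[OF finite_lessThan A(1,2) half] \<delta>\<^sub>0_pos
    by (intro mult_left_mono add_right_mono divide_right_mono) auto
  finally show False by simp
qed

section \<open>Construction of a subgaussian vector\<close>

lemma exp_minus_le_quadratic:
  assumes "0 \<le> (x::real)"
  shows "exp (- x) \<le> 1 - x + x\<^sup>2"
proof -
  have "0 < 1 + x" using assms by simp
  have "exp (- x) = 1 / exp x" by (simp add: exp_minus divide_inverse)
  also have "\<dots> \<le> 1 / (1 + x)"
    using exp_ge_add_one_self[of x] \<open>0 < 1 + x\<close> by (intro divide_left_mono) auto
  also have "\<dots> \<le> 1 - x + x\<^sup>2"
  proof -
    have "(1 - x + x\<^sup>2) * (1 + x) = 1 + x ^ 3" by (simp add: power2_eq_square power3_eq_cube algebra_simps)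
    then have "1 \<le> (1 - x + x\<^sup>2) * (1 + x)" using assms by simp
    then show ?thesis using \<open>0 < 1 + x\<close> by (simp add: pos_divide_le_eq)
  qed
  finally show ?thesis .
qed

text \<open>Multiplicative weights: the best responses to exponential weights approximate the minimax value.\<close>

lemma approximate_minimax:
  fixes F :: "'q \<Rightarrow> 't \<Rightarrow> real"
  assumes T: "finite T" "T \<noteq> {}" and F: "\<And>\<theta> t. \<theta> \<in> \<Theta> \<Longrightarrow> t \<in> T \<Longrightarrow> 0 \<le> F \<theta> t" "\<And>\<theta> t. \<theta> \<in> \<Theta> \<Longrightarrow> t \<in> T \<Longrightarrow> F \<theta> t \<le> B"
    and B: "0 < B" and \<epsilon>: "0 < \<epsilon>"
    and avg: "\<And>N \<theta>s. 0 < N \<Longrightarrow> (\<And>i. \<theta>s i \<in> \<Theta>) \<Longrightarrow> \<exists>t\<in>T. (\<Sum>i<N. F (\<theta>s i) t) \<le> real N * c"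
  shows "\<exists>p. (\<forall>t\<in>T. 0 \<le> p t) \<and> sum p T = 1 \<and> (\<forall>\<theta>\<in>\<Theta>. (\<Sum>t\<in>T. p t * F \<theta> t) \<le> c + \<epsilon>)"
proof (rule ccontr)
  assume "\<not> ?thesis"
  then have "\<exists>\<theta>\<in>\<Theta>. c + \<epsilon> < (\<Sum>t\<in>T. p t * F \<theta> t)" if "\<forall>t\<in>T. 0 \<le> p t" "sum p T = 1" for p
    using that by (meson not_le)
  then obtain br where br: "\<And>p. \<forall>t\<in>T. 0 \<le> p t \<Longrightarrow> sum p T = 1 \<Longrightarrow> br p \<in> \<Theta>"
    "\<And>p. \<forall>t\<in>T. 0 \<le> p t \<Longrightarrow> sum p T = 1 \<Longrightarrow> c + \<epsilon> < (\<Sum>t\<in>T. p t * F (br p) t)" by metis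
  \<comment> \<open>This makes the second-order loss \<open>(\<eta> * B)\<^sup>2\<close> equal to
    half of the gain \<eta> \<epsilon> per round.\<close>
  define \<eta> where "\<eta> = \<epsilon> / (2 * B\<^sup>2)"
  have \<eta>: "0 < \<eta>" using \<epsilon> B by (simp add: \<eta>_def)
  define W where "W S = (\<Sum>t\<in>T. exp (- \<eta> * S t))" for S
  have W: "0 < W S" for S unfolding W_def using T by (intro sum_pos) auto
  define P where "P S t = exp (- \<eta> * S t) / W S" for S t
  have P: "\<forall>t\<in>T. 0 \<le> P S t" "sum (P S) T = 1" for S
  proof -
    show "\<forall>t\<in>T. 0 \<le> P S t" using W[of S] by (simp add: P_def)
    have "sum (P S) T = W S / W S" unfolding P_def sum_divide_distrib[symmetric] by (simp only: W_def)
    then show "sum (P S) T = 1" using W[of S] by simp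
  qed
  \<comment> \<open>Accumulated losses of the points of \<open>T\<close>. In each round
    \<open>br\<close> returns a \<theta> that violates the desired bound for the current exponential
    weights \<open>P (S n)\<close>.\<close>
  define S where "S = rec_nat (\<lambda>_. 0) (\<lambda>_ S t. S t + F (br (P S)) t)"
  have S0: "S 0 = (\<lambda>_. 0)" and SS: "S (Suc n) = (\<lambda>t. S n t + F (br (P (S n))) t)" for n
    by (simp_all add: S_def)
  have Ssum: "S n t = (\<Sum>i<n. F (br (P (S i))) t)" for n t
    by (induction n) (simp_all add: S0 SS)
  have step: "W (S (Suc n)) \<le> W (S n) * exp (- \<eta> * (c + \<epsilon> / 2))" for n
  proof -
    let ?\<theta> = "br (P (S n))" and ?p = "P (S n)"
    have \<theta>: "?\<theta> \<in> \<Theta>" by (rule br(1)[OF P])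
    have "W (S (Suc n)) = (\<Sum>t\<in>T. W (S n) * (?p t * exp (- (\<eta> * F ?\<theta> t))))"
      unfolding W_def[of "S (Suc n)"] using W[of "S n"]
      by (intro sum.cong refl) (simp add: SS P_def distrib_left exp_add[symmetric])
    also have "\<dots> = W (S n) * (\<Sum>t\<in>T. ?p t * exp (- (\<eta> * F ?\<theta> t)))" by (simp only: sum_distrib_left)
    also have "\<dots> \<le> W (S n) * exp (- \<eta> * (c + \<epsilon> / 2))"
    proof (rule mult_left_mono)
      have "(\<Sum>t\<in>T. ?p t * exp (- (\<eta> * F ?\<theta> t))) \<le> (\<Sum>t\<in>T. ?p t * (1 - \<eta> * F ?\<theta> t + (\<eta> * B)\<^sup>2))"
      proof (intro sum_mono mult_left_mono)
        fix t assume t: "t \<in> T"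
        have "exp (- (\<eta> * F ?\<theta> t)) \<le> 1 - \<eta> * F ?\<theta> t + (\<eta> * F ?\<theta> t)\<^sup>2"
          using \<eta> F(1)[OF \<theta> t] by (intro exp_minus_le_quadratic) simp
        also have "(\<eta> * F ?\<theta> t)\<^sup>2 \<le> (\<eta> * B)\<^sup>2"
          using \<eta> F[OF \<theta> t] by (intro power_mono mult_left_mono) auto
        finally show "exp (- (\<eta> * F ?\<theta> t)) \<le> 1 - \<eta> * F ?\<theta> t + (\<eta> * B)\<^sup>2" by simp
        show "0 \<le> ?p t" using P(1) t by blast
      qed
      also have "\<dots> = (\<Sum>t\<in>T. ?p t) - \<eta> * (\<Sum>t\<in>T. ?p t * F ?\<theta> t) + (\<eta> * B)\<^sup>2 * (\<Sum>t\<in>T. ?p t)"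
        by (simp add: sum.distrib sum_subtractf sum_distrib_left sum_distrib_right algebra_simps)
      also have "\<dots> = 1 - \<eta> * (\<Sum>t\<in>T. ?p t * F ?\<theta> t) + (\<eta> * B)\<^sup>2" by (simp add: P(2))
      also have "\<dots> \<le> 1 - \<eta> * (c + \<epsilon>) + \<eta> * (\<epsilon> / 2)"
      proof -
        have "\<eta> * (c + \<epsilon>) \<le> \<eta> * (\<Sum>t\<in>T. ?p t * F ?\<theta> t)"
          using br(2)[OF P, of "S n"] \<eta> by (intro mult_left_mono) auto
        moreover have "(\<eta> * B)\<^sup>2 = \<eta> * (\<epsilon> / 2)"
          using B by (simp add: \<eta>_def power2_eq_square field_simps)
        ultimately show ?thesis by linarith
      qed
      also have "\<dots> = 1 + (- \<eta> * (c + \<epsilon> / 2))" by (simp add: algebra_simps)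
      also have "\<dots> \<le> exp (- \<eta> * (c + \<epsilon> / 2))" by (rule exp_ge_add_one_self)
      finally show "(\<Sum>t\<in>T. ?p t * exp (- (\<eta> * F ?\<theta> t))) \<le> exp (- \<eta> * (c + \<epsilon> / 2))" .
    qed (use W[of "S n"] in simp)
    finally show ?thesis .
  qed
  have Wn: "W (S n) \<le> card T * exp (- \<eta> * (c + \<epsilon> / 2) * n)" for n
  proof (induction n)
    case 0
    show ?case by (simp add: W_def S0)
  next
    case (Suc n)
    have "W (S (Suc n)) \<le> W (S n) * exp (- \<eta> * (c + \<epsilon> / 2))" by (rule step)
    also have "\<dots> \<le> card T * exp (- \<eta> * (c + \<epsilon> / 2) * n) * exp (- \<eta> * (c + \<epsilon> / 2))"
      using Suc.IH by (intro mult_right_mono) auto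
    also have "\<dots> = card T * exp (- \<eta> * (c + \<epsilon> / 2) * Suc n)"
      by (simp add: exp_add[symmetric] algebra_simps)
    finally show ?case .
  qed
  \<comment> \<open>By \<open>avg\<close> some point has accumulated loss at most N c, so its term
    in the potential is at least exp(-\<eta> N c). The potential is at most this times card T *
    exp(-\<eta> \<epsilon> N / 2), which the choice of N makes smaller than 1.\<close>
  obtain N :: nat where N: "card T / (\<eta> * (\<epsilon> / 2)) < N" using reals_Archimedean2 by blast
  have "0 \<le> card T / (\<eta> * (\<epsilon> / 2))" using \<eta> \<epsilon> by simp
  then have N0: "0 < N" using N by simp
  obtain t where t: "t \<in> T" "(\<Sum>i<N. F (br (P (S i))) t) \<le> real N * c"
    using avg[OF N0, of "\<lambda>i. br (P (S i))"] br(1)[OF P] by blast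
  have "exp (- \<eta> * (real N * c)) \<le> exp (- \<eta> * S N t)"
    using t \<eta> by (simp add: Ssum)
  also have "\<dots> \<le> W (S N)" unfolding W_def by (rule member_le_sum) (use t T in auto)
  also have "\<dots> \<le> card T * exp (- \<eta> * (c + \<epsilon> / 2) * N)" by (rule Wn)
  also have "- \<eta> * (c + \<epsilon> / 2) * N = - \<eta> * (real N * c) + - (\<eta> * (\<epsilon> / 2) * N)" by (simp add: algebra_simps)
  finally have "exp (- \<eta> * (real N * c)) * 1 \<le> exp (- \<eta> * (real N * c)) * (card T * exp (- (\<eta> * (\<epsilon> / 2) * N)))"
    unfolding exp_add by (simp add: mult_ac)
  then have "1 \<le> card T * exp (- (\<eta> * (\<epsilon> / 2) * N))" by (rule mult_left_le_imp_le) simp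
  then have "exp (\<eta> * (\<epsilon> / 2) * N) \<le> card T" by (simp add: exp_minus field_simps)
  moreover have "card T < \<eta> * (\<epsilon> / 2) * N" using N \<eta> \<epsilon> by (simp add: pos_divide_less_eq mult.commute)
  moreover have "1 + \<eta> * (\<epsilon> / 2) * N \<le> exp (\<eta> * (\<epsilon> / 2) * N)" by (rule exp_ge_add_one_self)
  ultimately show False by linarith
qed

section \<open>Bodies given by averages of exponential squares\<close>

lemma expectation_exp_lin_sq:
  assumes J: "finite J" and v: "(\<Sum>j\<in>J. (v j)\<^sup>2) = 1"
  shows "integrable (Gam J) (\<lambda>x. exp ((lin J v x)\<^sup>2 / 4))" "(\<integral>x. exp ((lin J v x)\<^sup>2 / 4) \<partial>Gam J) = sqrt 2"
proof -
  have D: "distributed (Gam J) lborel (lin J v) std_normal_density"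
    using distributed_lin[OF J, of v] v by simp
  \<comment> \<open>The exponent 1/4 is below the critical 1/2, so the product is again a multiple
    of a normal density, now of variance 2; its total mass is the expectation.\<close>
  have e: "std_normal_density x * exp (x\<^sup>2 / 4) = sqrt 2 * normal_density 0 (sqrt 2) x" for x
  proof -
    have "std_normal_density x * exp (x\<^sup>2 / 4) = 1 / sqrt (2 * pi) * exp (- x\<^sup>2 / 4)"
      by (simp add: std_normal_density_def exp_add[symmetric] mult.assoc)
    moreover have "sqrt 2 * normal_density 0 (sqrt 2) x = sqrt 2 / sqrt (2 * pi * 2) * exp (- x\<^sup>2 / 4)"
      by (simp add: normal_density_def)
    moreover have "sqrt 2 / sqrt (2 * pi * 2) = 1 / sqrt (2 * pi)"
    proof -
      have "sqrt 2 / (a * sqrt 2) = 1 / a" for a :: real by simp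
      then show ?thesis by (simp only: real_sqrt_mult[of "2 * pi" 2])
    qed
    ultimately show ?thesis by (simp only:)
  qed
  have i: "integrable lborel (\<lambda>x. std_normal_density x * exp (x\<^sup>2 / 4))" unfolding e by simp
  show "integrable (Gam J) (\<lambda>x. exp ((lin J v x)\<^sup>2 / 4))"
    using distributed_integrable[OF D, of "\<lambda>x. exp (x\<^sup>2 / 4)"] i by simp
  have "(\<integral>x. exp ((lin J v x)\<^sup>2 / 4) \<partial>Gam J) = (\<integral>x. std_normal_density x * exp (x\<^sup>2 / 4) \<partial>lborel)"
    using distributed_integral[OF D, of "\<lambda>x. exp (x\<^sup>2 / 4)"] by simp
  then show "(\<integral>x. exp ((lin J v x)\<^sup>2 / 4) \<partial>Gam J) = sqrt 2" unfolding e by simp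
qed

text \<open>Convexity of the square, followed by the tangent line of exp at the weighted mean.
  Summed over directions it makes \<open>exp_body\<close> convex.\<close>

lemma exp_square_convex:
  fixes p q u v c :: real
  assumes uv: "0 \<le> u" "0 \<le> v" "u + v = 1" and c: "0 < c"
  shows "exp ((u * p + v * q)\<^sup>2 / c) \<le> u * exp (p\<^sup>2 / c) + v * exp (q\<^sup>2 / c)"
proof -
  have "u * p\<^sup>2 + v * q\<^sup>2 - (u * p + v * q)\<^sup>2 = u * v * (p - q)\<^sup>2 + (1 - (u + v)) * (u * p\<^sup>2 + v * q\<^sup>2)"
    by (simp add: power2_eq_square algebra_simps)
  also have "0 \<le> \<dots>" using uv by simp
  finally have "(u * p + v * q)\<^sup>2 \<le> u * p\<^sup>2 + v * q\<^sup>2" by simp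
  then have "(u * p + v * q)\<^sup>2 / c \<le> u * (p\<^sup>2 / c) + v * (q\<^sup>2 / c)"
    using c by (simp add: add_divide_distrib[symmetric] divide_right_mono)
  then have "exp ((u * p + v * q)\<^sup>2 / c) \<le> exp (u * (p\<^sup>2 / c) + v * (q\<^sup>2 / c))" by simp
  also have "\<dots> \<le> u * exp (p\<^sup>2 / c) + v * exp (q\<^sup>2 / c)"
  proof -
    define a b where "a = p\<^sup>2 / c" and "b = q\<^sup>2 / c"
    define m where "m = u * a + v * b"
    have 1: "exp m * (1 + (x - m)) \<le> exp x" for x
      using mult_left_mono[OF exp_ge_add_one_self[of "x - m"], of "exp m"] by (simp add: exp_diff)
    have "exp m = u * (exp m * (1 + (a - m))) + v * (exp m * (1 + (b - m)))"
    proof -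
      have "u * (exp m * (1 + (a - m))) + v * (exp m * (1 + (b - m))) = exp m * ((u + v) * (1 - m) + m)"
        unfolding m_def by (simp add: algebra_simps)
      then show ?thesis using uv by simp
    qed
    also have "\<dots> \<le> u * exp a + v * exp b" using uv 1 by (intro add_mono mult_left_mono) auto
    finally show ?thesis unfolding m_def a_def b_def .
  qed
  finally show ?thesis .
qed

text \<open>The threshold per direction is twice the Gaussian mean sqrt 2, so that Markov's
  inequality leaves mass at least 1/2.\<close>

definition exp_body :: "nat \<Rightarrow> nat \<Rightarrow> (nat \<Rightarrow> nat \<Rightarrow> real) \<Rightarrow> (nat \<Rightarrow> real) set" where
  "exp_body n N \<theta>s = {x \<in> euclid n. (\<Sum>i<N. exp ((dotp n x (\<theta>s i))\<^sup>2 / 4)) \<le> real N * (2 * sqrt 2)}"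

lemma continuous_map_exp_sum:
  fixes n N :: nat
  shows "continuous_map (powertop_real {..<n}) euclideanreal (\<lambda>x. \<Sum>i<N. exp ((dotp n x (\<theta>s i))\<^sup>2 / 4))"
proof (rule continuous_map_sum)
  fix i
  have 1: "continuous_map (powertop_real {..<n}) euclideanreal (\<lambda>x. (dotp n x (\<theta>s i))\<^sup>2 / 4)"
    unfolding dotp_def by (intro continuous_intros) auto
  have 2: "continuous_map euclideanreal euclideanreal exp"
    by (simp add: continuous_on_exp)
  show "continuous_map (powertop_real {..<n}) euclideanreal (\<lambda>x. exp ((dotp n x (\<theta>s i))\<^sup>2 / 4))"
    using continuous_map_compose[OF 1 2] by (simp add: o_def)
qed simp

lemma dotp_combination: "dotp n (\<lambda>i\<in>{..<n}. u * x i + v * y i) \<theta> = u * dotp n x \<theta> + v * dotp n y \<theta>"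
  by (simp add: dotp_def sum_distrib_left sum.distrib algebra_simps)

lemma dotp_scale: "dotp n (\<lambda>i\<in>{..<n}. u * x i) \<theta> = u * dotp n x \<theta>"
  by (simp add: dotp_def sum_distrib_left algebra_simps)

lemma symmetric_body_exp_body:
  assumes N: "0 < N"
  shows "symmetric_body n (exp_body n N \<theta>s)"
proof -
  let ?X = "powertop_real {..<n}" and ?K = "exp_body n N \<theta>s"
  let ?f = "\<lambda>x. \<Sum>i<N. exp ((dotp n x (\<theta>s i))\<^sup>2 / 4)" and ?c = "real N * (2 * sqrt 2)"
  have X: "topspace ?X = euclid n" by (simp add: euclid_def)
  have "closedin ?X {x \<in> topspace ?X. ?f x \<in> {..?c}}"
    by (rule closedin_continuous_map_preimage[OF continuous_map_exp_sum]) simp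
  then have cl: "closedin ?X ?K" unfolding X exp_body_def by (simp only: atMost_iff)
  have "openin ?X {x \<in> topspace ?X. ?f x \<in> {..<?c}}"
    by (rule openin_continuous_map_preimage[OF continuous_map_exp_sum]) simp
  then have op: "openin ?X {x \<in> euclid n. ?f x < ?c}" unfolding X by (simp only: lessThan_iff)
  have "{x \<in> euclid n. ?f x < ?c} \<subseteq> ?X interior_of ?K"
    by (rule interior_of_maximal[OF _ op]) (auto simp: exp_body_def)
  moreover have "(\<lambda>i\<in>{..<n}. 0) \<in> {x \<in> euclid n. ?f x < ?c}"
  proof -
    have "1 < sqrt (2::real)" by simp
    then have "1 < 2 * sqrt (2::real)" by linarith
    then show ?thesis using N by (simp add: euclid_def dotp_def)
  qed
  ultimately have int: "?X interior_of ?K \<noteq> {}" by blast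
  have conv: "convex_set n ?K"
    unfolding convex_set_def
  proof (intro ballI allI impI)
    fix x y and u v :: real
    assume x: "x \<in> ?K" and y: "y \<in> ?K" and uv: "0 \<le> u" "0 \<le> v" "u + v = 1"
    have "?f (\<lambda>i\<in>{..<n}. u * x i + v * y i) \<le> (\<Sum>i<N. u * exp ((dotp n x (\<theta>s i))\<^sup>2 / 4) + v * exp ((dotp n y (\<theta>s i))\<^sup>2 / 4))"
      unfolding dotp_combination using uv by (intro sum_mono exp_square_convex) auto
    also have "\<dots> = u * ?f x + v * ?f y" by (simp only: sum.distrib sum_distrib_left)
    also have "\<dots> \<le> u * ?c + v * ?c" using x y uv by (intro add_mono mult_left_mono) (auto simp: exp_body_def)
    also have "\<dots> = ?c" using uv by (simp only: distrib_right[symmetric] mult_1_left)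
    finally show "(\<lambda>i\<in>{..<n}. u * x i + v * y i) \<in> ?K" by (simp add: exp_body_def euclid_def)
  qed
  have neg: "(\<lambda>i\<in>{..<n}. -1 * x i) \<in> ?K" if "x \<in> ?K" for x
    using that unfolding exp_body_def mem_Collect_eq dotp_scale by (simp add: euclid_def)
  have sub: "dilate n (-1) ?K \<subseteq> ?K" unfolding dilate_def using neg by blast
  have "?K \<subseteq> dilate n (-1) ?K"
  proof
    fix x assume x: "x \<in> ?K"
    have "(\<lambda>i\<in>{..<n}. -1 * (\<lambda>i\<in>{..<n}. -1 * x i) i) \<in> dilate n (-1) ?K"
      unfolding dilate_def using neg[OF x] by blast
    moreover have "(\<lambda>i\<in>{..<n}. -1 * (\<lambda>i\<in>{..<n}. -1 * x i) i) = x"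
      using x by (auto simp: exp_body_def euclid_def fun_eq_iff PiE_iff extensional_def restrict_def)
    ultimately show "x \<in> dilate n (-1) ?K" by simp
  qed
  with sub have "?K = dilate n (-1) ?K" by blast
  then show ?thesis using cl int conv by (simp add: symmetric_body_def convex_body_def)
qed

lemma measure_exp_body:
  assumes N: "0 < N" and unit: "\<And>i. norm2 n (\<theta>s i) = 1"
  shows "1 / 2 \<le> measure (gauss n) (exp_body n N \<theta>s)"
proof -
  let ?J = "{..<n}"
  interpret G: prob_space "Gam ?J" by (rule prob_space_Gam)
  let ?f = "\<lambda>x. \<Sum>i<N. exp ((dotp n x (\<theta>s i))\<^sup>2 / 4)" and ?c = "real N * (2 * sqrt 2)"
  let ?E = "{x \<in> space (Gam ?J). ?c \<le> ?f x}"
  have un: "(\<Sum>j\<in>?J. (\<theta>s i j)\<^sup>2) = 1" for i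
    using unit[of i] by (simp add: norm2_def dotp_def power2_eq_square)
  have i: "integrable (Gam ?J) ?f"
    unfolding dotp_eq_lin by (intro Bochner_Integration.integrable_sum expectation_exp_lin_sq(1) un) simp
  have "(\<integral>x. ?f x \<partial>Gam ?J) = (\<Sum>i<N. \<integral>x. exp ((lin ?J (\<theta>s i) x)\<^sup>2 / 4) \<partial>Gam ?J)"
    unfolding dotp_eq_lin by (intro Bochner_Integration.integral_sum expectation_exp_lin_sq(1) un) simp
  also have "\<dots> = real N * sqrt 2" by (simp add: expectation_exp_lin_sq(2)[OF _ un])
  finally have E: "(\<integral>x. ?f x \<partial>Gam ?J) = real N * sqrt 2" .
  have fm: "?f \<in> borel_measurable (Gam ?J)" using i by (rule borel_measurable_integrable)
  have c0: "0 < ?c" using N by simp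
  have "measure (Gam ?J) ?E \<le> (\<integral>x. ?f x \<partial>Gam ?J) / ?c"
    by (rule integral_Markov_inequality_measure[OF i sets.top _ c0]) (auto intro!: AE_I2 sum_nonneg)
  also have "\<dots> = 1 / 2" unfolding E using N by simp
  finally have m: "measure (Gam ?J) ?E \<le> 1 / 2" .
  have S: "?E \<in> sets (Gam ?J)"
    by (rule borel_measurable_le[OF borel_measurable_const fm])
  have "measure (Gam ?J) (space (Gam ?J) - ?E) \<le> measure (Gam ?J) (exp_body n N \<theta>s)"
  proof (rule G.finite_measure_mono)
    show "space (Gam ?J) - ?E \<subseteq> exp_body n N \<theta>s"
      unfolding exp_body_def space_Gam euclid_def by (blast intro: linear[THEN disjE])
    have "{x \<in> space (Gam ?J). ?f x \<le> ?c} \<in> sets (Gam ?J)"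
      by (rule borel_measurable_le[OF fm borel_measurable_const])
    then show "exp_body n N \<theta>s \<in> sets (Gam ?J)" unfolding exp_body_def space_Gam euclid_def .
  qed
  then show ?thesis using G.prob_compl[OF S] m by (simp add: gauss_eq_Gam)
qed

text \<open>That \<open>T\<close> meets the dilated \<open>exp_body\<close> is exactly the
  hypothesis \<open>avg\<close> of the minimax lemma, with value 2 sqrt 2. Slack 3 - 2 sqrt 2 yields
  weights on \<open>T\<close> under which every exponential square moment is at most 3, and Markov
  gives the tails.\<close>

lemma subgaussian_exists:
  assumes n: "1 \<le> n" and T: "T \<subseteq> euclid n" "finite T" and s: "0 < s"
    and meets: "\<And>K. symmetric_body n K \<Longrightarrow> 1 / 2 \<le> measure (gauss n) K \<Longrightarrow> T \<inter> dilate n s K \<noteq> {}"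
  shows "\<exists>(M :: (nat \<Rightarrow> real) measure) Y. subgaussian n (2 * s) M Y \<and> (AE \<omega> in M. Y \<omega> \<in> T)"
proof -
  define \<Theta> where "\<Theta> = {\<theta> \<in> euclid n. norm2 n \<theta> = 1}"
  define F where "F \<theta> t = exp ((dotp n t \<theta> / s)\<^sup>2 / 4)" for \<theta> t
  have avg: "\<exists>t\<in>T. (\<Sum>i<N. F (\<theta>s i) t) \<le> real N * (2 * sqrt 2)" if N: "0 < N" and \<theta>s: "\<And>i. \<theta>s i \<in> \<Theta>" for N \<theta>s
  proof -
    have "T \<inter> dilate n s (exp_body n N \<theta>s) \<noteq> {}"
      by (rule meets[OF symmetric_body_exp_body[OF N] measure_exp_body[OF N]]) (use \<theta>s in \<open>auto simp: \<Theta>_def\<close>)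
    then obtain t x where t: "t \<in> T" and x: "x \<in> exp_body n N \<theta>s" "t = (\<lambda>i\<in>{..<n}. s * x i)"
      unfolding dilate_def by blast
    have "F \<theta> t = exp ((dotp n x \<theta>)\<^sup>2 / 4)" for \<theta> unfolding F_def x(2) dotp_scale using s by simp
    then show ?thesis using x(1) by (intro bexI[OF _ t]) (simp add: exp_body_def)
  qed
  \<comment> \<open>A unit vector, available because \<open>n\<close> is positive; it shows that
    \<open>T\<close> is nonempty and that the bound \<open>B\<close> is positive.\<close>
  have e0: "(\<lambda>i\<in>{..<n}. if i = 0 then 1 else 0) \<in> \<Theta>"
    using n by (simp add: \<Theta>_def euclid_def norm2_def dotp_def if_distrib[of "\<lambda>c. c * _"] cong: if_cong)
  have Tne: "T \<noteq> {}" using avg[of 1 "\<lambda>_. \<lambda>i\<in>{..<n}. if i = 0 then 1 else 0"] e0 by auto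
  define B where "B = Max ((\<lambda>t. exp ((norm2 n t / s)\<^sup>2 / 4)) ` T)"
  have FB: "F \<theta> t \<le> B" if "\<theta> \<in> \<Theta>" "t \<in> T" for \<theta> t
  proof -
    have "\<bar>dotp n t \<theta>\<bar> \<le> (\<Sum>i<n. \<bar>t i\<bar> * \<bar>\<theta> i\<bar>)"
      unfolding dotp_def by (rule order_trans[OF sum_abs]) (simp add: abs_mult)
    also have "\<dots> \<le> norm2 n t * norm2 n \<theta>" unfolding norm2_eq_L2_set by (rule L2_set_mult_ineq)
    also have "\<dots> = norm2 n t" using that by (simp add: \<Theta>_def)
    finally have "\<bar>dotp n t \<theta> / s\<bar> \<le> norm2 n t / s" using s by (simp add: abs_divide divide_right_mono)
    then have "\<bar>dotp n t \<theta> / s\<bar>\<^sup>2 \<le> (norm2 n t / s)\<^sup>2" by (rule power_mono) simp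
    then have "F \<theta> t \<le> exp ((norm2 n t / s)\<^sup>2 / 4)" unfolding F_def power2_abs by simp
    also have "\<dots> \<le> B" unfolding B_def using T that by (intro Max_ge) auto
    finally show ?thesis .
  qed
  obtain t0 where t0: "t0 \<in> T" using Tne by auto
  have "0 < F (\<lambda>i\<in>{..<n}. if i = 0 then 1 else 0) t0" by (simp add: F_def)
  then have B: "0 < B" using FB[OF e0 t0] by linarith
  have r: "2 * sqrt 2 < (3::real)"
  proof -
    have "(2 * sqrt 2)\<^sup>2 < (3::real)\<^sup>2" by (simp add: power_mult_distrib)
    then show ?thesis by (rule power2_less_imp_less) simp
  qed
  have "\<exists>p. (\<forall>t\<in>T. 0 \<le> p t) \<and> sum p T = 1 \<and> (\<forall>\<theta>\<in>\<Theta>. (\<Sum>t\<in>T. p t * F \<theta> t) \<le> 2 * sqrt 2 + (3 - 2 * sqrt 2))"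
    by (rule approximate_minimax[OF T(2) Tne _ FB B _ avg]) (use r in \<open>simp_all add: F_def\<close>)
  then obtain p where p: "\<forall>t\<in>T. 0 \<le> p t" "sum p T = 1" "\<forall>\<theta>\<in>\<Theta>. (\<Sum>t\<in>T. p t * F \<theta> t) \<le> 2 * sqrt 2 + (3 - 2 * sqrt 2)"
    by blast
  define M where "M = point_measure T (\<lambda>t. ennreal (p t))"
  have sp: "space M = T" by (simp add: M_def space_point_measure)
  have pM: "prob_space M"
  proof (rule prob_spaceI)
    show "emeasure M (space M) = 1"
      unfolding sp unfolding M_def using T p by (simp add: emeasure_point_measure_finite sum_ennreal)
  qed
  have mM: "measure M X = sum p X" if "X \<subseteq> T" for X
  proof -
    have "emeasure M X = ennreal (sum p X)"
      unfolding M_def using T p(1) that by (subst emeasure_point_measure_finite) (auto intro!: sum_ennreal)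
    moreover have "0 \<le> sum p X" using p(1) that by (intro sum_nonneg) auto
    ultimately show ?thesis by (simp add: measure_def)
  qed
  have "random_vector n M (\<lambda>x. x)"
    unfolding random_vector_def using pM T by (auto simp: M_def space_PiM euclid_def)
  moreover have "measure M {\<omega> \<in> space M. \<bar>dotp n \<omega> \<theta>\<bar> \<ge> t} \<le> 2 * exp (- (t / (2 * s))\<^sup>2 / 2)"
    if \<theta>: "\<theta> \<in> euclid n" "norm2 n \<theta> = 1" and t: "0 \<le> t" for \<theta> t
  proof -
    let ?X = "{\<omega> \<in> T. \<bar>dotp n \<omega> \<theta>\<bar> \<ge> t}"
    \<comment> \<open>At scale \<open>2 * s\<close> the Gaussian factor is the square root of the
      one that Markov produces. The mass is at most both 1 and 3 q^2, hence at most 2 q: the first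
      bound serves q >= 1/2, the second the rest.\<close>
    define q where "q = exp (- (t / (2 * s))\<^sup>2 / 2)"
    have q: "0 < q" "q\<^sup>2 = exp (- ((t / s)\<^sup>2 / 4))"
      by (auto simp: q_def power2_eq_square exp_add[symmetric])
    have "sum p ?X * exp ((t / s)\<^sup>2 / 4) \<le> (\<Sum>\<omega>\<in>?X. p \<omega> * F \<theta> \<omega>)"
      unfolding sum_distrib_right
    proof (rule sum_mono)
      fix \<omega> assume \<omega>: "\<omega> \<in> ?X"
      have "t / s \<le> \<bar>dotp n \<omega> \<theta> / s\<bar>" using \<omega> s by (simp add: abs_divide divide_right_mono)
      then have "(t / s)\<^sup>2 \<le> \<bar>dotp n \<omega> \<theta> / s\<bar>\<^sup>2" using t s by (intro power_mono) auto
      then have "exp ((t / s)\<^sup>2 / 4) \<le> F \<theta> \<omega>" unfolding F_def power2_abs by simp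
      then show "p \<omega> * exp ((t / s)\<^sup>2 / 4) \<le> p \<omega> * F \<theta> \<omega>" using p(1) \<omega> by (intro mult_left_mono) auto
    qed
    also have "\<dots> \<le> (\<Sum>\<omega>\<in>T. p \<omega> * F \<theta> \<omega>)"
      using T p(1) by (intro sum_mono2) (auto simp: F_def)
    also have "\<dots> \<le> 3" using p(3) \<theta> by (auto simp: \<Theta>_def)
    finally have "sum p ?X \<le> 3 * q\<^sup>2" unfolding q(2) by (simp add: exp_minus field_simps)
    moreover have "sum p ?X \<le> 1"
      unfolding p(2)[symmetric] using T p(1) by (intro sum_mono2) auto
    ultimately have "sum p ?X \<le> 2 * q"
    proof (cases "1 / 2 \<le> q")
      case False
      then have "3 * q\<^sup>2 \<le> 3 / 2 * q" using q(1) by (simp add: power2_eq_square)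
      then show ?thesis using \<open>sum p ?X \<le> 3 * q\<^sup>2\<close> q(1) by linarith
    qed simp
    then show ?thesis unfolding sp q_def by (subst mM) auto
  qed
  ultimately have "subgaussian n (2 * s) M (\<lambda>x. x)" unfolding subgaussian_def by blast
  moreover have "AE \<omega> in M. \<omega> \<in> T" using AE_space[of M] unfolding sp .
  ultimately show ?thesis by blast
qed

text \<open>Dividing by the positive finite \<open>c\<close> reduces the claim to lower bounds of
  \<open>S\<close>, so an empty \<open>S\<close> with infimum \<infinity> and an infimum 0 need no
  separate treatment.\<close>

lemma Inf_ereal_le_scaled:
  assumes c: "0 < c" and sub: "\<And>s. s \<in> S \<Longrightarrow> c * s \<in> S'"
  shows "Inf (ereal ` S') \<le> ereal c * Inf (ereal ` S)"
proof -
  have "Inf (ereal ` S') / ereal c \<le> Inf (ereal ` S)"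
  proof (rule Inf_greatest)
    fix x assume "x \<in> ereal ` S"
    then obtain s where s: "s \<in> S" "x = ereal s" by auto
    have "Inf (ereal ` S') \<le> ereal (c * s)" using sub[OF s(1)] by (intro Inf_lower) auto
    then show "Inf (ereal ` S') / ereal c \<le> x" using c s by (simp add: ereal_divide_le_pos)
  qed
  then show ?thesis using c by (simp add: ereal_divide_le_pos)
qed

theorem theorem1p2:
  "\<exists>c\<^sub>1 c\<^sub>2 :: real. c\<^sub>1 > 0 \<and> c\<^sub>2 > 0 \<and>
     (\<forall>(n::nat) (T :: (nat \<Rightarrow> real) set). n \<ge> 1 \<and> T \<subseteq> euclid n \<and> finite T \<longrightarrow>
        s_b n T \<le> ereal c\<^sub>1 * s_g n T \<and> s_g n T \<le> ereal c\<^sub>2 * s_b n T)"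
proof (intro exI conjI allI impI)
  show "0 < c_body" by (rule c_body_pos)
  show "(0 :: real) < 2" by simp
  fix n :: nat and T :: "(nat \<Rightarrow> real) set"
  assume "n \<ge> 1 \<and> T \<subseteq> euclid n \<and> finite T"
  then have n: "1 \<le> n" and T: "T \<subseteq> euclid n" "finite T" by auto
  show "s_b n T \<le> ereal c_body * s_g n T"
    unfolding s_b_def s_g_def
  proof (rule Inf_ereal_le_scaled[OF c_body_pos], safe)
    fix s :: real and M :: "(nat \<Rightarrow> real) measure" and Y
    assume s: "0 < s" and Y: "subgaussian n s M Y" "AE \<omega> in M. Y \<omega> \<in> T"
    show "0 < c_body * s" using c_body_pos s by simp
    fix K assume K: "symmetric_body n K" "1 / 2 \<le> measure (gauss n) K" and "T \<inter> dilate n (c_body * s) K = {}"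
    then show False using subgaussian_meets_body[OF T s Y K] by blast
  qed
  show "s_g n T \<le> ereal 2 * s_b n T"
    unfolding s_b_def s_g_def
  proof (rule Inf_ereal_le_scaled)
    fix s :: real
    assume "s \<in> {s. 0 < s \<and> (\<forall>K. symmetric_body n K \<and> 1 / 2 \<le> measure (gauss n) K \<longrightarrow> T \<inter> dilate n s K \<noteq> {})}"
    then have s: "0 < s" and "\<And>K. symmetric_body n K \<Longrightarrow> 1 / 2 \<le> measure (gauss n) K \<Longrightarrow> T \<inter> dilate n s K \<noteq> {}"
      by blast+
    from subgaussian_exists[OF n T this]
    show "2 * s \<in> {s. 0 < s \<and> (\<exists>(M :: (nat \<Rightarrow> real) measure) Y. subgaussian n s M Y \<and> (AE \<omega> in M. Y \<omega> \<in> T))}"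
      using s by simp
  qed simp
qed

end
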